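(* Let $L>0$, let $g:\mathbb{R}\to\mathbb{R}$ be continuous and nondecreasing with $g(0)=0$, and let $F:\mathbb{R}\to\mathbb{R}$ be globally Lipschitz continuous with $F(0)=0$. Let $q\in(0,1/2)$. Assume that $$\alpha_1|s|\le|g(s)|\le\alpha_2|s|\quad\text{for all }s\in\mathbb{R},$$ for some positive constants $\alpha_1\le\alpha_2$ satisfying $$\frac{\alpha_1}{1+\alpha_2^2}>q .$$ Then the following hold for the system (P). 1. (Global version.) If $F$ is globally $q$-Lipschitz, then there exist positive constants $M$ and $\mu$ (independent of the solution) such that every weak solution $\mathbf{u}$ of (P) satisfies $$\mathcal{E}^{\mathbf{u}}(t)\le M\exp(-\mu t)\,\mathcal{E}^{\mathbf{u}}(0)\quad\text{for all }t\ge0. \qquad(\ast)$$ 2. (Local version.) If $F$ is $q$-Lipschitz in some neighborhood $\mathcal{N}$ of $0$, then there exist $R>0$ and positive constants $M$ and $\mu$ (independent of the solution) such that $(\ast)$ holds for all weak solutions $\mathbf{u}$ of (P) satisfying $\mathcal{E}^{\mathbf{u}}(0)\le R$. (System (P), weak solutions and $\mathcal{E}^{\mathbf{u}}$ are defined in the context.)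
   Context: Setting. Let $\Omega=(0,L)$. System (P) is $$\partial_{tt}u-\partial_{xx}u=0 \text{ on }\Omega\times\mathbb{R}^+,\qquad \partial_{tt}u(0,t)-\partial_xu(0,t)=F(\partial_tu(0,t)),\qquad \partial_xu(L,t)=-g(\partial_tu(L,t)).$$ Spaces. $H=L^2(\Omega)\times\mathbb{R}$ with scalar product $((u_1,\theta_1),(u_2,\theta_2))_H=\int_\Omega u_1u_2\,dx+\theta_1\theta_2$. $V=\{(u,u(0)):u\in H^1(\Omega)\}$, a closed subspace of $H^1(\Omega)\times\mathbb{R}$, with the inherited scalar product. $\mathcal{H}=V\times H$ with the product Hilbert structure. Elements of $H$ are written $\mathbf{v}=(v,\theta)$, elements of $V$ are written $\mathbf{u}=(u,u(0))$, and elements of $\mathcal{H}$ are written $[\mathbf{u},\mathbf{v}]$. $W=\{\mathbf{u}\in V:u\in H^2(\Omega)\}$. Cauchy problem. (P) is recast as $\dot{\mathbf{X}}(t)+\mathcal{A}_g(\mathbf{X}(t))=\mathcal{F}(\mathbf{X}(t))$, $\mathbf{X}(0)=\mathbf{X}^0$, where $\mathbf{X}=[\mathbf{u},\mathbf{v}]$ with $\mathbf{v}=\mathbf{u}'$, $\mathcal{D}(\mathcal{A}_g)=\{[\mathbf{u},\mathbf{v}]\in W\times V:\partial_xu(L)=-g(v(L))\}$, $\mathcal{A}_g([\mathbf{u},\mathbf{v}])=-[\mathbf{v},(\partial_{xx}u,\partial_xu(0))]$, and $\mathcal{F}([\mathbf{u},(v,\theta)])=[0,(0,F(\theta))]$.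 Solutions. A strong solution is a (locally) absolutely continuous $\mathcal{H}$-valued function on $\mathbb{R}^+$ satisfying the differential equation for a.e. $t\ge0$, with initial data in $\mathcal{D}(\mathcal{A}_g)$. A weak solution, with initial data in $\mathcal{H}$, is a limit of strong solutions in $\mathcal{C}([0,T],\mathcal{H})$ for every $T>0$. It is known that for every $[\mathbf{u}^0,\mathbf{v}^0]\in\mathcal{H}$ there is a unique weak solution $[\mathbf{u},\mathbf{u}']$, with $\mathbf{u}\in\mathcal{C}(\mathbb{R}^+,V)\cap\mathcal{C}^1(\mathbb{R}^+,H)$; one calls $\mathbf{u}$ itself the weak solution. Energy. For $[\mathbf{u},\mathbf{v}]\in\mathcal{H}$, $\mathcal{E}(\mathbf{u},\mathbf{v})=\frac12\left\{\int_\Omega|\partial_xu|^2dx+\|\mathbf{v}\|_H^2\right\}$. For a weak solution $\mathbf{u}$, $\mathcal{E}^{\mathbf{u}}(t)=\mathcal{E}(\mathbf{u}(t),\mathbf{u}'(t))$. A function is $q$-Lipschitz on a set if $|F(s_1)-F(s_2)|\le q|s_1-s_2|$ for all $s_1,s_2$ in that set. *)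

theory Defs
  imports "HOL-Analysis.Analysis" "HOL-Library.Function_Algebras"
begin

text \<open>
  Elements of the function spaces over \<open>(0,L)\<close> are represented by functions \<^typ>\<open>real \<Rightarrow> real\<close>,
  identified when they agree almost everywhere on \<open>(0,L)\<close>. All notions below depend only on the
  classes, limits being taken with respect to the seminorms that become norms on the quotients.
  The pointwise vector space structure on functions (and hence on tuples of functions) is used for
  the linear operations; \<open>HOL-Library.Function_Algebras\<close> lacks the scalar multiplication.
\<close>

instantiation "fun" :: (type, real_vector) real_vector
begin

definition scaleR_fun :: "real \<Rightarrow> ('a \<Rightarrow> 'b) \<Rightarrow> 'a \<Rightarrow> 'b"
  where "scaleR_fun c f = (\<lambda>x. c *\<^sub>R f x)"

instance
  by standard (simp_all add: scaleR_fun_def plus_fun_def fun_eq_iff algebra_simps)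

end


section \<open>Sobolev spaces on an interval\<close>

abbreviation Omega :: "real \<Rightarrow> real measure"
  where "Omega L \<equiv> lebesgue_on {0<..<L}"

definition L2 :: "real \<Rightarrow> (real \<Rightarrow> real) set"
  where "L2 L = {f \<in> borel_measurable (Omega L). integrable (Omega L) (\<lambda>x. (f x)\<^sup>2)}"

definition test_functions :: "real \<Rightarrow> (real \<Rightarrow> real) set"
  where "test_functions L =
    {\<phi>. \<phi> C1_differentiable_on UNIV \<and>
         (\<exists>K. compact K \<and> K \<subseteq> {0<..<L} \<and> (\<forall>x. x \<notin> K \<longrightarrow> \<phi> x = 0))}"

definition has_weak_deriv :: "real \<Rightarrow> (real \<Rightarrow> real) \<Rightarrow> (real \<Rightarrow> real) \<Rightarrow> bool"
  where "has_weak_deriv L u w \<longleftrightarrow> u \<in> L2 L \<and> w \<in> L2 L \<and>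
    (\<forall>\<phi>\<in>test_functions L.
       (\<integral>x. u x * deriv \<phi> x \<partial>Omega L) = - (\<integral>x. w x * \<phi> x \<partial>Omega L))"

definition H1 :: "real \<Rightarrow> (real \<Rightarrow> real) set"
  where "H1 L = {u. \<exists>w. has_weak_deriv L u w}"

definition weak_deriv :: "real \<Rightarrow> (real \<Rightarrow> real) \<Rightarrow> real \<Rightarrow> real"
  where "weak_deriv L u = (SOME w. has_weak_deriv L u w)"

definition H2 :: "real \<Rightarrow> (real \<Rightarrow> real) set"
  where "H2 L = {u \<in> H1 L. weak_deriv L u \<in> H1 L}"

text \<open>
  For \<open>u \<in> H\<^sup>1(0,L)\<close> and \<open>a \<in> [0,L]\<close>, \<open>u(a)\<close> means the value at \<open>a\<close> of the representative of \<open>u\<close>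
  that is continuous on \<open>[0,L]\<close>.
\<close>

definition point_value :: "real \<Rightarrow> (real \<Rightarrow> real) \<Rightarrow> real \<Rightarrow> real"
  where "point_value L u a =
    (SOME f. continuous_on {0..L} f \<and> (AE x in Omega L. f x = u x)) a"


section \<open>The state space\<close>

type_synonym pair = "(real \<Rightarrow> real) \<times> real"
type_synonym state = "pair \<times> pair"

definition inner_H :: "real \<Rightarrow> pair \<Rightarrow> pair \<Rightarrow> real"
  where "inner_H L v w = (\<integral>x. fst v x * fst w x \<partial>Omega L) + snd v * snd w"

definition norm_H :: "real \<Rightarrow> pair \<Rightarrow> real"
  where "norm_H L v = sqrt (inner_H L v v)"

definition H_space :: "real \<Rightarrow> pair set"
  where "H_space L = L2 L \<times> UNIV"

definition inner_H1 :: "real \<Rightarrow> (real \<Rightarrow> real) \<Rightarrow> (real \<Rightarrow> real) \<Rightarrow> real"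
  where "inner_H1 L u w =
    (\<integral>x. u x * w x \<partial>Omega L) + (\<integral>x. weak_deriv L u x * weak_deriv L w x \<partial>Omega L)"

definition inner_V :: "real \<Rightarrow> pair \<Rightarrow> pair \<Rightarrow> real"
  where "inner_V L u w = inner_H1 L (fst u) (fst w) + snd u * snd w"

definition V_space :: "real \<Rightarrow> pair set"
  where "V_space L = {(u, c). u \<in> H1 L \<and> c = point_value L u 0}"

definition W_space :: "real \<Rightarrow> pair set"
  where "W_space L = {(u, c) \<in> V_space L. u \<in> H2 L}"

definition state_space :: "real \<Rightarrow> state set"
  where "state_space L = V_space L \<times> H_space L"

definition inner_state :: "real \<Rightarrow> state \<Rightarrow> state \<Rightarrow> real"
  where "inner_state L X Y = inner_V L (fst X) (fst Y) + inner_H L (snd X) (snd Y)"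

definition norm_state :: "real \<Rightarrow> state \<Rightarrow> real"
  where "norm_state L X = sqrt (inner_state L X X)"


section \<open>The Cauchy problem\<close>

definition dom_A :: "real \<Rightarrow> (real \<Rightarrow> real) \<Rightarrow> state set"
  where "dom_A L g = {(u, v) \<in> W_space L \<times> V_space L.
    point_value L (weak_deriv L (fst u)) L = - g (point_value L (fst v) L)}"

definition op_A :: "real \<Rightarrow> state \<Rightarrow> state"
  where "op_A L = (\<lambda>(u, v).
    - (v, (weak_deriv L (weak_deriv L (fst u)), point_value L (weak_deriv L (fst u)) 0)))"

definition op_F :: "(real \<Rightarrow> real) \<Rightarrow> state \<Rightarrow> state"
  where "op_F F = (\<lambda>(u, (v, \<theta>)). (0, (0, F \<theta>)))"

text \<open>
  Differentiability and absolute continuity on \<open>[0,\<infinity>)\<close> with respect to a (semi)norm \<open>N\<close>; at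
  \<open>t = 0\<close> the derivative is one-sided.
\<close>

definition has_deriv_wrt ::
    "('a::real_vector \<Rightarrow> real) \<Rightarrow> (real \<Rightarrow> 'a) \<Rightarrow> 'a \<Rightarrow> real \<Rightarrow> bool"
  where "has_deriv_wrt N X Y t \<longleftrightarrow>
    ((\<lambda>s. N ((1 / (s - t)) *\<^sub>R (X s - X t) - Y)) \<longlongrightarrow> 0) (at t within {0..})"

definition locally_abs_cont_wrt :: "('a::real_vector \<Rightarrow> real) \<Rightarrow> (real \<Rightarrow> 'a) \<Rightarrow> bool"
  where "locally_abs_cont_wrt N X \<longleftrightarrow>
    (\<forall>T>0. \<forall>\<epsilon>>0. \<exists>\<delta>>0. \<forall>(n::nat) a b.
       (\<forall>i<n. 0 \<le> a i \<and> a i \<le> b i \<and> b i \<le> T) \<and>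
       disjoint_family_on (\<lambda>i. {a i<..<b i}) {..<n} \<and>
       (\<Sum>i<n. b i - a i) < \<delta>
       \<longrightarrow> (\<Sum>i<n. N (X (b i) - X (a i))) < \<epsilon>)"

definition strong_solution ::
    "real \<Rightarrow> (real \<Rightarrow> real) \<Rightarrow> (real \<Rightarrow> real) \<Rightarrow> (real \<Rightarrow> state) \<Rightarrow> bool"
  where "strong_solution L g F X \<longleftrightarrow>
    (\<forall>t\<ge>0. X t \<in> state_space L) \<and>
    X 0 \<in> dom_A L g \<and>
    locally_abs_cont_wrt (norm_state L) X \<and>
    (AE t in lebesgue_on {0..}. X t \<in> dom_A L g \<and>
       has_deriv_wrt (norm_state L) X (op_F F (X t) - op_A L (X t)) t)"

definition weak_state_solution ::
    "real \<Rightarrow> (real \<Rightarrow> real) \<Rightarrow> (real \<Rightarrow> real) \<Rightarrow> (real \<Rightarrow> state) \<Rightarrow> bool"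
  where "weak_state_solution L g F X \<longleftrightarrow>
    (\<forall>t\<ge>0. X t \<in> state_space L) \<and>
    (\<exists>Xs. (\<forall>n. strong_solution L g F (Xs n)) \<and>
       (\<forall>T>0. uniform_limit {0..T} (\<lambda>n t. norm_state L (Xs n t - X t)) (\<lambda>t. 0) sequentially))"

definition weak_solution ::
    "real \<Rightarrow> (real \<Rightarrow> real) \<Rightarrow> (real \<Rightarrow> real) \<Rightarrow> (real \<Rightarrow> pair) \<Rightarrow> bool"
  where "weak_solution L g F u \<longleftrightarrow> (\<exists>v. weak_state_solution L g F (\<lambda>t. (u t, v t)))"


section \<open>Energy\<close>

definition energy :: "real \<Rightarrow> state \<Rightarrow> real"
  where "energy L = (\<lambda>(u, v).
    1 / 2 * ((\<integral>x. (weak_deriv L (fst u) x)\<^sup>2 \<partial>Omega L) + (norm_H L v)\<^sup>2))"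

text \<open>
  The derivative of an \<open>H\<close>-valued function. The restriction to \<^const>\<open>H_space\<close> is essential:
  \<^const>\<open>norm_H\<close> is meaningless outside it, since integrals of non-integrable functions are \<open>0\<close>.
\<close>

definition H_deriv :: "real \<Rightarrow> (real \<Rightarrow> pair) \<Rightarrow> real \<Rightarrow> pair"
  where "H_deriv L u t = (SOME v. v \<in> H_space L \<and> has_deriv_wrt (norm_H L) u v t)"

definition solution_energy :: "real \<Rightarrow> (real \<Rightarrow> pair) \<Rightarrow> real \<Rightarrow> real"
  where "solution_energy L u t = energy L (u t, H_deriv L u t)"

end

theory Submission
  imports Defs
begin

text \<open>
  Write \<open>p = u\<^sub>x\<close>, \<open>v = u\<^sub>t\<close>, \<open>\<theta> = v(0)\<close>. Along strong solutions the energy has derivative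
  \<open>\<theta> F(\<theta>) - v(L) g(v(L))\<close>, and \<open>I = \<integral> (1 + \<epsilon> x) p v dx\<close> has derivative
  \<open>1/2 ((1 + \<epsilon> L) (g(v(L))\<^sup>2 + v(L)\<^sup>2) - p(0)\<^sup>2 - \<theta>\<^sup>2 - \<epsilon> \<integral> (p\<^sup>2 + v\<^sup>2) dx)\<close>.
  If \<open>2 q < \<beta>\<close> and \<open>\<beta> (1 + \<epsilon> L) (1 + \<alpha>\<^sub>2\<^sup>2) < 2 \<alpha>\<^sub>1\<close> then \<open>E + \<beta> I\<close> is equivalent to the energy and decays
  exponentially as long as \<open>F\<close> is \<open>q\<close>-Lipschitz at the values taken by \<open>\<theta>\<close>; for small data this persists,
  because \<open>\<theta>\<^sup>2 / 2\<close> is at most the energy. The estimate passes to weak solutions by density.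
\<close>

section \<open>A mean value inequality for absolutely continuous functions\<close>

text \<open>The perturbation cannot be taken small: the anti-damping at \<open>0\<close> forces
  \<beta> above \<open>2 * q\<close>, so the equivalence of the Lyapunov function with the energy
  has to be checked for a \<beta> bounded away from \<open>0\<close>. It holds because
  \<open>\<alpha>\<^sub>1 \<le> \<alpha>\<^sub>2\<close> makes
  \<open>\<alpha>\<^sub>1 / (1 + \<alpha>\<^sub>2\<^sup>2)\<close> at most \<open>1 / 2\<close>. The
  energy itself may grow, since \<open>\<theta> * F \<theta>\<close> can be positive; hence the
  barrier that keeps \<theta> small is put on the Lyapunov function. Strong solutions are
  differentiable only almost everywhere, with values in a seminormed function space. No
  vector-valued integral is formed: increments are paired with a fixed vector or put into a
  quadratic form, and a scalar mean value inequality does the rest. It also shows that the velocity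
  component of a weak solution is its time derivative at every time, which matters because the
  energy of a solution refers to that derivative.\<close>

lemma locally_abs_cont_wrt_small_null_intervals:
  fixes f :: "real \<Rightarrow> real"
  assumes ac: "locally_abs_cont_wrt abs f"
    and null: "N \<in> null_sets lebesgue" and "0 < T" and "0 < \<epsilon>" and "0 < \<eta>"
  shows "\<exists>U. open U \<and> N \<subseteq> U \<and> (\<forall>P :: ('a \<times> real set) set. finite P \<and>
      (\<forall>p\<in>P. \<exists>c d. 0 \<le> c \<and> c \<le> d \<and> d \<le> T \<and> snd p = {c..d} \<and> snd p \<subseteq> U) \<and>
      (\<forall>p\<in>P. \<forall>p'\<in>P. p \<noteq> p' \<longrightarrow> interior (snd p) \<inter> interior (snd p') = {}) \<longrightarrow>
      (\<Sum>p\<in>P. \<bar>f (Sup (snd p)) - f (Inf (snd p))\<bar>) < \<epsilon> \<and>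
      (\<Sum>p\<in>P. Sup (snd p) - Inf (snd p)) < \<eta>)"
proof -
  obtain \<delta> where "\<delta> > 0" and \<delta>: "\<And>(n::nat) a b.
       (\<forall>i<n. 0 \<le> a i \<and> a i \<le> b i \<and> b i \<le> T) \<Longrightarrow>
       disjoint_family_on (\<lambda>i. {a i<..<b i}) {..<n} \<Longrightarrow>
       (\<Sum>i<n. b i - a i) < \<delta>
       \<Longrightarrow> (\<Sum>i<n. \<bar>f (b i) - f (a i)\<bar>) < \<epsilon>"
  proof -
    from ac \<open>0 < T\<close> \<open>0 < \<epsilon>\<close> obtain \<delta> where "\<delta> > 0" and "\<forall>(n::nat) a b.
       (\<forall>i<n. 0 \<le> a i \<and> a i \<le> b i \<and> b i \<le> T) \<and>
       disjoint_family_on (\<lambda>i. {a i<..<b i}) {..<n} \<and>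
       (\<Sum>i<n. b i - a i) < \<delta>
       \<longrightarrow> (\<Sum>i<n. \<bar>f (b i) - f (a i)\<bar>) < \<epsilon>"
      unfolding locally_abs_cont_wrt_def by blast
    then show thesis by (intro that[of \<delta>]) simp_all
  qed
  \<comment> \<open>One outer approximation controls both sums: \<eta> bounds the lengths
    themselves, \<delta> makes absolute continuity applicable.\<close>
  define \<delta>' where "\<delta>' = min \<delta> \<eta>"
  have "\<delta>' > 0" using \<open>\<delta> > 0\<close> \<open>\<eta> > 0\<close> by (simp add: \<delta>'_def)
  have N: "N \<in> sets lebesgue" using null by auto
  obtain U where U: "open U" "N \<subseteq> U" "U - N \<in> lmeasurable" "emeasure lebesgue (U - N) < ennreal \<delta>'"
    using sets_lebesgue_outer_open[OF N \<open>\<delta>' > 0\<close>] by metis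
  have "emeasure lebesgue U = emeasure lebesgue (U - N)"
    using null U(1) by (metis borel_open emeasure_Diff_null_set sets_completionI_sets sets_lborel)
  then have em: "emeasure lebesgue U < ennreal \<delta>'" using U(4) by simp
  have Uset: "U \<in> sets lebesgue" using U(1) by auto
  have Um: "U \<in> lmeasurable"
    using em Uset by (intro fmeasurableI) (auto simp: order_less_trans[OF _ ennreal_less_top])
  have mU: "measure lebesgue U < \<delta>'"
    using em Um by (metis \<open>0 < \<delta>'\<close> emeasure_eq_measure2 ennreal_less_iff measure_nonneg)
  have main: "(\<Sum>p\<in>P. \<bar>f (Sup (snd p)) - f (Inf (snd p))\<bar>) < \<epsilon> \<and> (\<Sum>p\<in>P. Sup (snd p) - Inf (snd p)) < \<eta>"
    if P: "finite P"
      "\<forall>p\<in>P. \<exists>c d. 0 \<le> c \<and> c \<le> d \<and> d \<le> T \<and> snd p = {c..d} \<and> snd p \<subseteq> U"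
      "\<forall>p\<in>P. \<forall>p'\<in>P. p \<noteq> p' \<longrightarrow> interior (snd p) \<inter> interior (snd p') = {}"
    for P :: "('a \<times> real set) set"
  proof -
    \<comment> \<open>Absolute continuity speaks of finite sequences of intervals, a tagged division
      is a finite set; an enumeration of \<open>P\<close> translates. Degenerate intervals do no
      harm, their interiors being empty.\<close>
    obtain h where h: "bij_betw h {..<card P} P"
      using ex_bij_betw_nat_finite[OF P(1)] by (auto simp: lessThan_atLeast0)
    have hP: "h i \<in> P" if "i < card P" for i using h that by (auto simp: bij_betw_def)
    have K: "0 \<le> Inf (snd p) \<and> Inf (snd p) \<le> Sup (snd p) \<and> Sup (snd p) \<le> T \<and>
        snd p = {Inf (snd p)..Sup (snd p)} \<and> snd p \<subseteq> U" if "p \<in> P" for p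
      using P(2) that by fastforce
    let ?a = "\<lambda>i. Inf (snd (h i))" and ?b = "\<lambda>i. Sup (snd (h i))"
    have int: "interior (snd p) = {Inf (snd p)<..<Sup (snd p)}" if "p \<in> P" for p
      using K[OF that] by (metis interior_atLeastAtMost_real)
    have disjP: "disjoint_family_on (\<lambda>p. {Inf (snd p)<..<Sup (snd p)}) P"
      unfolding disjoint_family_on_def using P(3) int by metis
    have disj: "disjoint_family_on (\<lambda>i. {?a i<..<?b i}) {..<card P}"
      unfolding disjoint_family_on_def
    proof (intro ballI impI)
      fix i j assume "i \<in> {..<card P}" "j \<in> {..<card P}" "i \<noteq> j"
      then have "h i \<noteq> h j" "h i \<in> P" "h j \<in> P"
        using h hP by (auto simp: bij_betw_def inj_on_def)
      then show "{?a i<..<?b i} \<inter> {?a j<..<?b j} = {}"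
        using disjP by (auto simp: disjoint_family_on_def)
    qed
    have "(\<Sum>p\<in>P. Sup (snd p) - Inf (snd p)) = (\<Sum>p\<in>P. measure lebesgue {Inf (snd p)<..<Sup (snd p)})"
      using K by (intro sum.cong) auto
    also have "\<dots> = measure lebesgue (\<Union>p\<in>P. {Inf (snd p)<..<Sup (snd p)})"
      using P(1) disjP
    proof (intro measure_finite_Union[symmetric])
      fix p assume "p \<in> P"
      with K[of p] show "emeasure lebesgue {Inf (snd p)<..<Sup (snd p)} \<noteq> \<infinity>" by simp
    qed auto
    also have "\<dots> \<le> measure lebesgue U"
    proof (rule measure_mono_fmeasurable[OF _ _ Um])
      show "(\<Union>p\<in>P. {Inf (snd p)<..<Sup (snd p)}) \<subseteq> U"
        using K int interior_subset by blast
      show "(\<Union>p\<in>P. {Inf (snd p)<..<Sup (snd p)}) \<in> sets lebesgue"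
        using P(1) by (intro sets.finite_UN) auto
    qed
    finally have len: "(\<Sum>p\<in>P. Sup (snd p) - Inf (snd p)) < \<delta>'" using mU by simp
    have "(\<Sum>i<card P. \<bar>f (?b i) - f (?a i)\<bar>) < \<epsilon>"
    proof (rule \<delta>[OF _ disj])
      show "\<forall>i<card P. 0 \<le> ?a i \<and> ?a i \<le> ?b i \<and> ?b i \<le> T" using K hP by blast
      have "(\<Sum>i<card P. ?b i - ?a i) = (\<Sum>p\<in>P. Sup (snd p) - Inf (snd p))"
        by (rule sum.reindex_bij_betw[OF h])
      then show "(\<Sum>i<card P. ?b i - ?a i) < \<delta>" using len by (simp add: \<delta>'_def)
    qed
    moreover have "(\<Sum>i<card P. \<bar>f (?b i) - f (?a i)\<bar>) = (\<Sum>p\<in>P. \<bar>f (Sup (snd p)) - f (Inf (snd p))\<bar>)"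
      by (rule sum.reindex_bij_betw[OF h])
    ultimately show ?thesis using len by (simp add: \<delta>'_def)
  qed
  show ?thesis
    by (intro exI[of _ U] conjI[OF U(1)] conjI[OF U(2)] allI impI, elim conjE) (rule main)
qed

text \<open>The straddle estimate: because \<open>t\<close> lies between \<open>c\<close> and
  \<open>d\<close>, the errors \<open>\<epsilon> * (t - c)\<close> and
  \<open>\<epsilon> * (d - t)\<close> of the linear approximation add up to
  \<open>\<epsilon> * (d - c)\<close>.\<close>

lemma real_derivative_growth:
  fixes f :: "real \<Rightarrow> real"
  assumes der: "(f has_real_derivative D) (at t within {0..})" and "D \<le> K" and "\<epsilon> > 0"
  shows "\<exists>r>0. \<forall>c d. 0 \<le> c \<and> c \<le> t \<and> t \<le> d \<and> {c..d} \<subseteq> ball t r \<longrightarrow> f d - f c \<le> (K + \<epsilon>) * (d - c)"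
proof -
  obtain r where "r > 0" and r: "\<And>y. y \<in> {0..} \<Longrightarrow> norm (y - t) < r \<Longrightarrow>
      norm (f y - f t - (y - t) * D) \<le> \<epsilon> * norm (y - t)"
    using der \<open>\<epsilon> > 0\<close> unfolding has_field_derivative_def has_derivative_within_alt
    by (metis mult.commute)
  have "f d - f c \<le> (K + \<epsilon>) * (d - c)" if "0 \<le> c" "c \<le> t" "t \<le> d" "{c..d} \<subseteq> ball t r" for c d
  proof -
    have "c \<in> ball t r" "d \<in> ball t r" using that by (auto simp del: mem_ball)
    then have "\<bar>f c - f t - (c - t) * D\<bar> \<le> \<epsilon> * (t - c)" "\<bar>f d - f t - (d - t) * D\<bar> \<le> \<epsilon> * (d - t)"
      using r[of c] r[of d] that by (auto simp: dist_norm)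
    then have "f d - f c \<le> (d - c) * D + \<epsilon> * (d - c)" by (simp add: algebra_simps abs_le_iff)
    also have "\<dots> \<le> (d - c) * K + \<epsilon> * (d - c)"
      using that mult_left_mono[OF \<open>D \<le> K\<close>, of "d - c"] by simp
    finally show ?thesis by (simp add: algebra_simps)
  qed
  with \<open>r > 0\<close> show ?thesis by blast
qed

text \<open>Cousin's lemma replaces the Lebesgue differentiation theorem: on a division fine for the
  gauge below, intervals tagged at good points contribute at most \<open>(K + \<epsilon>) * length\<close>, while those
  tagged in the exceptional null set are controlled by absolute continuity.\<close>

lemma locally_abs_cont_wrt_increment_le:
  fixes f :: "real \<Rightarrow> real"
  assumes ac: "locally_abs_cont_wrt abs f" and "0 \<le> a" and "a \<le> b"
    and ae: "AE t in lebesgue_on {0..}. t \<in> {a..b} \<longrightarrow>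
      (\<exists>D. (f has_real_derivative D) (at t within {0..}) \<and> D \<le> K)"
  shows "f b - f a \<le> K * (b - a)"
proof (rule field_le_epsilon)
  fix \<epsilon>0 :: real assume "\<epsilon>0 > 0"
  \<comment> \<open>Three errors have to fit into \<open>\<epsilon>0\<close>: the variation of
    \<open>f\<close> on the intervals tagged in \<open>N\<close>, the term
    \<open>- (K + \<epsilon>)\<close> times their length, and the slack
    \<open>\<epsilon> * (b - a)\<close> of the good ones.\<close>
  define \<epsilon> where "\<epsilon> = \<epsilon>0 / (2 + (b - a))"
  have "\<epsilon> > 0" using \<open>\<epsilon>0 > 0\<close> \<open>a \<le> b\<close> by (simp add: \<epsilon>_def)
  \<comment> \<open>Adding \<open>1\<close> keeps \<open>T\<close> positive when
    \<open>b = 0\<close>.\<close>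
  define T where "T = b + 1"
  have "T > 0" using assms by (simp add: T_def)
  let ?good = "\<lambda>t. \<exists>D. (f has_real_derivative D) (at t within {0..}) \<and> D \<le> K"
  have "AE t in lebesgue. t \<in> {a..b} \<longrightarrow> ?good t"
    using ae \<open>0 \<le> a\<close> by (subst (asm) AE_restrict_space_iff) (auto elim!: eventually_mono)
  then obtain N where N: "N \<in> null_sets lebesgue" "{t. \<not> (t \<in> {a..b} \<longrightarrow> ?good t)} \<subseteq> N"
    by (auto simp: eventually_ae_filter)
  \<comment> \<open>\<open>K\<close> may be negative, so removing the bad intervals from the length
    \<open>b - a\<close> can raise the bound; with this \<eta> it does so by at most
    \<epsilon>.\<close>
  define \<eta> where "\<eta> = \<epsilon> / (\<bar>K\<bar> + \<epsilon>)"
  have "\<eta> > 0" using \<open>\<epsilon> > 0\<close> by (simp add: \<eta>_def)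
  obtain U where "open U" "N \<subseteq> U" and U:
    "\<forall>P :: (real \<times> real set) set. finite P \<and>
      (\<forall>p\<in>P. \<exists>c d. 0 \<le> c \<and> c \<le> d \<and> d \<le> T \<and> snd p = {c..d} \<and> snd p \<subseteq> U) \<and>
      (\<forall>p\<in>P. \<forall>p'\<in>P. p \<noteq> p' \<longrightarrow> interior (snd p) \<inter> interior (snd p') = {}) \<longrightarrow>
      (\<Sum>p\<in>P. \<bar>f (Sup (snd p)) - f (Inf (snd p))\<bar>) < \<epsilon> \<and>
      (\<Sum>p\<in>P. Sup (snd p) - Inf (snd p)) < \<eta>"
    using locally_abs_cont_wrt_small_null_intervals[OF ac N(1) \<open>T > 0\<close> \<open>\<epsilon> > 0\<close> \<open>\<eta> > 0\<close>] by blast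
  have "\<exists>r>0. (t \<in> {a..b} \<and> t \<notin> N \<longrightarrow> (\<forall>c d. 0 \<le> c \<and> c \<le> t \<and> t \<le> d \<and> {c..d} \<subseteq> ball t r \<longrightarrow> f d - f c \<le> (K + \<epsilon>) * (d - c)))
      \<and> (t \<in> N \<longrightarrow> ball t r \<subseteq> U)" for t
  proof (cases "t \<in> N")
    case True
    then show ?thesis using \<open>open U\<close> \<open>N \<subseteq> U\<close> by (meson open_contains_ball subsetD)
  next
    case False
    show ?thesis
    proof (cases "t \<in> {a..b}")
      case True
      with False N obtain D where "(f has_real_derivative D) (at t within {0..})" "D \<le> K" by blast
      from real_derivative_growth[OF this \<open>\<epsilon> > 0\<close>] False show ?thesis by blast
    qed (use False zero_less_one in blast)
  qed
  then obtain r where r: "\<And>t. r t > 0"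
    "\<And>t c d. t \<in> {a..b} \<Longrightarrow> t \<notin> N \<Longrightarrow> 0 \<le> c \<Longrightarrow> c \<le> t \<Longrightarrow> t \<le> d \<Longrightarrow> {c..d} \<subseteq> ball t (r t) \<Longrightarrow> f d - f c \<le> (K + \<epsilon>) * (d - c)"
    "\<And>t. t \<in> N \<Longrightarrow> ball t (r t) \<subseteq> U" by metis
  have "gauge (\<lambda>t. ball t (r t))" using r(1) by (simp add: gauge_def)
  then obtain p where p: "p tagged_division_of {a..b}" and fine: "(\<lambda>t. ball t (r t)) fine p"
    by (rule fine_division_exists_real)
  have fin: "finite p" using p by blast
  have elt: "x \<in> k \<and> Inf k \<le> x \<and> x \<le> Sup k \<and> x \<in> {a..b} \<and> k \<subseteq> ball x (r x) \<and> k \<subseteq> {a..b} \<and> k = {Inf k..Sup k} \<and> Inf k \<le> Sup k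
      \<and> a \<le> Inf k \<and> Sup k \<le> b" if xk: "(x, k) \<in> p" for x k
  proof -
    obtain c d where "k = {c..d}" using tagged_division_ofD(4)[OF p xk] by auto
    moreover have "x \<in> k" "k \<subseteq> {a..b}" using tagged_division_ofD(2,3)[OF p xk] by auto
    moreover have "k \<subseteq> ball x (r x)" using fine xk by (auto simp: fine_def)
    ultimately show ?thesis by auto
  qed
  let ?l = "\<lambda>k::real set. Sup k - Inf k" and ?df = "\<lambda>k. f (Sup k) - f (Inf k)"
  define B where "B = {z \<in> p. fst z \<in> N}"
  have "finite B" "B \<subseteq> p" using fin by (auto simp: B_def)
  have "(\<Sum>z\<in>B. \<bar>?df (snd z)\<bar>) < \<epsilon> \<and> (\<Sum>z\<in>B. ?l (snd z)) < \<eta>"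
  proof (rule U[rule_format], intro conjI ballI impI)
    fix z assume "z \<in> B"
    then have "(fst z, snd z) \<in> p" "fst z \<in> N" by (auto simp: B_def)
    with elt[of "fst z" "snd z"] r(3)[of "fst z"] \<open>0 \<le> a\<close>
    show "\<exists>c d. 0 \<le> c \<and> c \<le> d \<and> d \<le> T \<and> snd z = {c..d} \<and> snd z \<subseteq> U"
      by (intro exI[of _ "Inf (snd z)"] exI[of _ "Sup (snd z)"]) (auto simp: T_def)
  next
    fix z z' assume "z \<in> B" "z' \<in> B" "z \<noteq> z'"
    then show "interior (snd z) \<inter> interior (snd z') = {}"
      using tagged_division_ofD(5)[OF p, of "fst z" "snd z" "fst z'" "snd z'"] \<open>B \<subseteq> p\<close>
      by (auto simp: prod_eq_iff)
  qed (rule \<open>finite B\<close>)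
  then have B: "(\<Sum>z\<in>B. \<bar>?df (snd z)\<bar>) < \<epsilon>" "(\<Sum>z\<in>B. ?l (snd z)) < \<eta>" by auto
  have lB: "(\<Sum>z\<in>B. ?l (snd z)) \<ge> 0" using elt \<open>B \<subseteq> p\<close> by (intro sum_nonneg) force
  have sumf: "(\<Sum>z\<in>p. ?df (snd z)) = f b - f a"
    using additive_tagged_division_1[OF \<open>a \<le> b\<close> p, of f] by (simp add: case_prod_unfold)
  have suml: "(\<Sum>z\<in>p. ?l (snd z)) = b - a"
    using additive_tagged_division_1[OF \<open>a \<le> b\<close> p, of "\<lambda>x. x"] by (simp add: case_prod_unfold)
  have spl: "(\<Sum>z\<in>p. h z) = (\<Sum>z\<in>B. h z) + (\<Sum>z\<in>p - B. h z)" for h :: "_ \<Rightarrow> real"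
    using sum.subset_diff[OF \<open>B \<subseteq> p\<close> fin, of h] by (simp add: add.commute)
  have "(\<Sum>z\<in>p - B. ?df (snd z)) \<le> (\<Sum>z\<in>p - B. (K + \<epsilon>) * ?l (snd z))"
  proof (rule sum_mono)
    fix z assume z: "z \<in> p - B"
    then have "z \<in> p" "fst z \<notin> N" by (auto simp: B_def)
    with elt[of "fst z" "snd z"] r(2)[of "fst z" "Inf (snd z)" "Sup (snd z)"] \<open>0 \<le> a\<close>
    show "?df (snd z) \<le> (K + \<epsilon>) * ?l (snd z)" by auto
  qed
  also have "\<dots> = (K + \<epsilon>) * ((b - a) - (\<Sum>z\<in>B. ?l (snd z)))"
    using suml spl[of "\<lambda>z. ?l (snd z)"] by (simp add: sum_distrib_left[symmetric])
  finally have 1: "(\<Sum>z\<in>p - B. ?df (snd z)) \<le> (K + \<epsilon>) * ((b - a) - (\<Sum>z\<in>B. ?l (snd z)))" .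
  have 2: "(\<Sum>z\<in>B. ?df (snd z)) \<le> (\<Sum>z\<in>B. \<bar>?df (snd z)\<bar>)" by (intro sum_mono) auto
  have "- (K + \<epsilon>) * (\<Sum>z\<in>B. ?l (snd z)) \<le> (\<bar>K\<bar> + \<epsilon>) * (\<Sum>z\<in>B. ?l (snd z))"
    using lB \<open>\<epsilon> > 0\<close> by (intro mult_right_mono) auto
  also have "\<dots> \<le> (\<bar>K\<bar> + \<epsilon>) * \<eta>" using B(2) \<open>\<epsilon> > 0\<close> by (intro mult_left_mono) auto
  also have "\<dots> = \<epsilon>" using \<open>\<epsilon> > 0\<close> by (simp add: \<eta>_def)
  finally have "- (K + \<epsilon>) * (\<Sum>z\<in>B. ?l (snd z)) \<le> \<epsilon>" .
  then have "f b - f a \<le> \<epsilon> + (K + \<epsilon>) * (b - a) + \<epsilon>"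
    using sumf spl[of "\<lambda>z. ?df (snd z)"] 1 2 B(1) by (simp add: algebra_simps)
  also have "\<dots> = K * (b - a) + \<epsilon> * (2 + (b - a))" by (simp add: algebra_simps)
  also have "\<epsilon> * (2 + (b - a)) = \<epsilon>0" using \<open>a \<le> b\<close> by (simp add: \<epsilon>_def)
  finally show "f b - f a \<le> K * (b - a) + \<epsilon>0" .
qed

section \<open>Absolute continuity on the half-line\<close>

text \<open>The common source of absolute continuity for images under bounded linear maps, quadratic
  forms and products with exponentials. The summand \<open>t - s\<close> admits Lipschitz dependence
  on time, and \<open>C\<close> may depend on \<open>T\<close>.\<close>

lemma locally_abs_cont_wrt_dominated:
  fixes X :: "real \<Rightarrow> 'a::real_vector" and Y :: "real \<Rightarrow> 'b::real_vector"
  assumes ac: "locally_abs_cont_wrt N X"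
    and dom: "\<And>T. T > 0 \<Longrightarrow> \<exists>C\<ge>0. \<forall>s t. 0 \<le> s \<and> s \<le> t \<and> t \<le> T \<longrightarrow>
      N' (Y t - Y s) \<le> C * (N (X t - X s) + (t - s))"
  shows "locally_abs_cont_wrt N' Y"
  unfolding locally_abs_cont_wrt_def
proof (intro allI impI)
  fix T \<epsilon> :: real assume "T > 0" "\<epsilon> > 0"
  obtain C where "C \<ge> 0" and C: "\<And>s t. 0 \<le> s \<Longrightarrow> s \<le> t \<Longrightarrow> t \<le> T \<Longrightarrow>
      N' (Y t - Y s) \<le> C * (N (X t - X s) + (t - s))"
    using dom[OF \<open>T > 0\<close>] by blast
  define e where "e = \<epsilon> / (2 * (C + 1))"
  have "e > 0" using \<open>\<epsilon> > 0\<close> \<open>C \<ge> 0\<close> by (simp add: e_def)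
  obtain \<delta> where "\<delta> > 0" and \<delta>: "\<forall>(n::nat) a b.
       (\<forall>i<n. 0 \<le> a i \<and> a i \<le> b i \<and> b i \<le> T) \<and>
       disjoint_family_on (\<lambda>i. {a i<..<b i}) {..<n} \<and> (\<Sum>i<n. b i - a i) < \<delta>
       \<longrightarrow> (\<Sum>i<n. N (X (b i) - X (a i))) < e"
    using ac \<open>T > 0\<close> \<open>e > 0\<close> unfolding locally_abs_cont_wrt_def by blast
  show "\<exists>\<delta>>0. \<forall>(n::nat) a b. (\<forall>i<n. 0 \<le> a i \<and> a i \<le> b i \<and> b i \<le> T) \<and>
       disjoint_family_on (\<lambda>i. {a i<..<b i}) {..<n} \<and> (\<Sum>i<n. b i - a i) < \<delta>
       \<longrightarrow> (\<Sum>i<n. N' (Y (b i) - Y (a i))) < \<epsilon>"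
  proof (intro exI[of _ "min \<delta> e"] conjI allI impI; (elim conjE)?)
    fix n :: nat and a b
    assume ab: "\<forall>i<n. 0 \<le> a i \<and> a i \<le> b i \<and> b i \<le> T"
      and "disjoint_family_on (\<lambda>i. {a i<..<b i}) {..<n}" and len: "(\<Sum>i<n. b i - a i) < min \<delta> e"
    then have *: "(\<Sum>i<n. N (X (b i) - X (a i))) < e" using \<delta> by simp
    have "(\<Sum>i<n. N' (Y (b i) - Y (a i))) \<le> (\<Sum>i<n. C * (N (X (b i) - X (a i)) + (b i - a i)))"
      using ab by (intro sum_mono C) auto
    also have "\<dots> = C * ((\<Sum>i<n. N (X (b i) - X (a i))) + (\<Sum>i<n. b i - a i))"
      by (simp add: sum_distrib_left[symmetric] sum.distrib)
    also have "\<dots> \<le> C * (e + e)" using * len \<open>C \<ge> 0\<close> by (intro mult_left_mono add_mono) auto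
    also have "\<dots> < (C + 1) * (e + e)" using \<open>e > 0\<close> by simp
    also have "\<dots> = \<epsilon>"
    proof -
      have "2 * (C + 1) * e = \<epsilon>" using \<open>C \<ge> 0\<close> by (simp add: e_def)
      then show ?thesis by (simp add: algebra_simps)
    qed
    finally show "(\<Sum>i<n. N' (Y (b i) - Y (a i))) < \<epsilon>" .
  qed (use \<open>\<delta> > 0\<close> \<open>e > 0\<close> in auto)
qed

lemma locally_abs_cont_wrt_small_increment:
  assumes ac: "locally_abs_cont_wrt N X" and "T > 0" and "\<epsilon> > 0"
  shows "\<exists>\<delta>>0. \<forall>s t. 0 \<le> s \<and> s \<le> t \<and> t \<le> T \<and> t - s < \<delta> \<longrightarrow> N (X t - X s) < \<epsilon>"
proof -
  obtain \<delta> where "\<delta> > 0" and \<delta>: "\<forall>(n::nat) a b.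
       (\<forall>i<n. 0 \<le> a i \<and> a i \<le> b i \<and> b i \<le> T) \<and>
       disjoint_family_on (\<lambda>i. {a i<..<b i}) {..<n} \<and> (\<Sum>i<n. b i - a i) < \<delta>
       \<longrightarrow> (\<Sum>i<n. N (X (b i) - X (a i))) < \<epsilon>"
    using ac \<open>T > 0\<close> \<open>\<epsilon> > 0\<close> unfolding locally_abs_cont_wrt_def by blast
  have "N (X t - X s) < \<epsilon>" if "0 \<le> s" "s \<le> t" "t \<le> T" "t - s < \<delta>" for s t
    using \<delta>[rule_format, of "Suc 0" "\<lambda>_. s" "\<lambda>_. t"] that by (simp add: disjoint_family_on_def)
  with \<open>\<delta> > 0\<close> show ?thesis by blast
qed

lemma locally_abs_cont_wrt_continuous_on:
  fixes f :: "real \<Rightarrow> real"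
  assumes ac: "locally_abs_cont_wrt abs f"
  shows "continuous_on {0..} f"
  unfolding continuous_on_iff
proof (intro ballI allI impI)
  fix x \<epsilon> :: real assume "x \<in> {0..}" "\<epsilon> > 0"
  then obtain \<delta> where "\<delta> > 0" and \<delta>: "\<forall>s t. 0 \<le> s \<and> s \<le> t \<and> t \<le> x + 1 \<and> t - s < \<delta> \<longrightarrow> \<bar>f t - f s\<bar> < \<epsilon>"
    using locally_abs_cont_wrt_small_increment[OF ac, of "x + 1" \<epsilon>] by auto
  have "dist (f y) (f x) < \<epsilon>" if "y \<in> {0..}" "dist y x < min \<delta> 1" for y
    using \<delta>[rule_format, of x y] \<delta>[rule_format, of y x] that \<open>x \<in> {0..}\<close>
    by (cases "x \<le> y") (auto simp: dist_real_def abs_minus_commute)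
  then show "\<exists>d>0. \<forall>y\<in>{0..}. dist y x < d \<longrightarrow> dist (f y) (f x) < \<epsilon>"
    using \<open>\<delta> > 0\<close> by (intro exI[of _ "min \<delta> 1"]) auto
qed

lemma locally_abs_cont_wrt_bounded:
  fixes f :: "real \<Rightarrow> real"
  assumes "locally_abs_cont_wrt abs f"
  obtains M where "M \<ge> 0" "\<And>t. 0 \<le> t \<Longrightarrow> t \<le> T \<Longrightarrow> \<bar>f t\<bar> \<le> M"
proof -
  have "continuous_on {0..T} f"
    using locally_abs_cont_wrt_continuous_on[OF assms] by (rule continuous_on_subset) auto
  then have "bounded (f ` {0..T})" by (intro compact_imp_bounded compact_continuous_image) auto
  then obtain M where "\<forall>t\<in>{0..T}. \<bar>f t\<bar> \<le> M" by (auto simp: bounded_iff)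
  then show thesis by (intro that[of "max M 0"]) force+
qed

lemma exp_increment_le:
  fixes \<mu> :: real
  assumes "\<mu> > 0" "s \<le> t" "t \<le> T"
  shows "\<bar>exp (\<mu> * t) - exp (\<mu> * s)\<bar> \<le> exp (\<mu> * T) * \<mu> * (t - s)"
proof -
  have "exp (\<mu> * t) * (1 - \<mu> * (t - s)) \<le> exp (\<mu> * t) * exp (- (\<mu> * (t - s)))"
    using exp_ge_add_one_self[of "- (\<mu> * (t - s))"] by (intro mult_left_mono) auto
  also have "\<dots> = exp (\<mu> * s)" by (simp add: exp_add[symmetric] algebra_simps)
  finally have "exp (\<mu> * t) - exp (\<mu> * s) \<le> exp (\<mu> * t) * (\<mu> * (t - s))" by (simp add: algebra_simps)
  also have "\<dots> \<le> exp (\<mu> * T) * (\<mu> * (t - s))" using assms by (intro mult_right_mono) auto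
  finally show ?thesis using assms by (simp add: mult.assoc)
qed

lemma locally_abs_cont_wrt_exp_mult:
  fixes f :: "real \<Rightarrow> real"
  assumes ac: "locally_abs_cont_wrt abs f" and "\<mu> > 0"
  shows "locally_abs_cont_wrt abs (\<lambda>t. exp (\<mu> * t) * f t)"
proof (rule locally_abs_cont_wrt_dominated[OF ac])
  fix T :: real assume "T > 0"
  obtain M where "M \<ge> 0" and M: "\<And>t. 0 \<le> t \<Longrightarrow> t \<le> T \<Longrightarrow> \<bar>f t\<bar> \<le> M"
    using locally_abs_cont_wrt_bounded[OF ac] by metis
  \<comment> \<open>The increment of the product splits into \<open>exp\<close> times the increment
    of \<open>f\<close> and \<open>f\<close> times the increment of \<open>exp\<close>; the summands
    \<open>1\<close> and \<open>\<mu> * M\<close> account for the two.\<close>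
  define C where "C = exp (\<mu> * T) * (1 + \<mu> * M)"
  have "C \<ge> 0" using \<open>M \<ge> 0\<close> \<open>\<mu> > 0\<close> by (simp add: C_def)
  moreover have "\<bar>exp (\<mu> * t) * f t - exp (\<mu> * s) * f s\<bar> \<le> C * (\<bar>f t - f s\<bar> + (t - s))"
    if st: "0 \<le> s" "s \<le> t" "t \<le> T" for s t
  proof -
    have "exp (\<mu> * t) * f t - exp (\<mu> * s) * f s
        = exp (\<mu> * t) * (f t - f s) + (exp (\<mu> * t) - exp (\<mu> * s)) * f s"
      by (simp add: algebra_simps)
    then have "\<bar>exp (\<mu> * t) * f t - exp (\<mu> * s) * f s\<bar>
        \<le> exp (\<mu> * t) * \<bar>f t - f s\<bar> + \<bar>exp (\<mu> * t) - exp (\<mu> * s)\<bar> * \<bar>f s\<bar>"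
      by (metis abs_exp_cancel abs_mult abs_triangle_ineq)
    also have "\<dots> \<le> exp (\<mu> * T) * \<bar>f t - f s\<bar> + exp (\<mu> * T) * \<mu> * (t - s) * M"
      using st \<open>\<mu> > 0\<close> exp_increment_le[OF \<open>\<mu> > 0\<close> st(2,3)] M[of s]
      by (intro add_mono mult_mono) auto
    also have "\<dots> \<le> C * (\<bar>f t - f s\<bar> + (t - s))"
    proof -
      have "C * (\<bar>f t - f s\<bar> + (t - s)) = exp (\<mu> * T) * \<bar>f t - f s\<bar> + exp (\<mu> * T) * \<mu> * (t - s) * M
          + (exp (\<mu> * T) * (\<mu> * M * \<bar>f t - f s\<bar>) + exp (\<mu> * T) * (t - s))"
        by (simp add: C_def algebra_simps)
      moreover have "exp (\<mu> * T) * (\<mu> * M * \<bar>f t - f s\<bar>) \<ge> 0" "exp (\<mu> * T) * (t - s) \<ge> 0"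
        using \<open>M \<ge> 0\<close> \<open>\<mu> > 0\<close> st by auto
      ultimately show ?thesis by linarith
    qed
    finally show ?thesis .
  qed
  ultimately show "\<exists>C\<ge>0. \<forall>s t. 0 \<le> s \<and> s \<le> t \<and> t \<le> T \<longrightarrow>
      \<bar>exp (\<mu> * t) * f t - exp (\<mu> * s) * f s\<bar> \<le> C * (\<bar>f t - f s\<bar> + (t - s))" by blast
qed

text \<open>Integrating factor: \<open>exp (\<mu> * t) * f t\<close> has a nonpositive derivative
  almost everywhere on \<open>{0..b}\<close>, so the mean value inequality with \<open>K = 0\<close>
  applies to it.\<close>

lemma exponential_decay_of_derivative_le:
  fixes f :: "real \<Rightarrow> real"
  assumes ac: "locally_abs_cont_wrt abs f" and "\<mu> > 0" and "0 \<le> b"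
    and ae: "AE t in lebesgue_on {0..}. t \<in> {0..b} \<longrightarrow>
      (\<exists>D. (f has_real_derivative D) (at t within {0..}) \<and> D \<le> - \<mu> * f t)"
  shows "f b \<le> exp (- \<mu> * b) * f 0"
proof -
  have "exp (\<mu> * b) * f b - exp (\<mu> * 0) * f 0 \<le> 0 * (b - 0)"
  proof (rule locally_abs_cont_wrt_increment_le[OF locally_abs_cont_wrt_exp_mult[OF ac \<open>\<mu> > 0\<close>]])
    show "AE t in lebesgue_on {0..}. t \<in> {0..b} \<longrightarrow>
      (\<exists>D. ((\<lambda>t. exp (\<mu> * t) * f t) has_real_derivative D) (at t within {0..}) \<and> D \<le> 0)"
      using ae
    proof (eventually_elim, intro impI)
      fix t assume "t \<in> {0..b} \<longrightarrow> (\<exists>D. (f has_real_derivative D) (at t within {0..}) \<and> D \<le> - \<mu> * f t)"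
        and "t \<in> {0..b}"
      then obtain D where D: "(f has_real_derivative D) (at t within {0..})" "D \<le> - \<mu> * f t" by blast
      have "((\<lambda>t. exp (\<mu> * t) * f t) has_real_derivative exp (\<mu> * t) * (D + \<mu> * f t)) (at t within {0..})"
        by (rule derivative_eq_intros D(1) refl | simp add: algebra_simps)+
      moreover have "exp (\<mu> * t) * (D + \<mu> * f t) \<le> 0" using D(2) by (simp add: mult_le_0_iff)
      ultimately show "\<exists>D. ((\<lambda>t. exp (\<mu> * t) * f t) has_real_derivative D) (at t within {0..}) \<and> D \<le> 0"
        by blast
    qed
  qed (use \<open>0 \<le> b\<close> in auto)
  then have "exp (- \<mu> * b) * (exp (\<mu> * b) * f b) \<le> exp (- \<mu> * b) * f 0"
    by (intro mult_left_mono) auto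
  then show ?thesis by (simp add: mult.assoc[symmetric] exp_add[symmetric])
qed

section \<open>Positive semidefinite forms\<close>

text \<open>Functions are not passed to quotient classes, so the forms are only semidefinite. They
  are bilinear only on a carrier \<open>S\<close>: outside the spaces in question integrals may
  default to \<open>0\<close>. The instances are the products of \<open>H\<close> and of the state
  space, and the Lyapunov form.\<close>

locale psd_form =
  fixes S :: "'a::real_vector set" and B :: "'a \<Rightarrow> 'a \<Rightarrow> real"
  assumes subspace: "subspace S"
    and sym: "x \<in> S \<Longrightarrow> y \<in> S \<Longrightarrow> B x y = B y x"
    and add_left: "x \<in> S \<Longrightarrow> y \<in> S \<Longrightarrow> z \<in> S \<Longrightarrow> B (x + y) z = B x z + B y z"
    and scale_left: "x \<in> S \<Longrightarrow> z \<in> S \<Longrightarrow> B (c *\<^sub>R x) z = c * B x z"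
    and nonneg: "x \<in> S \<Longrightarrow> 0 \<le> B x x"
begin

definition nrm :: "'a \<Rightarrow> real" where "nrm x = sqrt (B x x)"

lemma mem_intros [intro]:
  "x \<in> S \<Longrightarrow> y \<in> S \<Longrightarrow> x + y \<in> S" "x \<in> S \<Longrightarrow> y \<in> S \<Longrightarrow> x - y \<in> S" "x \<in> S \<Longrightarrow> c *\<^sub>R x \<in> S"
  using subspace by (auto intro: subspace_add subspace_diff subspace_scale)

lemma diff_left: "x \<in> S \<Longrightarrow> y \<in> S \<Longrightarrow> z \<in> S \<Longrightarrow> B (x - y) z = B x z - B y z"
  using add_left[of "x - y" y z] by (simp add: mem_intros)

lemma right:
  "x \<in> S \<Longrightarrow> y \<in> S \<Longrightarrow> z \<in> S \<Longrightarrow> B z (x + y) = B z x + B z y"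
  "x \<in> S \<Longrightarrow> y \<in> S \<Longrightarrow> z \<in> S \<Longrightarrow> B z (x - y) = B z x - B z y"
  "x \<in> S \<Longrightarrow> z \<in> S \<Longrightarrow> B z (c *\<^sub>R x) = c * B z x"
  using sym add_left diff_left scale_left by (simp_all add: mem_intros)

lemmas bilinear = add_left diff_left scale_left right

lemma nrm_nonneg [simp]: "x \<in> S \<Longrightarrow> 0 \<le> nrm x" by (simp add: nrm_def nonneg)

lemma nrm_power2: "x \<in> S \<Longrightarrow> (nrm x)\<^sup>2 = B x x" by (simp add: nrm_def nonneg)

lemma Cauchy_Schwarz:
  assumes x: "x \<in> S" and y: "y \<in> S"
  shows "\<bar>B x y\<bar> \<le> nrm x * nrm y"
proof -
  have pos: "0 \<le> B x x + 2 * s * B x y + s\<^sup>2 * B y y" for s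
    using nonneg[of "x + s *\<^sub>R y"] x y
    by (simp add: bilinear mem_intros sym[OF y x] algebra_simps power2_eq_square)
  have "(B x y)\<^sup>2 \<le> B x x * B y y"
  proof (cases "B y y = 0")
    case True
    \<comment> \<open>Semidefiniteness allows \<open>B y y = 0\<close> for nonzero \<open>y\<close>;
      the quadratic polynomial is then affine in \<open>s\<close>, and the chosen \<open>s\<close>
      would give it the value \<open>- 1\<close>.\<close>
    have "B x y = 0"
    proof (rule ccontr)
      assume "B x y \<noteq> 0"
      then show False using pos[of "- (B x x + 1) / (2 * B x y)"] True by (simp add: field_simps)
    qed
    then show ?thesis using True by simp
  next
    case False
    then have "B y y > 0" using nonneg[OF y] by simp
    \<comment> \<open>This \<open>s\<close> minimises the quadratic polynomial.\<close>
    then show ?thesis using pos[of "- B x y / B y y"] by (simp add: field_simps power2_eq_square)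
  qed
  then have "sqrt ((B x y)\<^sup>2) \<le> sqrt (B x x * B y y)" by (rule real_sqrt_le_mono)
  then show ?thesis by (simp add: nrm_def real_sqrt_mult)
qed

lemma nrm_triangle:
  assumes x: "x \<in> S" and y: "y \<in> S"
  shows "nrm (x + y) \<le> nrm x + nrm y"
proof (rule power2_le_imp_le)
  have "(nrm (x + y))\<^sup>2 = (nrm x)\<^sup>2 + 2 * B x y + (nrm y)\<^sup>2"
    using x y by (simp add: nrm_power2 bilinear mem_intros sym[OF y x])
  also have "\<dots> \<le> (nrm x + nrm y)\<^sup>2"
    using Cauchy_Schwarz[OF x y] by (simp add: power2_sum abs_le_iff)
  finally show "(nrm (x + y))\<^sup>2 \<le> (nrm x + nrm y)\<^sup>2" .
qed (use x y in auto)

lemma nrm_scale: "x \<in> S \<Longrightarrow> nrm (c *\<^sub>R x) = \<bar>c\<bar> * nrm x"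
  by (simp add: nrm_def bilinear mem_intros real_sqrt_mult mult.assoc[symmetric])

lemma nrm_minus_commute: "x \<in> S \<Longrightarrow> y \<in> S \<Longrightarrow> nrm (x - y) = nrm (y - x)"
  using nrm_scale[of "x - y" "-1"] by (simp add: mem_intros)

lemma nrm_diff_triangle: "x \<in> S \<Longrightarrow> y \<in> S \<Longrightarrow> z \<in> S \<Longrightarrow> nrm (x - z) \<le> nrm (x - y) + nrm (y - z)"
  using nrm_triangle[of "x - y" "y - z"] by (simp add: mem_intros)

lemma nrm_diff_ineq: "x \<in> S \<Longrightarrow> y \<in> S \<Longrightarrow> \<bar>nrm x - nrm y\<bar> \<le> nrm (x - y)"
  using nrm_triangle[of "x - y" y] nrm_triangle[of "y - x" x] nrm_minus_commute[of x y]
  by (simp add: mem_intros)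

text \<open>Membership in \<open>S\<close> is required only eventually because of the difference
  quotients: a trajectory is unconstrained at negative times, so its quotients lie in
  \<open>S\<close> only along the half-line.\<close>

lemma nrm_tendsto:
  assumes lim: "((\<lambda>i. nrm (Y i - y)) \<longlongrightarrow> 0) G" and "y \<in> S" and ev: "eventually (\<lambda>i. Y i \<in> S) G"
  shows "((\<lambda>i. nrm (Y i)) \<longlongrightarrow> nrm y) G" and "((\<lambda>i. B (Y i) (Y i)) \<longlongrightarrow> B y y) G"
    and "w \<in> S \<Longrightarrow> ((\<lambda>i. B (Y i) w) \<longlongrightarrow> B y w) G"
proof -
  show *: "((\<lambda>i. nrm (Y i)) \<longlongrightarrow> nrm y) G"
  proof (rule Lim_null[THEN iffD2], rule tendsto_0_le[OF lim, of _ 1])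
    show "\<forall>\<^sub>F i in G. norm (nrm (Y i) - nrm y) \<le> norm (nrm (Y i - y)) * 1"
      using ev by eventually_elim (use nrm_diff_ineq \<open>y \<in> S\<close> in force)
  qed
  have "((\<lambda>i. (nrm (Y i))\<^sup>2) \<longlongrightarrow> (nrm y)\<^sup>2) G" by (intro tendsto_intros *)
  then show "((\<lambda>i. B (Y i) (Y i)) \<longlongrightarrow> B y y) G"
    unfolding nrm_power2[OF \<open>y \<in> S\<close>]
    by (rule Lim_transform_eventually) (rule eventually_mono[OF ev nrm_power2])
  assume w: "w \<in> S"
  show "((\<lambda>i. B (Y i) w) \<longlongrightarrow> B y w) G"
  proof (rule Lim_null[THEN iffD2], rule tendsto_0_le[OF lim, of _ "nrm w"])
    show "\<forall>\<^sub>F i in G. norm (B (Y i) w - B y w) \<le> norm (nrm (Y i - y)) * nrm w"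
      using ev
    proof eventually_elim
      case (elim i)
      then show ?case using Cauchy_Schwarz[of "Y i - y" w] w \<open>y \<in> S\<close> by (simp add: bilinear mem_intros)
    qed
  qed
qed

lemma eventually_difference_quotient_mem:
  assumes "\<And>s. s \<ge> 0 \<Longrightarrow> X s \<in> S" and "t \<ge> 0"
  shows "eventually (\<lambda>s. (1 / (s - t)) *\<^sub>R (X s - X t) \<in> S) (at t within {0..})"
  using assms by (auto simp: eventually_at_filter mem_intros)

lemma has_deriv_wrt_inner:
  assumes X: "\<And>s. s \<ge> 0 \<Longrightarrow> X s \<in> S" and "t \<ge> 0" and Y: "Y \<in> S" and w: "w \<in> S"
    and der: "has_deriv_wrt nrm X Y t"
  shows "((\<lambda>s. B (X s) w) has_real_derivative B Y w) (at t within {0..})"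
proof -
  have "((\<lambda>s. B ((1 / (s - t)) *\<^sub>R (X s - X t)) w) \<longlongrightarrow> B Y w) (at t within {0..})"
    using nrm_tendsto(3)[OF der[unfolded has_deriv_wrt_def] Y
        eventually_difference_quotient_mem[OF X \<open>t \<ge> 0\<close>] w] by simp
  then show ?thesis
    unfolding has_field_derivative_iff
    by (rule tendsto_cong[THEN iffD1, rotated])
      (auto simp: eventually_at_filter bilinear mem_intros X \<open>t \<ge> 0\<close> w)
qed

text \<open>With \<open>D\<close> the difference quotient of \<open>X\<close>, that of the quadratic
  function equals \<open>2 * B D (X t) + (s - t) * B D D\<close>. Since \<open>D\<close> converges
  in the seminorm, \<open>B D D\<close> stays bounded and the second term vanishes in the
  limit.\<close>

lemma has_deriv_wrt_quadratic:
  assumes X: "\<And>s. s \<ge> 0 \<Longrightarrow> X s \<in> S" and "t \<ge> 0" and Y: "Y \<in> S"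
    and der: "has_deriv_wrt nrm X Y t"
  shows "((\<lambda>s. B (X s) (X s)) has_real_derivative 2 * B (X t) Y) (at t within {0..})"
proof -
  let ?D = "\<lambda>s. (1 / (s - t)) *\<^sub>R (X s - X t)"
  note lim = nrm_tendsto[OF der[unfolded has_deriv_wrt_def] Y
        eventually_difference_quotient_mem[OF X \<open>t \<ge> 0\<close>]]
  have "((\<lambda>s. 2 * B (?D s) (X t) + (s - t) * B (?D s) (?D s)) \<longlongrightarrow> 2 * B Y (X t) + (t - t) * B Y Y) (at t within {0..})"
    by (intro tendsto_intros lim X \<open>t \<ge> 0\<close>)
  then have "((\<lambda>s. 2 * B (?D s) (X t) + (s - t) * B (?D s) (?D s)) \<longlongrightarrow> 2 * B (X t) Y) (at t within {0..})"
    using sym[OF Y X[OF \<open>t \<ge> 0\<close>]] by simp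
  then show ?thesis
    unfolding has_field_derivative_iff
  proof (rule tendsto_cong[THEN iffD1, rotated])
    have "2 * B (?D s) (X t) + (s - t) * B (?D s) (?D s) = (B (X s) (X s) - B (X t) (X t)) / (s - t)"
      if "s \<noteq> t" "s \<ge> 0" for s
    proof -
      have "(s - t) * B (?D s) (?D s) = B (X s - X t) (?D s)"
        using that X \<open>t \<ge> 0\<close> by (simp add: bilinear(3) mem_intros)
      also have "\<dots> = B (?D s) (X s - X t)"
        using that X \<open>t \<ge> 0\<close> by (intro sym) auto
      finally have "2 * B (?D s) (X t) + (s - t) * B (?D s) (?D s) = B (?D s) (X s + X t)"
        using that X \<open>t \<ge> 0\<close> by (simp only: right mem_intros)
      also have "\<dots> = (B (X s) (X s) - B (X t) (X t)) / (s - t)"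
        using that X \<open>t \<ge> 0\<close> by (simp add: bilinear mem_intros sym[of "X s" "X t"]
            add_divide_distrib[symmetric])
      finally show ?thesis .
    qed
    then show "\<forall>\<^sub>F s in at t within {0..}. 2 * B (?D s) (X t) + (s - t) * B (?D s) (?D s)
        = (B (X s) (X s) - B (X t) (X t)) / (s - t)"
      by (simp add: eventually_at_filter)
  qed
qed

lemma abs_cont_inner:
  assumes ac: "locally_abs_cont_wrt nrm X" and X: "\<And>s. s \<ge> 0 \<Longrightarrow> X s \<in> S" and w: "w \<in> S"
  shows "locally_abs_cont_wrt abs (\<lambda>t. B (X t) w)"
proof (rule locally_abs_cont_wrt_dominated[OF ac], intro exI conjI allI impI)
  fix T s t :: real assume "0 \<le> s \<and> s \<le> t \<and> t \<le> T"
  then have "\<bar>B (X t) w - B (X s) w\<bar> \<le> nrm w * nrm (X t - X s)" "0 \<le> nrm w * (t - s)"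
    using Cauchy_Schwarz[of "X t - X s" w] X w by (auto simp: bilinear mem_intros mult.commute)
  then show "\<bar>B (X t) w - B (X s) w\<bar> \<le> nrm w * (nrm (X t - X s) + (t - s))"
    by (simp add: algebra_simps)
qed (use w in auto)

lemma abs_cont_nrm:
  assumes ac: "locally_abs_cont_wrt nrm X" and X: "\<And>s. s \<ge> 0 \<Longrightarrow> X s \<in> S"
  shows "locally_abs_cont_wrt abs (\<lambda>t. nrm (X t))"
proof (rule locally_abs_cont_wrt_dominated[OF ac], intro exI[of _ 1] conjI allI impI)
  fix T s t :: real assume "0 \<le> s \<and> s \<le> t \<and> t \<le> T"
  then show "\<bar>nrm (X t) - nrm (X s)\<bar> \<le> 1 * (nrm (X t - X s) + (t - s))"
    using nrm_diff_ineq[of "X t" "X s"] X by auto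
qed auto

lemma abs_cont_quadratic:
  assumes ac: "locally_abs_cont_wrt nrm X" and X: "\<And>s. s \<ge> 0 \<Longrightarrow> X s \<in> S"
  shows "locally_abs_cont_wrt abs (\<lambda>t. B (X t) (X t))"
proof (rule locally_abs_cont_wrt_dominated[OF ac])
  fix T :: real assume "T > 0"
  obtain M where "M \<ge> 0" and M: "\<And>t. 0 \<le> t \<Longrightarrow> t \<le> T \<Longrightarrow> \<bar>nrm (X t)\<bar> \<le> M"
    using locally_abs_cont_wrt_bounded[OF abs_cont_nrm[OF ac X]] by metis
  have "\<bar>B (X t) (X t) - B (X s) (X s)\<bar> \<le> (2 * M) * (nrm (X t - X s) + (t - s))"
    if st: "0 \<le> s" "s \<le> t" "t \<le> T" for s t
  proof -
    have S: "X s \<in> S" "X t \<in> S" using X st by auto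
    have "\<bar>B (X t) (X t) - B (X s) (X s)\<bar> = \<bar>B (X t - X s) (X t + X s)\<bar>"
      using S by (simp add: bilinear mem_intros sym[of "X s" "X t"])
    also have "\<dots> \<le> nrm (X t - X s) * nrm (X t + X s)" using S by (intro Cauchy_Schwarz) auto
    also have "\<dots> \<le> nrm (X t - X s) * (2 * M)"
      using S M[of s] M[of t] st nrm_triangle[of "X t" "X s"] by (intro mult_left_mono nrm_nonneg) auto
    also have "\<dots> \<le> (2 * M) * (nrm (X t - X s) + (t - s))"
      using \<open>M \<ge> 0\<close> st by (simp add: algebra_simps mult_left_mono)
    finally show ?thesis .
  qed
  then show "\<exists>C\<ge>0. \<forall>s t. 0 \<le> s \<and> s \<le> t \<and> t \<le> T \<longrightarrow>
      \<bar>B (X t) (X t) - B (X s) (X s)\<bar> \<le> C * (nrm (X t - X s) + (t - s))"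
    using \<open>M \<ge> 0\<close> by (intro exI[of _ "2 * M"]) auto
qed

text \<open>Testing the increment against itself reduces the claim to a scalar function.\<close>

lemma abs_cont_increment_le:
  assumes ac: "locally_abs_cont_wrt nrm U" and U: "\<And>s. s \<ge> 0 \<Longrightarrow> U s \<in> S"
    and V: "\<And>s. s \<ge> 0 \<Longrightarrow> V s \<in> S" and ab: "0 \<le> a" "a \<le> b" and c: "c \<in> S"
    and ae: "AE t in lebesgue_on {0..}. has_deriv_wrt nrm U (V t) t"
    and K: "\<And>r. a \<le> r \<Longrightarrow> r \<le> b \<Longrightarrow> nrm (V r - c) \<le> K"
  shows "nrm (U b - U a - (b - a) *\<^sub>R c) \<le> K * (b - a)"
proof -
  define w where "w = U b - U a - (b - a) *\<^sub>R c"
  have w: "w \<in> S" using U ab c by (simp add: w_def mem_intros)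
  have "B (U b) w - B (U a) w \<le> (B c w + K * nrm w) * (b - a)"
  proof (rule locally_abs_cont_wrt_increment_le[OF abs_cont_inner[OF ac U w] ab])
    have pos: "AE t in lebesgue_on {0..}. t \<ge> (0::real)" by (rule AE_I2) auto
    show "AE t in lebesgue_on {0..}. t \<in> {a..b} \<longrightarrow>
        (\<exists>D. ((\<lambda>t. B (U t) w) has_real_derivative D) (at t within {0..}) \<and> D \<le> B c w + K * nrm w)"
      using ae pos
    proof (eventually_elim, intro impI exI conjI)
      fix t assume der: "has_deriv_wrt nrm U (V t) t" and t: "0 \<le> t" "t \<in> {a..b}"
      show "((\<lambda>t. B (U t) w) has_real_derivative B (V t) w) (at t within {0..})"
        by (rule has_deriv_wrt_inner[OF U t(1) V[OF t(1)] w der])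
      have "B (V t) w - B c w \<le> nrm (V t - c) * nrm w"
        using Cauchy_Schwarz[of "V t - c" w] V[OF t(1)] c w by (simp add: bilinear mem_intros abs_le_iff)
      also have "\<dots> \<le> K * nrm w" using K[of t] t w by (intro mult_right_mono) auto
      finally show "B (V t) w \<le> B c w + K * nrm w" by simp
    qed
  qed
  then have "B w w \<le> (K * (b - a)) * nrm w"
    using U ab c w by (simp add: w_def[symmetric] bilinear mem_intros algebra_simps w_def)
  then have "nrm w * nrm w \<le> (K * (b - a)) * nrm w"
    using nrm_power2[OF w] by (simp add: power2_eq_square)
  \<comment> \<open>Cancelling \<open>nrm w\<close> is impossible when it vanishes; the claim is
    then \<open>0 \<le> K * (b - a)\<close>.\<close>
  moreover have "0 \<le> K"
    using ab V[of a] c by (intro order_trans[OF nrm_nonneg K[of a]]) auto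
  then have "0 \<le> K * (b - a)" using ab by simp
  ultimately show ?thesis
    using nrm_nonneg[OF w] by (cases "nrm w = 0") (auto simp: w_def)
qed

text \<open>An \<epsilon>/3 argument through one approximant that is uniformly close on
  \<open>{0..t + 1}\<close>, an interval reaching past \<open>t\<close> so that times on both sides
  are covered.\<close>

lemma abs_cont_uniform_limit_continuous:
  assumes acn: "\<And>n. locally_abs_cont_wrt nrm (Vs n)" and Vs: "\<And>n s. s \<ge> 0 \<Longrightarrow> Vs n s \<in> S"
    and V: "\<And>s. s \<ge> 0 \<Longrightarrow> V s \<in> S"
    and lim: "\<And>T. T > 0 \<Longrightarrow> uniform_limit {0..T} (\<lambda>n t. nrm (Vs n t - V t)) (\<lambda>t. 0) sequentially"
    and "t \<ge> 0" and "\<epsilon> > 0"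
  shows "\<exists>\<delta>>0. \<forall>r. 0 \<le> r \<and> \<bar>r - t\<bar> < \<delta> \<longrightarrow> nrm (V r - V t) \<le> \<epsilon>"
proof -
  define e where "e = \<epsilon> / 3"
  have "e > 0" using \<open>\<epsilon> > 0\<close> by (simp add: e_def)
  have "t + 1 > 0" using \<open>t \<ge> 0\<close> by simp
  from eventually_happens'[OF sequentially_bot uniform_limitD[OF lim[OF this] \<open>e > 0\<close>]] obtain n
    where "\<forall>r\<in>{0..t + 1}. dist (nrm (Vs n r - V r)) 0 < e" by blast
  then have n: "\<And>r. 0 \<le> r \<Longrightarrow> r \<le> t + 1 \<Longrightarrow> \<bar>nrm (Vs n r - V r)\<bar> < e" by simp
  obtain \<delta> where "\<delta> > 0" and \<delta>: "\<forall>s r. 0 \<le> s \<and> s \<le> r \<and> r \<le> t + 1 \<and> r - s < \<delta> \<longrightarrow> nrm (Vs n r - Vs n s) < e"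
    using locally_abs_cont_wrt_small_increment[OF acn \<open>t + 1 > 0\<close> \<open>e > 0\<close>] by blast
  have "nrm (V r - V t) \<le> \<epsilon>" if r: "0 \<le> r" "\<bar>r - t\<bar> < min \<delta> 1" for r
  proof -
    have "nrm (Vs n r - Vs n t) < e"
    proof (cases "r \<le> t")
      case True
      then show ?thesis using \<delta>[rule_format, of r t] r nrm_minus_commute[OF Vs Vs, of r t n n] \<open>t \<ge> 0\<close> by auto
    next
      case False
      then show ?thesis using \<delta>[rule_format, of t r] r \<open>t \<ge> 0\<close> by auto
    qed
    moreover have "nrm (V r - Vs n r) < e" "nrm (Vs n t - V t) < e"
      using n[of r] n[of t] r \<open>t \<ge> 0\<close> nrm_minus_commute[OF Vs[of r n] V[of r]]
      by (auto simp: abs_less_iff)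
    moreover have "nrm (V r - V t) \<le> nrm (V r - Vs n r) + (nrm (Vs n r - Vs n t) + nrm (Vs n t - V t))"
      using r \<open>t \<ge> 0\<close> Vs V nrm_diff_triangle[of "V r" "Vs n r" "V t"]
        nrm_diff_triangle[of "Vs n r" "Vs n t" "V t"] by force
    ultimately show ?thesis by (simp add: e_def)
  qed
  then show ?thesis using \<open>\<delta> > 0\<close> by (intro exI[of _ "min \<delta> 1"]) auto
qed

text \<open>The classical theorem on uniform convergence of derivatives, with the approximants
  differentiable only almost everywhere. Their increments satisfy a bound uniform in
  \<open>n\<close>, which survives the limit; as \<open>V\<close> is continuous, it yields the
  derivative at every \<open>t\<close>.\<close>

lemma uniform_limit_has_deriv_wrt:
  assumes acU: "\<And>n. locally_abs_cont_wrt nrm (Us n)" and acV: "\<And>n. locally_abs_cont_wrt nrm (Vs n)"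
    and Us: "\<And>n s. s \<ge> 0 \<Longrightarrow> Us n s \<in> S" and Vs: "\<And>n s. s \<ge> 0 \<Longrightarrow> Vs n s \<in> S"
    and U: "\<And>s. s \<ge> 0 \<Longrightarrow> U s \<in> S" and V: "\<And>s. s \<ge> 0 \<Longrightarrow> V s \<in> S"
    and ae: "\<And>n. AE t in lebesgue_on {0..}. has_deriv_wrt nrm (Us n) (Vs n t) t"
    and limU: "\<And>T. T > 0 \<Longrightarrow> uniform_limit {0..T} (\<lambda>n t. nrm (Us n t - U t)) (\<lambda>t. 0) sequentially"
    and limV: "\<And>T. T > 0 \<Longrightarrow> uniform_limit {0..T} (\<lambda>n t. nrm (Vs n t - V t)) (\<lambda>t. 0) sequentially"
    and "t \<ge> 0"
  shows "has_deriv_wrt nrm U (V t) t"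
proof -
  have Vt: "V t \<in> S" using V \<open>t \<ge> 0\<close> by simp
  \<comment> \<open>One \<epsilon> is the oscillation of \<open>V\<close> near \<open>t\<close>, the
    other the distance from \<open>Vs n\<close> to \<open>V\<close>.\<close>
  have step: "nrm (U b - U a - (b - a) *\<^sub>R V t) \<le> (\<epsilon> + \<epsilon>) * (b - a)"
    if ab: "0 \<le> a" "a \<le> b" and "\<epsilon> > 0" and near: "\<And>r. a \<le> r \<Longrightarrow> r \<le> b \<Longrightarrow> nrm (V r - V t) \<le> \<epsilon>"
    for a b \<epsilon>
  proof -
    have "b + 1 > 0" using ab by simp
    have "\<forall>\<^sub>F n in sequentially. nrm (Us n b - Us n a - (b - a) *\<^sub>R V t) \<le> (\<epsilon> + \<epsilon>) * (b - a)"
      using uniform_limitD[OF limV[OF \<open>b + 1 > 0\<close>] \<open>\<epsilon> > 0\<close>]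
    proof eventually_elim
      case (elim n)
      show ?case
      proof (rule abs_cont_increment_le[OF acU Us Vs ab Vt ae])
        fix r assume r: "a \<le> r" "r \<le> b"
        then have "nrm (Vs n r - V r) < \<epsilon>" using bspec[OF elim, of r] ab by simp
        moreover have "nrm (Vs n r - V t) \<le> nrm (Vs n r - V r) + nrm (V r - V t)"
          using r ab by (intro nrm_diff_triangle Vs V Vt) auto
        ultimately show "nrm (Vs n r - V t) \<le> \<epsilon> + \<epsilon>" using near[OF r] by linarith
      qed auto
    qed
    moreover have "(\<lambda>n. nrm (Us n b - Us n a - (b - a) *\<^sub>R V t)) \<longlonglongrightarrow> nrm (U b - U a - (b - a) *\<^sub>R V t)"
    proof (rule nrm_tendsto(1))
      have ptw: "(\<lambda>n. nrm (Us n r - U r)) \<longlonglongrightarrow> 0" if "0 \<le> r" "r \<le> b" for r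
        using tendsto_uniform_limitI[OF limU[OF \<open>b + 1 > 0\<close>], of r] that by auto
      have "(\<lambda>n. nrm (Us n b - U b) + nrm (Us n a - U a)) \<longlonglongrightarrow> 0 + 0"
        using ab by (intro tendsto_add ptw) auto
      then show "(\<lambda>n. nrm (Us n b - Us n a - (b - a) *\<^sub>R V t - (U b - U a - (b - a) *\<^sub>R V t))) \<longlonglongrightarrow> 0"
        unfolding add_0_left
      proof (rule tendsto_0_le[of _ _ _ 1], intro always_eventually allI)
        fix n
        have "nrm ((Us n b - U b) - (Us n a - U a)) \<le> nrm (Us n b - U b) + nrm (Us n a - U a)"
          using nrm_diff_triangle[of "Us n b - U b" 0 "Us n a - U a"] ab Us U
            nrm_minus_commute[of 0 "Us n a - U a"] subspace_0[OF subspace]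
          by (simp add: mem_intros)
        then have "nrm ((Us n b - U b) - (Us n a - U a)) \<le> norm (nrm (Us n b - U b) + nrm (Us n a - U a)) * 1"
          by simp
        moreover have "norm (nrm ((Us n b - U b) - (Us n a - U a))) = nrm ((Us n b - U b) - (Us n a - U a))"
          unfolding real_norm_def
          using ab by (intro abs_of_nonneg nrm_nonneg mem_intros(2) Us U) auto
        moreover have "Us n b - Us n a - (b - a) *\<^sub>R V t - (U b - U a - (b - a) *\<^sub>R V t)
            = (Us n b - U b) - (Us n a - U a)" by simp
        ultimately show "norm (nrm (Us n b - Us n a - (b - a) *\<^sub>R V t - (U b - U a - (b - a) *\<^sub>R V t)))
            \<le> norm (nrm (Us n b - U b) + nrm (Us n a - U a)) * 1"
          by (simp only:)
      qed
      show "U b - U a - (b - a) *\<^sub>R V t \<in> S"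
        using ab by (intro mem_intros(2) mem_intros(3)[OF Vt] U) auto
      show "\<forall>\<^sub>F n in sequentially. Us n b - Us n a - (b - a) *\<^sub>R V t \<in> S"
        using ab by (intro always_eventually allI mem_intros(2) mem_intros(3)[OF Vt] Us) auto
    qed
    ultimately show ?thesis by (intro tendsto_upperbound[OF _ _ sequentially_bot])
  qed
  show ?thesis
    unfolding has_deriv_wrt_def
  proof (rule tendstoI)
    fix e :: real assume "e > 0"
    \<comment> \<open>A third rather than a half: the resulting bound
      \<open>\<epsilon> + \<epsilon>\<close> has to be strictly below \<open>e\<close>.\<close>
    define \<epsilon> where "\<epsilon> = e / 3"
    have "\<epsilon> > 0" "\<epsilon> + \<epsilon> < e" using \<open>e > 0\<close> by (auto simp: \<epsilon>_def)
    obtain \<delta> where "\<delta> > 0" and \<delta>: "\<And>r. 0 \<le> r \<Longrightarrow> \<bar>r - t\<bar> < \<delta> \<Longrightarrow> nrm (V r - V t) \<le> \<epsilon>"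
      using abs_cont_uniform_limit_continuous[OF acV Vs V limV \<open>t \<ge> 0\<close> \<open>\<epsilon> > 0\<close>] by blast
    have "dist (nrm ((1 / (s - t)) *\<^sub>R (U s - U t) - V t)) 0 < e"
      if s: "s \<in> {0..}" "s \<noteq> t" "dist s t < \<delta>" for s
    proof -
      let ?w = "U s - U t - (s - t) *\<^sub>R V t"
      have w: "?w \<in> S" using s U Vt \<open>t \<ge> 0\<close> by auto
      have "nrm ?w \<le> (\<epsilon> + \<epsilon>) * \<bar>s - t\<bar>"
      proof (cases "s \<le> t")
        case True
        have "nrm (U t - U s - (t - s) *\<^sub>R V t) \<le> (\<epsilon> + \<epsilon>) * (t - s)"
          using s True \<open>\<epsilon> > 0\<close> by (intro step \<delta>) (auto simp: dist_real_def)
        moreover have "U t - U s - (t - s) *\<^sub>R V t = (-1) *\<^sub>R ?w" by (simp add: algebra_simps)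
        ultimately show ?thesis using True nrm_scale[OF w, of "-1"] by simp
      next
        case False
        then show ?thesis using step[of t s \<epsilon>] s \<open>\<epsilon> > 0\<close> \<open>t \<ge> 0\<close> \<delta> by (auto simp: dist_real_def)
      qed
      then have "\<bar>1 / (s - t)\<bar> * nrm ?w \<le> \<bar>1 / (s - t)\<bar> * ((\<epsilon> + \<epsilon>) * \<bar>s - t\<bar>)"
        by (intro mult_left_mono) auto
      also have "\<dots> = \<epsilon> + \<epsilon>" using s by (simp add: field_simps)
      finally have "nrm ((1 / (s - t)) *\<^sub>R ?w) < e"
        using nrm_scale[OF w, of "1 / (s - t)"] \<open>\<epsilon> + \<epsilon> < e\<close> by simp
      moreover have "(1 / (s - t)) *\<^sub>R ?w = (1 / (s - t)) *\<^sub>R (U s - U t) - V t"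
        using s by (simp add: scaleR_diff_right)
      ultimately show ?thesis using nrm_nonneg[OF mem_intros(3)[OF w, of "1 / (s - t)"]] by simp
    qed
    then show "\<forall>\<^sub>F s in at t within {0..}. dist (nrm ((1 / (s - t)) *\<^sub>R (U s - U t) - V t)) 0 < e"
      unfolding eventually_at using \<open>\<delta> > 0\<close> by blast
  qed
qed

text \<open>Testing against \<open>Y - Z\<close> itself reduces the claim to uniqueness of a scalar
  derivative at a limit point of the half-line. In a seminormed space the derivative is determined
  only up to null vectors, but its norm is determined, and that is all the energy uses.\<close>

lemma has_deriv_wrt_unique:
  assumes X: "\<And>s. s \<ge> 0 \<Longrightarrow> X s \<in> S" and "t \<ge> 0" and Y: "Y \<in> S" "Z \<in> S"
    and der: "has_deriv_wrt nrm X Y t" "has_deriv_wrt nrm X Z t"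
  shows "nrm (Y - Z) = 0" and "nrm Y = nrm Z"
proof -
  let ?w = "Y - Z"
  have w: "?w \<in> S" using Y by auto
  have "B Y ?w = B Z ?w"
    using has_deriv_wrt_inner[OF X \<open>t \<ge> 0\<close> Y(1) w der(1)]
      has_deriv_wrt_inner[OF X \<open>t \<ge> 0\<close> Y(2) w der(2)]
  proof (rule has_field_derivative_unique)
    have "t islimpt {0..t + 1}" using \<open>t \<ge> 0\<close> by (simp add: islimpt_Icc)
    then have "t islimpt {0..}" by (rule islimpt_subset) auto
    then show "at t within {0..} \<noteq> bot" by (simp add: trivial_limit_within)
  qed
  then have "B ?w ?w = 0" using Y w by (simp add: diff_left)
  then show *: "nrm ?w = 0" by (simp add: nrm_def)
  show "nrm Y = nrm Z" using nrm_diff_ineq[OF Y] * by simp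
qed

end

section \<open>Primitives of integrable functions\<close>

locale bounded_interval =
  fixes L :: real
  assumes L_pos: "L > 0"
begin

abbreviation M :: "real measure" where "M \<equiv> Omega L"

lemma Ioo_sets [simp, measurable]: "{0<..<L} \<in> sets lebesgue" by auto

sublocale fin: finite_measure M
  by (rule finite_measure_lebesgue_on) auto

lemma space_M [simp]: "space M = {0<..<L}" by simp

lemma AE_M_mem: "AE x in M. x \<in> {0<..<L}"
  by (rule AE_I2) auto

lemma AE_M_iff: "(AE x in M. P x) \<longleftrightarrow> (AE x in lebesgue. x \<in> {0<..<L} \<longrightarrow> P x)"
  by (rule AE_restrict_space_iff) auto

lemma AE_M_neq: "AE y in M. y \<noteq> x"
proof -
  have "AE y in lebesgue. y \<noteq> x" by (intro AE_completion AE_lborel_singleton)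
  then show ?thesis unfolding AE_M_iff by eventually_elim auto
qed

lemma measurable_ident_M [measurable]: "(\<lambda>x. x) \<in> borel_measurable M"
  by (intro measurable_restrict_space1 measurable_completion) auto

lemma borel_measurable_M: "f \<in> borel_measurable borel \<Longrightarrow> f \<in> borel_measurable M"
  by (rule measurable_compose[OF measurable_ident_M])

lemma indicator_lessThan_measurable [measurable]: "(\<lambda>y. indicat_real {..<x} y) \<in> borel_measurable M"
  by (intro borel_measurable_M) auto

lemma integrable_indicator_mult:
  fixes w :: "real \<Rightarrow> real"
  assumes "integrable M w"
  shows "integrable M (\<lambda>y. indicator {..<x} y * w y)"
  by (rule Bochner_Integration.integrable_bound[OF assms])
    (use assms in \<open>auto simp: indicator_def\<close>)

text \<open>An integral over all of \<open>Omega L\<close> with a cut-off integrand: dominated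
  convergence and Fubini then work over one fixed measure, and the function is defined on the whole
  line, constant to either side of the interval.\<close>

definition primitive :: "(real \<Rightarrow> real) \<Rightarrow> real \<Rightarrow> real"
  where "primitive w x = (\<integral>y. indicator {..<x} y * w y \<partial>M)"

lemma primitive_add:
  "integrable M v \<Longrightarrow> integrable M w \<Longrightarrow> primitive (\<lambda>y. v y + w y) x = primitive v x + primitive w x"
  unfolding primitive_def
  by (subst Bochner_Integration.integral_add[symmetric]) (auto simp: integrable_indicator_mult ring_distribs)

lemma primitive_scale: "primitive (\<lambda>y. c * w y) x = c * primitive w x"
  unfolding primitive_def
  by (subst integral_mult_right_zero[symmetric]) (simp add: algebra_simps)

lemma primitive_diff:
  "integrable M v \<Longrightarrow> integrable M w \<Longrightarrow> primitive (\<lambda>y. v y - w y) x = primitive v x - primitive w x"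
  unfolding primitive_def
  by (subst Bochner_Integration.integral_diff[symmetric]) (auto simp: integrable_indicator_mult ring_distribs)

lemma primitive_nonpos [simp]: "x \<le> 0 \<Longrightarrow> primitive w x = 0"
  unfolding primitive_def by (subst Bochner_Integration.integral_cong[OF refl, of _ _ "\<lambda>_. 0"]) (auto simp: indicator_def)

lemma primitive_ge: "x \<ge> L \<Longrightarrow> primitive w x = (\<integral>y. w y \<partial>M)"
  unfolding primitive_def by (rule Bochner_Integration.integral_cong) (auto simp: indicator_def)

lemma primitive_abs_le:
  assumes "integrable M w" shows "\<bar>primitive w x\<bar> \<le> (\<integral>y. \<bar>w y\<bar> \<partial>M)"
proof -
  have "norm (primitive w x) \<le> (\<integral>y. norm (indicator {..<x} y * w y) \<partial>M)"
    unfolding primitive_def by (rule integral_norm_bound)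
  also have "\<dots> \<le> (\<integral>y. \<bar>w y\<bar> \<partial>M)"
    using assms by (intro integral_mono integrable_norm integrable_indicator_mult integrable_abs) (auto simp: indicator_def)
  finally show ?thesis by simp
qed

text \<open>Dominated convergence: the cut-offs converge at every \<open>y\<close> other than
  \<open>x\<close>.\<close>

lemma primitive_continuous_on:
  assumes w: "integrable M w" shows "continuous_on A (primitive w)"
proof -
  have "isCont (primitive w) x" for x
    unfolding continuous_at_sequentially comp_def
  proof (intro allI impI)
    fix X :: "nat \<Rightarrow> real" assume X: "X \<longlonglongrightarrow> x"
    show "(\<lambda>n. primitive w (X n)) \<longlonglongrightarrow> primitive w x"
      unfolding primitive_def
    proof (rule integral_dominated_convergence[where w = "\<lambda>y. \<bar>w y\<bar>"])
      show "AE y in M. (\<lambda>n. indicator {..<X n} y * w y) \<longlonglongrightarrow> indicator {..<x} y * w y"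
        using AE_M_neq[of x]
      proof eventually_elim
        case (elim y)
        have "\<forall>\<^sub>F n in sequentially. indicator {..<X n} y * w y = indicator {..<x} y * w y"
        proof (cases "y < x")
          case True
          from order_tendstoD(1)[OF X True] show ?thesis by eventually_elim (use True in auto)
        next
          case False
          with elim have "x < y" by simp
          from order_tendstoD(2)[OF X this] show ?thesis by eventually_elim (use False in auto)
        qed
        then show ?case by (rule tendsto_eventually)
      qed
    qed (use w in \<open>auto simp: indicator_def\<close>)
  qed
  then show ?thesis by (simp add: continuous_at_imp_continuous_on)
qed

lemma primitive_measurable [measurable]:
  "integrable M w \<Longrightarrow> primitive w \<in> borel_measurable M"
  by (intro borel_measurable_M borel_measurable_continuous_onI primitive_continuous_on)

lemma integrable_bounded_mult:
  fixes b f :: "real \<Rightarrow> real"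
  assumes "b \<in> borel_measurable M" and "\<And>x. x \<in> {0<..<L} \<Longrightarrow> \<bar>b x\<bar> \<le> C" and "integrable M f"
  shows "integrable M (\<lambda>x. b x * f x)"
proof (rule Bochner_Integration.integrable_bound[of M "\<lambda>x. C * f x"])
  show "AE x in M. norm (b x * f x) \<le> norm (C * f x)"
    using AE_M_mem
  proof eventually_elim
    case (elim x)
    then have "\<bar>b x\<bar> \<le> \<bar>C\<bar>" using assms(2)[of x] by simp
    then show ?case by (simp add: abs_mult mult_right_mono)
  qed
qed (use assms in auto)

lemma integrable_primitive_mult:
  assumes "integrable M v" "integrable M w"
  shows "integrable M (\<lambda>x. primitive v x * w x)"
  by (rule integrable_bounded_mult[OF primitive_measurable[OF assms(1)] primitive_abs_le[OF assms(1)] assms(2)])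

text \<open>Fubini over a triangle: one integral collects the pairs below the diagonal, the other
  those above it, and the diagonal is null.\<close>

lemma integral_primitive_by_parts:
  assumes f: "integrable M f" and g: "integrable M g"
  shows "(\<integral>x. primitive f x * g x \<partial>M) + (\<integral>x. f x * primitive g x \<partial>M) = (\<integral>x. f x \<partial>M) * (\<integral>x. g x \<partial>M)"
proof -
  interpret P: pair_sigma_finite M M ..
  have [measurable]: "f \<in> borel_measurable M" "g \<in> borel_measurable M" using f g by auto
  define h where "h = (\<lambda>x y. g x * (indicator {..<x} y * f y))"
  have meas: "case_prod h \<in> borel_measurable (M \<Otimes>\<^sub>M M)"
  proof -
    have [measurable]: "snd \<in> borel_measurable (M \<Otimes>\<^sub>M M)" "fst \<in> borel_measurable (M \<Otimes>\<^sub>M M)"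
      using measurable_compose[OF measurable_snd measurable_ident_M]
        measurable_compose[OF measurable_fst measurable_ident_M] by auto
    have "case_prod h = (\<lambda>z. g (fst z) * ((if snd z < fst z then 1 else 0) * f (snd z)))"
      by (auto simp: h_def fun_eq_iff)
    then show ?thesis by simp
  qed
  have int: "integrable (M \<Otimes>\<^sub>M M) (case_prod h)"
  proof (rule P.Fubini_integrable[OF meas])
    have "(\<lambda>x. \<integral>y. norm (case_prod h (x, y)) \<partial>M) = (\<lambda>x. \<bar>g x\<bar> * primitive (\<lambda>y. \<bar>f y\<bar>) x)"
      by (simp add: h_def primitive_def abs_mult)
    moreover have "integrable M (\<lambda>x. primitive (\<lambda>y. \<bar>f y\<bar>) x * \<bar>g x\<bar>)"
      using f g by (intro integrable_primitive_mult) auto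
    ultimately show "integrable M (\<lambda>x. \<integral>y. norm (case_prod h (x, y)) \<partial>M)" by (simp add: mult.commute)
    show "AE x in M. integrable M (\<lambda>y. case_prod h (x, y))"
      using f by (simp add: h_def integrable_indicator_mult)
  qed
  have inner: "(\<integral>x. h x y \<partial>M) = f y * ((\<integral>x. g x \<partial>M) - primitive g y)" for y
  proof -
    have "(\<lambda>x. indicat_real {..<x} y) = indicat_real {y<..}" by (auto simp: indicator_def fun_eq_iff)
    then have [measurable]: "(\<lambda>x. indicat_real {..<x} y) \<in> borel_measurable M"
      by (simp add: borel_measurable_M)
    have "(\<integral>x. h x y \<partial>M) = (\<integral>x. f y * (g x - indicator {..<y} x * g x) \<partial>M)"
    proof (rule integral_cong_AE)
      show "AE x in M. h x y = f y * (g x - indicator {..<y} x * g x)"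
        using AE_M_neq[of y] by eventually_elim (auto simp: h_def indicator_def)
    qed (auto simp: h_def)
    then show ?thesis using g by (simp add: primitive_def integrable_indicator_mult)
  qed
  have "(\<integral>x. primitive f x * g x \<partial>M) = (\<integral>x. (\<integral>y. h x y \<partial>M) \<partial>M)"
    by (simp add: h_def primitive_def mult.commute)
  also have "\<dots> = (\<integral>y. f y * ((\<integral>x. g x \<partial>M) - primitive g y) \<partial>M)"
    by (subst P.Fubini_integral[OF int, symmetric]) (simp add: inner)
  also have "\<dots> = (\<integral>y. f y * (\<integral>x. g x \<partial>M) - f y * primitive g y \<partial>M)" by (simp add: right_diff_distrib)
  also have "\<dots> = (\<integral>y. f y \<partial>M) * (\<integral>x. g x \<partial>M) - (\<integral>y. f y * primitive g y \<partial>M)"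
    using f integrable_primitive_mult[OF g f] by (simp add: mult.commute)
  finally show ?thesis by simp
qed

text \<open>Integration by parts over the whole interval, applied to \<open>f\<close> and
  \<open>g\<close> cut off at \<open>x\<close>; the cut-off does not change the primitives to the
  left of \<open>x\<close>.\<close>

lemma primitive_mult_primitive:
  assumes f: "integrable M f" and g: "integrable M g"
  shows "primitive f x * primitive g x = primitive (\<lambda>y. primitive f y * g y + f y * primitive g y) x"
proof -
  let ?i = "indicat_real {..<x}"
  have [measurable]: "f \<in> borel_measurable M" "g \<in> borel_measurable M" using f g by auto
  have loc: "?i y * primitive (\<lambda>z. ?i z * k z) y = ?i y * primitive k y" for k y
  proof (cases "y < x")
    case True
    then have "primitive (\<lambda>z. ?i z * k z) y = primitive k y"
      unfolding primitive_def by (intro Bochner_Integration.integral_cong) (auto simp: indicator_def)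
    then show ?thesis by simp
  qed auto
  have "(\<integral>y. ?i y * f y \<partial>M) * (\<integral>y. ?i y * g y \<partial>M)
     = (\<integral>y. primitive (\<lambda>z. ?i z * f z) y * (?i y * g y) \<partial>M) + (\<integral>y. (?i y * f y) * primitive (\<lambda>z. ?i z * g z) y \<partial>M)"
    using integral_primitive_by_parts[of "\<lambda>y. ?i y * f y" "\<lambda>y. ?i y * g y"] f g
    by (simp add: integrable_indicator_mult)
  also have "\<dots> = (\<integral>y. ?i y * (primitive f y * g y) \<partial>M) + (\<integral>y. ?i y * (f y * primitive g y) \<partial>M)"
  proof -
    have "primitive (\<lambda>z. ?i z * f z) y * (?i y * g y) = ?i y * (primitive f y * g y)"
      "(?i y * f y) * primitive (\<lambda>z. ?i z * g z) y = ?i y * (f y * primitive g y)" for y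
      using loc[of y f] loc[of y g] by (auto simp: indicator_def)
    then show ?thesis by (simp only:)
  qed
  also have "\<dots> = primitive (\<lambda>y. primitive f y * g y) x + primitive (\<lambda>y. f y * primitive g y) x"
    by (simp add: primitive_def)
  also have "\<dots> = primitive (\<lambda>y. primitive f y * g y + f y * primitive g y) x"
    using f g integrable_primitive_mult[OF f g] integrable_primitive_mult[OF g f]
    by (intro primitive_add[symmetric]) (auto simp: mult.commute)
  finally show ?thesis by (simp add: primitive_def)
qed

lemma primitive_product:
  assumes f: "integrable M f" and g: "integrable M g"
  shows "(c + primitive f x) * (d + primitive g x)
    = c * d + primitive (\<lambda>y. (c + primitive f y) * g y + f y * (d + primitive g y)) x"
proof -
  have i: "integrable M (\<lambda>y. primitive f y * g y)" "integrable M (\<lambda>y. f y * primitive g y)"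
    using integrable_primitive_mult[OF f g] integrable_primitive_mult[OF g f] by (auto simp: mult.commute)
  have "primitive (\<lambda>y. (c + primitive f y) * g y + f y * (d + primitive g y)) x
      = primitive (\<lambda>y. (c * g y + d * f y) + (primitive f y * g y + f y * primitive g y)) x"
    by (simp add: algebra_simps)
  also have "\<dots> = c * primitive g x + d * primitive f x + primitive f x * primitive g x"
    unfolding primitive_mult_primitive[OF f g]
    by (subst primitive_add | use f g i in \<open>simp add: primitive_scale\<close>)+
  finally show ?thesis by (simp add: algebra_simps)
qed

lemma primitive_eq_diff:
  assumes F: "\<And>y. y \<in> {0..L} \<Longrightarrow> (F has_vector_derivative f y) (at y)"
    and f: "integrable M f" and x: "x \<in> {0..L}"
  shows "primitive f x = F x - F 0"
proof -
  let ?i = "indicat_real {..<x}"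
  have "((\<lambda>y. ?i y * f y) has_integral primitive f x) {0<..<L}"
    unfolding primitive_def
    by (intro has_integral_integral_lebesgue_on integrable_indicator_mult f) auto
  then have 1: "((\<lambda>y. ?i y * f y) has_integral primitive f x) {0..L}"
    by (simp add: has_integral_Icc_iff_Ioo)
  have "(f has_integral (F x - F 0)) {0..x}"
    using x by (intro fundamental_theorem_of_calculus) (auto intro!: has_vector_derivative_at_within[OF F])
  then have "((\<lambda>y. if y \<in> {0..x} then f y else 0) has_integral (F x - F 0)) {0..L}"
    using x by (subst has_integral_restrict) auto
  \<comment> \<open>The integrands differ only at \<open>x\<close>, because \<open>primitive\<close>
    cuts off with a strict inequality.\<close>
  then have "((\<lambda>y. ?i y * f y) has_integral (F x - F 0)) {0..L}"
    by (rule has_integral_spike_finite[of "{x}", rotated 2]) (auto simp: indicator_def)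
  with 1 show ?thesis by (rule has_integral_unique)
qed

text \<open>The half-lines \<open>{..<x}\<close> form an intersection-stable generator of the Borel
  sets, so the vanishing of the integral of \<open>k\<close> spreads by Dynkin induction to all
  Borel sets, and modulo null sets to all Lebesgue sets. A density with zero integral over every set
  vanishes almost everywhere.\<close>

lemma AE_eq_0_of_primitive:
  assumes k: "integrable M k" and 0: "\<And>x. x \<in> {0<..<L} \<Longrightarrow> primitive k x = 0"
  shows "AE x in M. k x = 0"
proof (rule fin.density_zero[OF k])
  \<comment> \<open>Continuity adds the endpoints, and outside \<open>{0..L}\<close> the primitive
    is constant. Its value at \<open>L\<close> is the total integral, which the complement step
    needs.\<close>
  have all: "primitive k x = 0" for x
  proof -
    have "primitive k x = 0" if "x \<in> closure {0<..<L}" for x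
      using 0 by (rule continuous_constant_on_closure[OF primitive_continuous_on[OF k] _ that])
    moreover have "closure {0<..<L} = {0..L}" using L_pos by simp
    ultimately have *: "primitive k x = 0" if "x \<in> {0..L}" for x using that by blast
    consider "x \<le> 0" | "x \<in> {0..L}" | "x \<ge> L" by fastforce
    then show ?thesis
      using * primitive_ge[of L k] primitive_ge[of x k] L_pos by cases (auto simp: *[of L])
  qed
  have total: "(\<integral>y. k y \<partial>M) = 0" using all[of L] primitive_ge[of L k] by simp
  have ksi: "set_integrable M (A \<inter> {0<..<L}) k" if "A \<in> sets borel" for A
  proof -
    have "(\<lambda>y. indicator A y) \<in> borel_measurable M" using that by (intro borel_measurable_M) auto
    then have "integrable M (\<lambda>y. indicator A y * k y)"
      by (intro integrable_bounded_mult[where C = 1] k) (auto simp: indicator_def)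
    moreover have "integrable M (\<lambda>y. indicator A y * k y) = integrable M (\<lambda>y. indicator (A \<inter> {0<..<L}) y * k y)"
      by (intro Bochner_Integration.integrable_cong) (auto simp: indicator_def)
    ultimately show ?thesis by (simp add: set_integrable_def)
  qed
  have int_A: "integrable M (\<lambda>y. indicator A y * k y)" if "A \<in> sets borel" for A :: "real set"
    using that by (intro integrable_bounded_mult[where C = 1] k borel_measurable_M) (auto simp: indicator_def)
  have borel: "(\<integral>y. indicator A y * k y \<partial>M) = 0" if "A \<in> sets borel" for A :: "real set"
  proof -
    have gen: "sets (borel :: real measure) = sigma_sets UNIV (range lessThan)"
      by (simp add: borel_Iio)
    have "Int_stable (range (lessThan :: real \<Rightarrow> real set))"
    proof (rule Int_stableI_image)
      fix a b :: real show "\<exists>c\<in>UNIV. {..<a} \<inter> {..<b} = {..<c}"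
        by (intro bexI[of _ "min a b"]) auto
    qed
    moreover have "range lessThan \<subseteq> Pow (UNIV :: real set)" by simp
    moreover have "A \<in> sigma_sets UNIV (range lessThan)" using that by (simp add: gen)
    ultimately show ?thesis
    proof (induction rule: sigma_sets_induct_disjoint)
      case (basic A)
      then show ?case using all by (auto simp: primitive_def)
    next
      case empty
      show ?case by simp
    next
      case (compl A)
      then have "A \<in> sets borel" by (simp add: gen)
      have "(\<integral>y. indicator (UNIV - A) y * k y \<partial>M) = (\<integral>y. k y - indicator A y * k y \<partial>M)"
        by (intro Bochner_Integration.integral_cong) (auto simp: indicator_def)
      also have "\<dots> = 0" using compl total k int_A[OF \<open>A \<in> sets borel\<close>] by simp
      finally show ?case .
    next
      case (union A)
      then have Ai: "A i \<in> sets borel" for i by (auto simp: gen)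
      \<comment> \<open>Set integrals over \<open>Omega L\<close> need sets that are measurable for
        the restricted measure.\<close>
      define B where "B i = A i \<inter> {0<..<L}" for i
      have Bset: "B i \<in> sets M" for i
        using Ai[of i] by (auto simp: B_def sets_restrict_space)
      have "(LINT y:(\<Union>i. B i)|M. k y) = (\<Sum>i. (LINT y:(B i)|M. k y))"
      proof (rule lebesgue_integral_countable_add[OF Bset])
        show "B i \<inter> B j = {}" if "i \<noteq> j" for i j
          using union(1) that by (auto simp: B_def disjoint_family_on_def)
        have "(\<Union>i. B i) = (\<Union>i. A i) \<inter> {0<..<L}" by (auto simp: B_def)
        then show "set_integrable M (\<Union>i. B i) k" using ksi[of "\<Union>i. A i"] Ai by auto
      qed
      moreover have "(LINT y:(B i)|M. k y) = 0" for i
      proof -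
        have "(LINT y:(B i)|M. k y) = (\<integral>y. indicator (A i) y * k y \<partial>M)"
          unfolding set_lebesgue_integral_def by (intro Bochner_Integration.integral_cong) (auto simp: B_def indicator_def)
        then show ?thesis using union(3)[of i] by simp
      qed
      moreover have "(LINT y:(\<Union>i. B i)|M. k y) = (\<integral>y. indicator (\<Union>i. A i) y * k y \<partial>M)"
        unfolding set_lebesgue_integral_def by (intro Bochner_Integration.integral_cong) (auto simp: B_def indicator_def)
      ultimately show ?case by simp
    qed
  qed
  fix A assume "A \<in> sets M"
  then have A: "A \<in> sets lebesgue" "A \<subseteq> {0<..<L}" by (auto simp: sets_restrict_space_iff)
  \<comment> \<open>A Lebesgue set is a Borel set up to a subset of a Borel null set, which the
    integral does not see.\<close>
  from A(1) obtain S N N' where SN: "A = S \<union> N" "N \<subseteq> N'" "N' \<in> null_sets lborel" "S \<in> sets lborel"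
    by (rule sets_completionE)
  have "AE x in lebesgue. x \<notin> N'" using AE_not_in[OF SN(3)] by (rule AE_completion)
  then have "AE x in M. x \<notin> N'" unfolding AE_M_iff by eventually_elim auto
  then have "AE x in M. indicator A x * k x = indicator S x * k x"
    by eventually_elim (use SN in \<open>auto simp: indicator_def\<close>)
  then have "(\<integral>x. indicator A x * k x \<partial>M) = (\<integral>x. indicator S x * k x \<partial>M)"
  proof (rule integral_cong_AE[rotated 2])
    show "(\<lambda>x. indicat_real A x * k x) \<in> borel_measurable M"
      using \<open>A \<in> sets M\<close> k by auto
    show "(\<lambda>x. indicat_real S x * k x) \<in> borel_measurable M"
      using int_A[of S] SN by auto
  qed
  then show "set_lebesgue_integral M A k = 0"
    using borel[of S] SN by (simp add: set_lebesgue_integral_def)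
qed

end

section \<open>Weak derivatives on an interval\<close>

context bounded_interval
begin

lemma L2_D:
  assumes "f \<in> L2 L"
  shows "f \<in> borel_measurable M" "integrable M (\<lambda>x. (f x)\<^sup>2)"
  using assms by (auto simp: L2_def)

lemma L2_mult:
  assumes f: "f \<in> L2 L" and g: "g \<in> L2 L"
  shows "integrable M (\<lambda>x. f x * g x)"
proof (rule Bochner_Integration.integrable_bound)
  show "integrable M (\<lambda>x. (f x)\<^sup>2 + (g x)\<^sup>2)" using L2_D(2)[OF f] L2_D(2)[OF g] by simp
  show "AE x in M. norm (f x * g x) \<le> norm ((f x)\<^sup>2 + (g x)\<^sup>2)"
  proof (rule AE_I2)
    fix x
    have "2 * \<bar>f x * g x\<bar> \<le> (f x)\<^sup>2 + (g x)\<^sup>2"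
      using sum_squares_bound[of "\<bar>f x\<bar>" "\<bar>g x\<bar>"] by (simp add: abs_mult)
    then show "norm (f x * g x) \<le> norm ((f x)\<^sup>2 + (g x)\<^sup>2)" by simp
  qed
qed (use L2_D(1)[OF f] L2_D(1)[OF g] in auto)

lemma L2_const: "(\<lambda>_. c) \<in> L2 L"
  by (auto simp: L2_def)

lemma L2_integrable: "f \<in> L2 L \<Longrightarrow> integrable M f"
  using L2_mult[OF _ L2_const[of 1]] by simp

lemma L2_add:
  assumes f: "f \<in> L2 L" and g: "g \<in> L2 L" shows "(\<lambda>x. f x + g x) \<in> L2 L"
  using L2_D[OF f] L2_D[OF g] L2_mult[OF f g]
  by (auto simp: L2_def power2_sum mult.assoc)

lemma L2_scale: "f \<in> L2 L \<Longrightarrow> (\<lambda>x. c * f x) \<in> L2 L"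
  by (auto simp: L2_def power_mult_distrib)

lemma L2_AE_cong:
  assumes "f \<in> L2 L" and "g \<in> borel_measurable M" and ae: "AE x in M. f x = g x"
  shows "g \<in> L2 L"
proof -
  have "AE x in M. (f x)\<^sup>2 = (g x)\<^sup>2" using ae by eventually_elim simp
  then have "integrable M (\<lambda>x. (g x)\<^sup>2)"
    using L2_D[OF assms(1)] assms(2) by (subst integrable_cong_AE[symmetric]) auto
  then show ?thesis using assms(2) by (simp add: L2_def)
qed

lemma continuous_bounded_M:
  fixes f :: "real \<Rightarrow> real"
  assumes "continuous_on {0..L} f"
  obtains C where "\<And>x. x \<in> {0..L} \<Longrightarrow> \<bar>f x\<bar> \<le> C"
proof -
  have "bounded (f ` {0..L})" by (intro compact_imp_bounded compact_continuous_image assms) auto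
  then obtain C where "\<forall>x\<in>{0..L}. \<bar>f x\<bar> \<le> C" by (auto simp: bounded_iff)
  then show thesis by (intro that[of C]) auto
qed

lemma continuous_integrable_M:
  fixes f :: "real \<Rightarrow> real"
  assumes "continuous_on UNIV f"
  shows "integrable M f"
proof -
  obtain C where "\<And>x. x \<in> {0..L} \<Longrightarrow> \<bar>f x\<bar> \<le> C"
    using continuous_bounded_M[OF continuous_on_subset[OF assms]] by auto
  then have "integrable M (\<lambda>x. f x * 1)"
    using assms by (intro integrable_bounded_mult[where C = C] borel_measurable_M borel_measurable_continuous_onI) auto
  then show ?thesis by simp
qed

section \<open>Test functions with prescribed derivative and the fundamental lemma of the calculus
  of variations\<close>

lemma test_function_with_derivative:
  assumes \<psi>: "continuous_on UNIV \<psi>" and ab: "0 < a" "a \<le> b" "b < L"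
    and supp: "\<And>x. x \<notin> {a..b} \<Longrightarrow> \<psi> x = 0" and mean: "(\<integral>x. \<psi> x \<partial>M) = 0"
  obtains \<phi> where "\<phi> \<in> test_functions L" "deriv \<phi> = \<psi>"
proof -
  \<comment> \<open>An antiderivative on the whole line, since a test function has to be
    \<open>C1\<close> on \<open>UNIV\<close>.\<close>
  have "\<exists>F. \<forall>x::real. - \<infinity> < ereal x \<longrightarrow> ereal x < \<infinity> \<longrightarrow> (F has_vector_derivative \<psi> x) (at x)"
    using \<psi> by (intro einterval_antiderivative) (auto simp: continuous_on_eq_continuous_at)
  then obtain F where F: "\<And>x. (F has_vector_derivative \<psi> x) (at x)" by auto
  define \<phi> where "\<phi> x = F x - F 0" for x
  have \<phi>: "(\<phi> has_vector_derivative \<psi> x) (at x)" for x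
    using has_vector_derivative_diff[OF F has_vector_derivative_const[of "F 0"], of x] by (simp add: \<phi>_def[abs_def])
  have prim: "primitive \<psi> x = \<phi> x" if "x \<in> {0..L}" for x
    using primitive_eq_diff[OF F continuous_integrable_M[OF \<psi>] that] by (simp add: \<phi>_def)
  \<comment> \<open>Mean zero is what makes the antiderivative vanish again to the right of the
    support.\<close>
  have \<phi>L: "\<phi> L = 0" using prim[of L] primitive_ge[of L \<psi>] mean L_pos by simp
  have left: "\<phi> x = 0" if "x < a" for x
  proof -
    have *: "(\<phi> has_vector_derivative 0) (at y within {..<a})" if "y \<in> {..<a}" for y
      using has_vector_derivative_at_within[OF \<phi>[of y]] supp[of y] that by auto
    obtain c where "\<And>y. y \<in> {..<a} \<Longrightarrow> \<phi> y = c"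
      by (rule has_vector_derivative_zero_constant[of "{..<a}" \<phi>, OF _ *]) auto
    moreover have "\<phi> 0 = 0" by (simp add: \<phi>_def)
    ultimately show ?thesis using that ab(1) by (metis lessThan_iff)
  qed
  have right: "\<phi> x = 0" if "b < x" for x
  proof -
    have *: "(\<phi> has_vector_derivative 0) (at y within {b<..})" if "y \<in> {b<..}" for y
      using has_vector_derivative_at_within[OF \<phi>[of y]] supp[of y] that by auto
    obtain c where "\<And>y. y \<in> {b<..} \<Longrightarrow> \<phi> y = c"
      by (rule has_vector_derivative_zero_constant[of "{b<..}" \<phi>, OF _ *]) auto
    then show ?thesis using that ab(3) \<phi>L by (metis greaterThan_iff)
  qed
  have "\<phi> C1_differentiable_on UNIV"
    using \<phi> \<psi> by (auto simp: C1_differentiable_on_def)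
  moreover have "\<phi> x = 0" if "x \<notin> {a..b}" for x using left right that by force
  ultimately have "\<phi> \<in> test_functions L"
    using ab unfolding test_functions_def by (intro CollectI conjI exI[of _ "{a..b}"]) auto
  moreover have "deriv \<phi> = \<psi>"
    using \<phi> by (intro ext DERIV_imp_deriv) (simp add: has_real_derivative_iff_has_vector_derivative)
  ultimately show thesis by (rule that)
qed

text \<open>Piecewise linear cut-offs that converge pointwise to the indicator of
  \<open>{a<..<b}\<close>. No smoothing is involved: test functions are only \<open>C1\<close>, so
  any continuous function may serve as the derivative of one, given support and mean zero.\<close>

definition trapezoid :: "real \<Rightarrow> real \<Rightarrow> nat \<Rightarrow> real \<Rightarrow> real"
  where "trapezoid a b n x = max 0 (min 1 (real n * min (x - a) (b - x)))"

lemma trapezoid_continuous: "continuous_on A (trapezoid a b n)"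
  unfolding trapezoid_def[abs_def] by (intro continuous_intros)

lemma trapezoid_range: "\<bar>trapezoid a b n x\<bar> \<le> 1"
  by (simp add: trapezoid_def)

lemma trapezoid_support: "x \<notin> {a<..<b} \<Longrightarrow> trapezoid a b n x = 0"
proof -
  assume "x \<notin> {a<..<b}"
  then have "min (x - a) (b - x) \<le> 0" by auto
  then have "real n * min (x - a) (b - x) \<le> 0" by (simp add: mult_nonneg_nonpos)
  then show ?thesis by (simp add: trapezoid_def)
qed

lemma trapezoid_measurable [measurable]: "trapezoid a b n \<in> borel_measurable M"
  by (intro borel_measurable_M borel_measurable_continuous_onI trapezoid_continuous)

lemma trapezoid_tendsto: "(\<lambda>n. trapezoid a b n x) \<longlonglongrightarrow> indicator {a<..<b} x"
proof (cases "x \<in> {a<..<b}")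
  case True
  define m where "m = min (x - a) (b - x)"
  have "m > 0" using True by (auto simp: m_def)
  obtain k :: nat where k: "1 / m < real k" using reals_Archimedean2 by blast
  have "trapezoid a b n x = 1" if "n \<ge> k" for n
  proof -
    have "1 \<le> real k * m" using k \<open>m > 0\<close> by (simp add: field_simps)
    also have "\<dots> \<le> real n * m" using that \<open>m > 0\<close> by (intro mult_right_mono) auto
    finally show ?thesis by (simp add: trapezoid_def m_def[symmetric])
  qed
  then have "\<forall>\<^sub>F n in sequentially. trapezoid a b n x = indicator {a<..<b} x"
    using True by (auto simp: eventually_sequentially)
  then show ?thesis by (rule tendsto_eventually)
next
  case False
  then show ?thesis by (simp add: trapezoid_support)
qed

lemma integrable_mult_trapezoid: "integrable M k \<Longrightarrow> integrable M (\<lambda>x. k x * trapezoid a b n x)"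
  using integrable_bounded_mult[of "trapezoid a b n" 1 k] by (simp add: trapezoid_range mult.commute)

lemma integral_mult_trapezoid_tendsto:
  assumes k: "integrable M k"
  shows "(\<lambda>n. \<integral>x. k x * trapezoid a b n x \<partial>M) \<longlonglongrightarrow> (\<integral>x. k x * indicator {a<..<b} x \<partial>M)"
proof (rule integral_dominated_convergence[where w = "\<lambda>x. \<bar>k x\<bar>"])
  have "(\<lambda>x. indicat_real {a<..<b} x) \<in> borel_measurable M" by (intro borel_measurable_M) auto
  then show "(\<lambda>x. k x * indicat_real {a<..<b} x) \<in> borel_measurable M" using k by auto
  show "AE x in M. norm (k x * trapezoid a b n x) \<le> \<bar>k x\<bar>" for n
    using trapezoid_range by (intro AE_I2) (simp add: abs_mult mult_left_le)
  show "AE x in M. (\<lambda>n. k x * trapezoid a b n x) \<longlonglongrightarrow> k x * indicator {a<..<b} x"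
    by (intro AE_I2 tendsto_intros trapezoid_tendsto)
qed (use k in auto)

text \<open>The du Bois-Reymond lemma. A trapezoid minus a suitable multiple of one fixed bump
  \<open>\<psi>0\<close> has mean zero and is thus the derivative of a test function; in the limit
  the trapezoids become intervals, and the primitive of \<open>h - c\<close> is found to
  vanish.\<close>

lemma AE_const_of_test_functions:
  assumes h: "integrable M h" and test: "\<And>\<phi>. \<phi> \<in> test_functions L \<Longrightarrow> (\<integral>x. h x * deriv \<phi> x \<partial>M) = 0"
  shows "\<exists>c. AE x in M. h x = c"
proof -
  let ?T = "trapezoid (L / 3) (2 * L / 3)"
  have "(\<lambda>n. \<integral>x. 1 * ?T n x \<partial>M) \<longlonglongrightarrow> (\<integral>x. 1 * indicat_real {L / 3<..<2 * L / 3} x \<partial>M)"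
    by (rule integral_mult_trapezoid_tendsto) auto
  moreover have "(\<integral>x. 1 * indicat_real {L / 3<..<2 * L / 3} x \<partial>M) > 0"
  proof -
    have "(\<integral>x. 1 * indicat_real {L / 3<..<2 * L / 3} x \<partial>M) = measure M ({L / 3<..<2 * L / 3} \<inter> space M)"
      by simp
    also have "\<dots> = measure lebesgue {L / 3<..<2 * L / 3}"
    proof -
      have eq: "{L / 3<..<2 * L / 3} \<inter> space M = {L / 3<..<2 * L / 3}" using L_pos by auto
      have "{L / 3<..<2 * L / 3} \<subseteq> {0<..<L}" using L_pos by auto
      then show ?thesis unfolding eq by (intro measure_restrict_space) auto
    qed
    also have "\<dots> > 0" using L_pos by simp
    finally show ?thesis .
  qed
  ultimately have "\<forall>\<^sub>F n in sequentially. (\<integral>x. 1 * ?T n x \<partial>M) > 0" by (rule order_tendstoD(1))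
  then obtain n0 where "(\<integral>x. 1 * ?T n0 x \<partial>M) > 0" by (auto simp: eventually_sequentially)
  define \<psi>0 where "\<psi>0 = ?T n0"
  define I where "I = (\<integral>x. \<psi>0 x \<partial>M)"
  have "I > 0" using \<open>(\<integral>x. 1 * ?T n0 x \<partial>M) > 0\<close> by (simp add: I_def \<psi>0_def)
  \<comment> \<open>The constant can only be the average of \<open>h\<close> with weight
    \<open>\<psi>0\<close>.\<close>
  define c where "c = (\<integral>x. h x * \<psi>0 x \<partial>M) / I"
  define k where "k x = h x - c" for x
  have k: "integrable M k" using h by (simp add: k_def[abs_def])
  have trap: "(\<integral>x. k x * trapezoid a b n x \<partial>M) = 0" if ab: "0 < a" "a < b" "b < L" for a b n
  proof -
    let ?\<tau> = "trapezoid a b n"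
    \<comment> \<open>\<open>r\<close> gives \<psi> mean zero; by the choice of \<open>c\<close>,
      \<open>r\<close> times the integral of \<open>h * \<psi>0\<close> is then \<open>c\<close>
      times the integral of the trapezoid.\<close>
    define r where "r = (\<integral>x. ?\<tau> x \<partial>M) / I"
    define \<psi> where "\<psi> x = ?\<tau> x - r * \<psi>0 x" for x
    have cont: "continuous_on UNIV \<psi>" "continuous_on UNIV \<psi>0" "continuous_on UNIV ?\<tau>"
      unfolding \<psi>_def[abs_def] \<psi>0_def by (intro continuous_intros trapezoid_continuous)+
    have "(\<integral>x. \<psi> x \<partial>M) = (\<integral>x. ?\<tau> x \<partial>M) - r * I"
      unfolding \<psi>_def I_def using cont continuous_integrable_M by simp
    then have mean: "(\<integral>x. \<psi> x \<partial>M) = 0" using \<open>I > 0\<close> by (simp add: r_def)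
    have supp: "\<psi> x = 0" if "x \<notin> {min a (L / 3)..max b (2 * L / 3)}" for x
    proof -
      have "x \<notin> {a<..<b}" "x \<notin> {L / 3<..<2 * L / 3}" using that by auto
      then show ?thesis by (simp add: \<psi>_def \<psi>0_def trapezoid_support)
    qed
    have "0 < min a (L / 3)" "min a (L / 3) \<le> max b (2 * L / 3)" "max b (2 * L / 3) < L"
      using ab L_pos by (auto simp: min_le_iff_disj le_max_iff_disj)
    from test_function_with_derivative[OF cont(1) this supp mean]
    obtain \<phi> where "\<phi> \<in> test_functions L" "deriv \<phi> = \<psi>" by blast
    with test[of \<phi>] have "(\<integral>x. h x * \<psi> x \<partial>M) = 0" by simp
    moreover have "(\<integral>x. h x * \<psi> x \<partial>M) = (\<integral>x. h x * ?\<tau> x - r * (h x * \<psi>0 x) \<partial>M)"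
      by (simp add: \<psi>_def algebra_simps)
    moreover have hi: "integrable M (\<lambda>x. h x * ?\<tau> x)" "integrable M (\<lambda>x. h x * \<psi>0 x)"
      unfolding \<psi>0_def using h by (simp_all add: integrable_mult_trapezoid)
    ultimately have "(\<integral>x. h x * ?\<tau> x \<partial>M) = r * (\<integral>x. h x * \<psi>0 x \<partial>M)" by simp
    also have "\<dots> = c * (\<integral>x. ?\<tau> x \<partial>M)" by (simp add: r_def c_def)
    finally have "(\<integral>x. h x * ?\<tau> x \<partial>M) - c * (\<integral>x. ?\<tau> x \<partial>M) = 0" by simp
    moreover have "(\<integral>x. k x * ?\<tau> x \<partial>M) = (\<integral>x. h x * ?\<tau> x - c * ?\<tau> x \<partial>M)"
      by (simp add: k_def algebra_simps)
    ultimately show ?thesis using hi continuous_integrable_M[OF cont(3)] by simp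
  qed
  have Ioo: "(\<integral>x. k x * indicator {a<..<b} x \<partial>M) = 0" if "0 < a" "a < b" "b < L" for a b
    using integral_mult_trapezoid_tendsto[OF k, of a b] unfolding trap[OF that]
    by (rule LIMSEQ_unique) (rule tendsto_const)
  have const: "primitive k a = primitive k b" if ab: "0 < a" "a < b" "b < L" for a b
  proof -
    have "primitive k b - primitive k a = (\<integral>x. indicator {..<b} x * k x - indicator {..<a} x * k x \<partial>M)"
      unfolding primitive_def using k by (simp add: integrable_indicator_mult)
    also have "\<dots> = (\<integral>x. k x * indicator {a<..<b} x \<partial>M)"
    proof (rule integral_cong_AE)
      have "(\<lambda>x. indicat_real {a<..<b} x) \<in> borel_measurable M" by (intro borel_measurable_M) auto
      then show "(\<lambda>x. k x * indicat_real {a<..<b} x) \<in> borel_measurable M" using k by auto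
      show "AE x in M. indicator {..<b} x * k x - indicator {..<a} x * k x = k x * indicator {a<..<b} x"
        using AE_M_neq[of a] by eventually_elim (use ab in \<open>auto simp: indicator_def\<close>)
    qed (use k in auto)
    finally show ?thesis using Ioo[OF ab] by simp
  qed
  have "AE x in M. k x = 0"
  proof (rule AE_eq_0_of_primitive[OF k])
    fix x assume x: "x \<in> {0<..<L}"
    have "primitive k 0 = primitive k x"
      by (rule continuous_constant_on_closure[OF primitive_continuous_on[OF k], of "{0<..<x}"])
        (use const x in auto)
    then show "primitive k x = 0" by simp
  qed
  then show ?thesis by (intro exI[of _ c]) (simp add: k_def)
qed

text \<open>By parts, \<open>u\<close> minus the primitive of \<open>w\<close> is orthogonal to
  every \<open>deriv \<phi>\<close>, so the du Bois-Reymond lemma makes it constant.\<close>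

lemma has_weak_deriv_primitive:
  assumes "has_weak_deriv L u w"
  shows "\<exists>c. AE x in M. u x = c + primitive w x"
proof -
  have u: "integrable M u" and w: "integrable M w"
    and parts: "\<And>\<phi>. \<phi> \<in> test_functions L \<Longrightarrow> (\<integral>x. u x * deriv \<phi> x \<partial>M) = - (\<integral>x. w x * \<phi> x \<partial>M)"
    using assms L2_integrable by (auto simp: has_weak_deriv_def)
  have pw: "integrable M (primitive w)"
    using continuous_integrable_M[OF primitive_continuous_on[OF w]] .
  have "\<exists>c. AE x in M. u x - primitive w x = c"
  proof (rule AE_const_of_test_functions)
    show "integrable M (\<lambda>x. u x - primitive w x)" using u pw by simp
    fix \<phi> assume \<phi>: "\<phi> \<in> test_functions L"
    then obtain K D where K: "K \<subseteq> {0<..<L}" "\<And>x. x \<notin> K \<Longrightarrow> \<phi> x = 0"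
      and D: "\<And>x. (\<phi> has_vector_derivative D x) (at x)" and contD: "continuous_on UNIV D"
      by (auto simp: test_functions_def C1_differentiable_on_def)
    have dD: "deriv \<phi> = D"
      using D by (intro ext DERIV_imp_deriv) (simp add: has_real_derivative_iff_has_vector_derivative)
    \<comment> \<open>The support stays inside the open interval, so boundary terms vanish and
      \<open>deriv \<phi>\<close> has mean zero.\<close>
    have "0 \<notin> K" "L \<notin> K" using K(1) by auto
    with K(2) have "\<phi> 0 = 0" "\<phi> L = 0" by auto
    have Di: "integrable M D" by (rule continuous_integrable_M[OF contD])
    have prim: "primitive D x = \<phi> x" if "x \<in> {0..L}" for x
      using primitive_eq_diff[OF D Di that] \<open>\<phi> 0 = 0\<close> by simp
    have "(\<integral>x. D x \<partial>M) = 0" using prim[of L] primitive_ge[of L D] \<open>\<phi> L = 0\<close> L_pos by simp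
    then have "(\<integral>x. primitive w x * D x \<partial>M) = - (\<integral>x. w x * primitive D x \<partial>M)"
      using integral_primitive_by_parts[OF w Di] by simp
    also have "(\<integral>x. w x * primitive D x \<partial>M) = (\<integral>x. w x * \<phi> x \<partial>M)"
      by (intro Bochner_Integration.integral_cong) (auto simp: prim)
    finally have "(\<integral>x. primitive w x * D x \<partial>M) = (\<integral>x. u x * D x \<partial>M)" using parts[OF \<phi>] dD by simp
    moreover obtain C where "\<And>x. x \<in> {0..L} \<Longrightarrow> \<bar>D x\<bar> \<le> C"
      using continuous_bounded_M[OF continuous_on_subset[OF contD]] by auto
    then have "integrable M (\<lambda>x. D x * u x)"
      using contD u by (intro integrable_bounded_mult[where C = C] borel_measurable_M borel_measurable_continuous_onI) auto
    then have "integrable M (\<lambda>x. u x * D x)" by (simp add: mult.commute)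
    ultimately show "(\<integral>x. (u x - primitive w x) * deriv \<phi> x \<partial>M) = 0"
      using integrable_primitive_mult[OF w Di] by (simp add: dD left_diff_distrib)
  qed
  then obtain c where "AE x in M. u x - primitive w x = c" by blast
  then have "AE x in M. u x = c + primitive w x" by eventually_elim simp
  then show ?thesis by blast
qed

section \<open>Continuous representatives, point values and uniqueness of weak derivatives\<close>

lemma AE_M_Ioo_ex:
  assumes "AE x in M. P x" and ab: "0 \<le> a" "a < b" "b \<le> L"
  shows "\<exists>x\<in>{a<..<b}. P x"
proof (rule ccontr)
  assume "\<not> ?thesis"
  then have "AE x in lebesgue. x \<notin> {a<..<b}"
    using assms(1) ab unfolding AE_M_iff by (auto elim!: eventually_mono)
  then have "{a<..<b} \<in> null_sets lebesgue" by (subst (asm) AE_iff_null_sets[symmetric]) auto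
  then have "emeasure lebesgue {a<..<b} = 0" by auto
  then show False using ab by simp
qed

text \<open>A set of full measure meets every subinterval, so it is dense up to the endpoints, which
  is where boundary values are taken.\<close>

lemma continuous_AE_eq:
  fixes f g :: "real \<Rightarrow> real"
  assumes f: "continuous_on {0..L} f" and g: "continuous_on {0..L} g" and ae: "AE x in M. f x = g x"
    and x: "x \<in> {0..L}"
  shows "f x = g x"
proof -
  define h where "h y = f y - g y" for y
  have "continuous_on (closure {y \<in> {0<..<L}. f y = g y}) h"
  proof (rule continuous_on_subset)
    show "continuous_on {0..L} h" unfolding h_def by (intro continuous_intros f g)
    have "closure {y \<in> {0<..<L}. f y = g y} \<subseteq> closure {0..L}" by (rule closure_mono) auto
    then show "closure {y \<in> {0<..<L}. f y = g y} \<subseteq> {0..L}" by simp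
  qed
  moreover have "x \<in> closure {y \<in> {0<..<L}. f y = g y}"
    unfolding closure_approachable
  proof (intro allI impI)
    fix e :: real assume "e > 0"
    have "\<exists>y\<in>{max 0 (x - e)<..<min L (x + e)}. f y = g y"
      using x \<open>e > 0\<close> L_pos by (intro AE_M_Ioo_ex[OF ae]) auto
    then show "\<exists>y\<in>{y \<in> {0<..<L}. f y = g y}. dist y x < e"
      by (force simp: dist_real_def abs_less_iff)
  qed
  ultimately have "h x = 0"
    using continuous_constant_on_closure[of "{y \<in> {0<..<L}. f y = g y}" h 0 x] by (simp add: h_def)
  then show ?thesis by (simp add: h_def)
qed

lemma has_weak_deriv_weak_deriv: "u \<in> H1 L \<Longrightarrow> has_weak_deriv L u (weak_deriv L u)"
proof -
  assume "u \<in> H1 L"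
  then have "\<exists>w. has_weak_deriv L u w" by (simp add: H1_def)
  then show ?thesis unfolding weak_deriv_def by (rule someI_ex)
qed

lemma H1_L2: "u \<in> H1 L \<Longrightarrow> u \<in> L2 L" "u \<in> H1 L \<Longrightarrow> weak_deriv L u \<in> L2 L"
  using has_weak_deriv_weak_deriv by (auto simp: has_weak_deriv_def)

lemma primitive_continuous_L2: "w \<in> L2 L \<Longrightarrow> continuous_on A (\<lambda>x. c + primitive w x)"
  by (intro continuous_intros primitive_continuous_on L2_integrable)

text \<open>The two representations agree as continuous functions. At \<open>0\<close> the
  primitives vanish, so the constants coincide and the primitive of \<open>w - z\<close> is
  zero.\<close>

lemma has_weak_deriv_unique:
  assumes "has_weak_deriv L u w" "has_weak_deriv L u z"
  shows "AE x in M. w x = z x"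
proof -
  have L2: "w \<in> L2 L" "z \<in> L2 L" using assms by (auto simp: has_weak_deriv_def)
  obtain c d where c: "AE x in M. u x = c + primitive w x" and d: "AE x in M. u x = d + primitive z x"
    using has_weak_deriv_primitive assms by blast
  have "AE x in M. c + primitive w x = d + primitive z x" using c d by eventually_elim simp
  then have eq: "c + primitive w x = d + primitive z x" if "x \<in> {0..L}" for x
    by (rule continuous_AE_eq[OF primitive_continuous_L2 primitive_continuous_L2, OF L2 _ that])
  have "c = d" using eq[of 0] L_pos by simp
  have "AE x in M. w x - z x = 0"
  proof (rule AE_eq_0_of_primitive)
    show "integrable M (\<lambda>x. w x - z x)" using L2 L2_integrable by simp
    fix x assume "x \<in> {0<..<L}"
    then show "primitive (\<lambda>x. w x - z x) x = 0"
      using eq[of x] \<open>c = d\<close> L2 L2_integrable by (simp add: primitive_diff)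
  qed
  then show ?thesis by eventually_elim simp
qed

text \<open>Two continuous representatives agree almost everywhere, hence on all of
  \<open>{0..L}\<close>, so the choice made by \<open>point_value\<close> does not matter
  there.\<close>

lemma point_value_eqI:
  assumes f: "continuous_on {0..L} f" and ae: "AE x in M. u x = f x" and a: "a \<in> {0..L}"
  shows "point_value L u a = f a"
proof -
  let ?P = "\<lambda>f. continuous_on {0..L} f \<and> (AE x in M. f x = u x)"
  have "?P f" using f ae by (auto elim!: eventually_mono)
  then have P: "?P (SOME f. ?P f)" by (rule someI[of ?P])
  then have "AE x in M. (SOME f. ?P f) x = f x" using ae by (auto elim: eventually_elim2)
  then show ?thesis
    unfolding point_value_def using P f by (intro continuous_AE_eq[OF _ _ _ a]) auto
qed

lemma H1_primitive:
  assumes u: "u \<in> H1 L"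
  shows "AE x in M. u x = point_value L u 0 + primitive (weak_deriv L u) x"
    and "a \<in> {0..L} \<Longrightarrow> point_value L u a = point_value L u 0 + primitive (weak_deriv L u) a"
proof -
  obtain c where c: "AE x in M. u x = c + primitive (weak_deriv L u) x"
    using has_weak_deriv_primitive[OF has_weak_deriv_weak_deriv[OF u]] by blast
  note pv = point_value_eqI[OF primitive_continuous_L2[OF H1_L2(2)[OF u]] c]
  have "point_value L u 0 = c" using pv[of 0] L_pos by simp
  with c pv show "AE x in M. u x = point_value L u 0 + primitive (weak_deriv L u) x"
    "a \<in> {0..L} \<Longrightarrow> point_value L u a = point_value L u 0 + primitive (weak_deriv L u) a" by auto
qed

lemma test_function_integrable_mult:
  assumes \<phi>: "\<phi> \<in> test_functions L" and f: "integrable M f"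
  shows "integrable M (\<lambda>x. f x * \<phi> x)" "integrable M (\<lambda>x. f x * deriv \<phi> x)"
proof -
  obtain D where D: "\<And>x. (\<phi> has_vector_derivative D x) (at x)" and contD: "continuous_on UNIV D"
    using \<phi> by (auto simp: test_functions_def C1_differentiable_on_def)
  have dD: "deriv \<phi> = D"
    using D by (intro ext DERIV_imp_deriv) (simp add: has_real_derivative_iff_has_vector_derivative)
  have "continuous_on UNIV \<phi>"
    using D by (auto simp: continuous_on_eq_continuous_at intro: has_vector_derivative_continuous)
  moreover have "integrable M (\<lambda>x. f x * b x)" if b: "continuous_on UNIV b" for b
  proof -
    obtain C where "\<And>x. x \<in> {0..L} \<Longrightarrow> \<bar>b x\<bar> \<le> C"
      using continuous_bounded_M[OF continuous_on_subset[OF b]] by auto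
    then have "integrable M (\<lambda>x. b x * f x)"
      using b f by (intro integrable_bounded_mult[where C = C] borel_measurable_M borel_measurable_continuous_onI) auto
    then show ?thesis by (simp add: mult.commute)
  qed
  ultimately show "integrable M (\<lambda>x. f x * \<phi> x)" "integrable M (\<lambda>x. f x * deriv \<phi> x)"
    using contD dD by auto
qed

section \<open>Linearity of weak derivatives and point values\<close>

lemma has_weak_deriv_add:
  assumes "has_weak_deriv L u w" "has_weak_deriv L v z"
  shows "has_weak_deriv L (u + v) (w + z)"
proof -
  have L2: "u \<in> L2 L" "v \<in> L2 L" "w \<in> L2 L" "z \<in> L2 L"
    using assms by (auto simp: has_weak_deriv_def)
  have "(\<integral>x. (u x + v x) * deriv \<phi> x \<partial>M) = - (\<integral>x. (w x + z x) * \<phi> x \<partial>M)"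
    if \<phi>: "\<phi> \<in> test_functions L" for \<phi>
    using assms \<phi> test_function_integrable_mult[OF \<phi> L2(1)[THEN L2_integrable]]
      test_function_integrable_mult[OF \<phi> L2(2)[THEN L2_integrable]]
      test_function_integrable_mult[OF \<phi> L2(3)[THEN L2_integrable]]
      test_function_integrable_mult[OF \<phi> L2(4)[THEN L2_integrable]]
    by (simp add: has_weak_deriv_def distrib_right)
  then show ?thesis using L2 by (simp add: has_weak_deriv_def plus_fun_def L2_add)
qed

lemma has_weak_deriv_scale:
  assumes "has_weak_deriv L u w"
  shows "has_weak_deriv L (c *\<^sub>R u) (c *\<^sub>R w)"
  using assms by (simp add: has_weak_deriv_def scaleR_fun_def mult.assoc L2_scale)

lemma H1_add: "u \<in> H1 L \<Longrightarrow> v \<in> H1 L \<Longrightarrow> u + v \<in> H1 L"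
  using has_weak_deriv_add unfolding H1_def by blast

lemma H1_scale: "u \<in> H1 L \<Longrightarrow> c *\<^sub>R u \<in> H1 L"
  using has_weak_deriv_scale unfolding H1_def by blast

lemma H1_zero: "0 \<in> H1 L"
  using L2_const[of 0] by (auto simp: H1_def has_weak_deriv_def zero_fun_def intro!: exI[of _ "\<lambda>_. 0"])

lemma weak_deriv_add:
  assumes "u \<in> H1 L" "v \<in> H1 L"
  shows "AE x in M. weak_deriv L (u + v) x = weak_deriv L u x + weak_deriv L v x"
  using has_weak_deriv_unique[OF has_weak_deriv_weak_deriv[OF H1_add[OF assms]]
      has_weak_deriv_add[OF assms[THEN has_weak_deriv_weak_deriv]]] by simp

lemma weak_deriv_scale:
  assumes "u \<in> H1 L"
  shows "AE x in M. weak_deriv L (c *\<^sub>R u) x = c * weak_deriv L u x"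
  using has_weak_deriv_unique[OF has_weak_deriv_weak_deriv[OF H1_scale[OF assms]]
      has_weak_deriv_scale[OF assms[THEN has_weak_deriv_weak_deriv]], of c] by (simp add: scaleR_fun_def)

lemma point_value_continuous_on:
  assumes u: "u \<in> H1 L"
  shows "continuous_on {0..L} (point_value L u)"
  by (rule continuous_on_eq[OF primitive_continuous_L2[OF H1_L2(2)[OF u]]])
    (rule H1_primitive(2)[OF u, symmetric])

lemma point_value_AE:
  assumes u: "u \<in> H1 L"
  shows "AE x in M. u x = point_value L u x"
  using H1_primitive(1)[OF u] AE_M_mem
proof eventually_elim
  case (elim x)
  then show ?case using H1_primitive(2)[OF u, of x] by simp
qed

lemma point_value_add:
  assumes u: "u \<in> H1 L" and v: "v \<in> H1 L" and "a \<in> {0..L}"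
  shows "point_value L (u + v) a = point_value L u a + point_value L v a"
proof -
  have "AE x in M. (u + v) x = point_value L u x + point_value L v x"
    using point_value_AE[OF u] point_value_AE[OF v] by eventually_elim simp
  then show ?thesis
    by (rule point_value_eqI[rotated, OF _ \<open>a \<in> {0..L}\<close>])
      (intro continuous_on_add point_value_continuous_on u v)
qed

lemma point_value_scale:
  assumes u: "u \<in> H1 L" and "a \<in> {0..L}"
  shows "point_value L (c *\<^sub>R u) a = c * point_value L u a"
proof -
  have "AE x in M. (c *\<^sub>R u) x = c * point_value L u x"
    using point_value_AE[OF u] by eventually_elim (simp add: scaleR_fun_def)
  then show ?thesis
    by (rule point_value_eqI[rotated, OF _ \<open>a \<in> {0..L}\<close>])
      (intro continuous_on_mult_left point_value_continuous_on u)
qed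

end

section \<open>The energy and Lyapunov forms\<close>

context bounded_interval
begin

text \<open>The factor \<open>1 + \<epsilon> * x\<close> is the multiplier of the Lyapunov function;
  \<open>wint 0\<close> is the plain product of square integrable functions, so energy and
  perturbation share one calculus.\<close>

definition wint :: "real \<Rightarrow> (real \<Rightarrow> real) \<Rightarrow> (real \<Rightarrow> real) \<Rightarrow> real"
  where "wint \<epsilon> f g = (\<integral>x. (1 + \<epsilon> * x) * (f x * g x) \<partial>M)"

lemma wint_0: "wint 0 f g = (\<integral>x. f x * g x \<partial>M)"
  by (simp add: wint_def)

lemma integrable_weight_mult:
  assumes k: "integrable M k"
  shows "integrable M (\<lambda>x. (1 + \<epsilon> * x) * k x)"
proof (rule integrable_bounded_mult[OF _ _ k])
  fix x assume "x \<in> {0<..<L}"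
  then have "\<bar>\<epsilon> * x\<bar> \<le> \<bar>\<epsilon>\<bar> * L" by (simp add: abs_mult mult_left_mono)
  then show "\<bar>1 + \<epsilon> * x\<bar> \<le> 1 + \<bar>\<epsilon>\<bar> * L" by (simp add: abs_le_iff)
qed auto

lemma wint_integrable: "f \<in> L2 L \<Longrightarrow> g \<in> L2 L \<Longrightarrow> integrable M (\<lambda>x. (1 + \<epsilon> * x) * (f x * g x))"
  by (intro integrable_weight_mult L2_mult)

lemma wint_sym: "wint \<epsilon> f g = wint \<epsilon> g f"
  by (simp add: wint_def mult.commute)

text \<open>Additivity is asked only almost everywhere because \<open>weak_deriv\<close> is a
  choice: the derivative chosen for a sum matches the sum of the chosen derivatives only up to a
  null set.\<close>

lemma wint_add:
  assumes "f \<in> L2 L" "f1 \<in> L2 L" "f2 \<in> L2 L" "g \<in> L2 L" and ae: "AE x in M. f x = f1 x + f2 x"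
  shows "wint \<epsilon> f g = wint \<epsilon> f1 g + wint \<epsilon> f2 g"
proof -
  have "wint \<epsilon> f g = (\<integral>x. (1 + \<epsilon> * x) * (f1 x * g x) + (1 + \<epsilon> * x) * (f2 x * g x) \<partial>M)"
    unfolding wint_def
  proof (rule integral_cong_AE)
    show "AE x in M. (1 + \<epsilon> * x) * (f x * g x) = (1 + \<epsilon> * x) * (f1 x * g x) + (1 + \<epsilon> * x) * (f2 x * g x)"
      using ae by eventually_elim (simp add: algebra_simps)
  qed (use assms(1-4)[THEN L2_D(1)] in measurable)
  then show ?thesis
    unfolding wint_def using wint_integrable assms by simp
qed

lemma wint_scale:
  assumes "f \<in> L2 L" "f1 \<in> L2 L" "g \<in> L2 L" and ae: "AE x in M. f x = c * f1 x"
  shows "wint \<epsilon> f g = c * wint \<epsilon> f1 g"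
proof -
  have "wint \<epsilon> f g = (\<integral>x. c * ((1 + \<epsilon> * x) * (f1 x * g x)) \<partial>M)"
    unfolding wint_def
  proof (rule integral_cong_AE)
    show "AE x in M. (1 + \<epsilon> * x) * (f x * g x) = c * ((1 + \<epsilon> * x) * (f1 x * g x))"
      using ae by eventually_elim (simp add: algebra_simps)
  qed (use assms(1-3)[THEN L2_D(1)] in measurable)
  then show ?thesis by (simp add: wint_def)
qed

lemma wint_0_nonneg: "0 \<le> wint 0 f f"
  by (simp add: wint_0)

lemma wint_bound:
  assumes f: "f \<in> L2 L" and g: "g \<in> L2 L" and "\<epsilon> \<ge> 0"
  shows "\<bar>wint \<epsilon> f g\<bar> \<le> (1 + \<epsilon> * L) * ((wint 0 f f + wint 0 g g) / 2)"
proof -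
  have "\<bar>wint \<epsilon> f g\<bar> \<le> (\<integral>x. (1 + \<epsilon> * L) * ((f x * f x + g x * g x) / 2) \<partial>M)"
    unfolding wint_def
  proof (rule integral_abs_bound_integral)
    show "integrable M (\<lambda>x. (1 + \<epsilon> * x) * (f x * g x))" by (rule wint_integrable[OF f g])
    show "integrable M (\<lambda>x. (1 + \<epsilon> * L) * ((f x * f x + g x * g x) / 2))"
      using L2_mult[OF f f] L2_mult[OF g g] by simp
    fix x assume "x \<in> space M"
    then have x: "0 < x" "x < L" by auto
    have "2 * \<bar>f x * g x\<bar> \<le> f x * f x + g x * g x"
      using sum_squares_bound[of "\<bar>f x\<bar>" "\<bar>g x\<bar>"] by (simp add: abs_mult power2_eq_square)
    moreover have "\<bar>1 + \<epsilon> * x\<bar> \<le> 1 + \<epsilon> * L" "0 \<le> 1 + \<epsilon> * L"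
      using x \<open>\<epsilon> \<ge> 0\<close> L_pos by (auto simp: mult_left_mono)
    ultimately show "\<bar>(1 + \<epsilon> * x) * (f x * g x)\<bar> \<le> (1 + \<epsilon> * L) * ((f x * f x + g x * g x) / 2)"
      by (subst abs_mult, intro mult_mono) auto
  qed
  also have "\<dots> = (1 + \<epsilon> * L) * ((wint 0 f f + wint 0 g g) / 2)"
    using L2_mult[OF f f] L2_mult[OF g g] by (simp add: wint_0)
  finally show ?thesis .
qed

lemma H2_D:
  assumes "u \<in> H2 L" shows "u \<in> H1 L" "weak_deriv L u \<in> H1 L"
  using assms by (auto simp: H2_def)

text \<open>The product rule for primitives evaluated at \<open>L\<close>, after \<open>p\<close>
  and \<open>v\<close> are replaced by their continuous representatives.\<close>

lemma wint_by_parts: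
  assumes p: "p \<in> H1 L" and v: "v \<in> H1 L"
  shows "wint 0 p (weak_deriv L v) + wint 0 v (weak_deriv L p)
    = point_value L p L * point_value L v L - point_value L p 0 * point_value L v 0"
proof -
  let ?dp = "weak_deriv L p" and ?dv = "weak_deriv L v"
  let ?p = "\<lambda>x. point_value L p 0 + primitive ?dp x" and ?v = "\<lambda>x. point_value L v 0 + primitive ?dv x"
  have L2: "p \<in> L2 L" "v \<in> L2 L" "?dp \<in> L2 L" "?dv \<in> L2 L" using p v by (auto intro: H1_L2)
  have meas: "?p \<in> borel_measurable M" "?v \<in> borel_measurable M"
    using L2 L2_integrable by auto
  have "wint 0 p ?dv + wint 0 v ?dp = (\<integral>x. p x * ?dv x + ?dp x * v x \<partial>M)"
    using L2_mult[OF L2(1,4)] L2_mult[OF L2(2,3)] by (simp add: wint_0 mult.commute)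
  also have "\<dots> = (\<integral>x. ?p x * ?dv x + ?dp x * ?v x \<partial>M)"
  proof (rule integral_cong_AE)
    show "AE x in M. p x * ?dv x + ?dp x * v x = ?p x * ?dv x + ?dp x * ?v x"
      using H1_primitive(1)[OF p] H1_primitive(1)[OF v]
    proof eventually_elim
      case (elim x)
      show ?case by (simp only: elim)
    qed
  qed (use L2[THEN L2_D(1)] meas in measurable)
  also have "\<dots> = ?p L * ?v L - point_value L p 0 * point_value L v 0"
    using primitive_product[OF L2(3,4)[THEN L2_integrable], of _ L] primitive_ge[OF order_refl] by simp
  also have "?p L = point_value L p L" using H1_primitive(2)[OF p, of L] L_pos by simp
  also have "?v L = point_value L v L" using H1_primitive(2)[OF v, of L] L_pos by simp
  finally show ?thesis .
qed

text \<open>The product rule is used twice, for \<open>p * p\<close> and for the weight times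
  \<open>p * p\<close>. The identity serves for the gradient and for the velocity; in the latter
  case the boundary term at \<open>0\<close> supplies the damping of the trace.\<close>

lemma wint_weighted_by_parts:
  assumes p: "p \<in> H1 L"
  shows "2 * wint \<epsilon> p (weak_deriv L p)
    = (1 + \<epsilon> * L) * (point_value L p L)\<^sup>2 - (point_value L p 0)\<^sup>2 - \<epsilon> * wint 0 p p"
proof -
  let ?dp = "weak_deriv L p" and ?a = "point_value L p 0"
  let ?p = "\<lambda>x. ?a + primitive ?dp x"
  let ?k = "\<lambda>x. ?p x * ?dp x + ?dp x * ?p x"
  have L2: "p \<in> L2 L" "?dp \<in> L2 L" using p by (auto intro: H1_L2)
  note i = L2[THEN L2_integrable]
  have p_meas: "?p \<in> borel_measurable M" using i by auto
  have p_L2: "?p \<in> L2 L" using H1_primitive(1)[OF p] by (intro L2_AE_cong[OF L2(1) p_meas])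
  have k: "integrable M ?k" using L2_mult[OF p_L2 L2(2)] L2_mult[OF L2(2) p_L2] by simp
  have ci: "integrable M (\<lambda>_. \<epsilon>)" by simp
  \<comment> \<open>The weight is \<open>1\<close> plus the primitive of the constant \<epsilon>, so
    it fits the product rule.\<close>
  have lin: "primitive (\<lambda>_. \<epsilon>) x = \<epsilon> * x" if "x \<in> {0..L}" for x
  proof -
    have "((\<lambda>y. \<epsilon> * y) has_vector_derivative \<epsilon>) (at y)" for y
      by (auto intro!: derivative_eq_intros simp: has_real_derivative_iff_has_vector_derivative[symmetric])
    from primitive_eq_diff[OF this ci that] show ?thesis by simp
  qed
  have sq: "?p x * ?p x = ?a * ?a + primitive ?k x" for x
    by (rule primitive_product[OF i(2) i(2)])
  have "(1 + \<epsilon> * L) * (?p L * ?p L) = (1 + primitive (\<lambda>_. \<epsilon>) L) * (?a * ?a + primitive ?k L)"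
    using lin[of L] L_pos by (simp only: sq) simp
  also have "\<dots> = 1 * (?a * ?a) +
      primitive (\<lambda>y. (1 + primitive (\<lambda>_. \<epsilon>) y) * ?k y + \<epsilon> * (?a * ?a + primitive ?k y)) L"
    by (rule primitive_product[OF ci k])
  also have "\<dots> = ?a * ?a + (\<integral>y. (1 + primitive (\<lambda>_. \<epsilon>) y) * ?k y + \<epsilon> * (?p y * ?p y) \<partial>M)"
    by (simp only: primitive_ge[OF order_refl] sq mult_1)
  also have "(\<integral>y. (1 + primitive (\<lambda>_. \<epsilon>) y) * ?k y + \<epsilon> * (?p y * ?p y) \<partial>M)
      = (\<integral>y. 2 * ((1 + \<epsilon> * y) * (p y * ?dp y)) + \<epsilon> * (p y * p y) \<partial>M)"
  proof (rule integral_cong_AE)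
    show "AE y in M. (1 + primitive (\<lambda>_. \<epsilon>) y) * ?k y + \<epsilon> * (?p y * ?p y)
        = 2 * ((1 + \<epsilon> * y) * (p y * ?dp y)) + \<epsilon> * (p y * p y)"
      using H1_primitive(1)[OF p] AE_M_mem
    proof eventually_elim
      case (elim y)
      have "primitive (\<lambda>_. \<epsilon>) y = \<epsilon> * y" using elim(2) by (intro lin) auto
      then show ?case unfolding elim(1)[symmetric] by (simp add: algebra_simps)
    qed
    show "(\<lambda>y. (1 + primitive (\<lambda>_. \<epsilon>) y) * ?k y + \<epsilon> * (?p y * ?p y)) \<in> borel_measurable M"
      using L2_D(1)[OF L2(2)] p_meas primitive_measurable[OF ci] by measurable
    show "(\<lambda>y. 2 * ((1 + \<epsilon> * y) * (p y * ?dp y)) + \<epsilon> * (p y * p y)) \<in> borel_measurable M"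
      using L2[THEN L2_D(1)] by measurable
  qed
  also have "\<dots> = 2 * wint \<epsilon> p ?dp + \<epsilon> * wint 0 p p"
    using wint_integrable[OF L2, of \<epsilon>] L2_mult[OF L2(1,1)] by (simp add: wint_def)
  finally have "(1 + \<epsilon> * L) * (?p L * ?p L) = ?a * ?a + (2 * wint \<epsilon> p ?dp + \<epsilon> * wint 0 p p)" .
  moreover have "?p L = point_value L p L" using H1_primitive(2)[OF p, of L] L_pos by simp
  ultimately show ?thesis by (simp add: power2_eq_square)
qed

section \<open>The state space and its quadratic forms\<close>

abbreviation dx :: "state \<Rightarrow> real \<Rightarrow> real" where "dx X \<equiv> weak_deriv L (fst (fst X))"
abbreviation vel :: "state \<Rightarrow> real \<Rightarrow> real" where "vel X \<equiv> fst (snd X)"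
abbreviation trace :: "state \<Rightarrow> real" where "trace X \<equiv> snd (snd X)"

lemma state_space_D:
  assumes "X \<in> state_space L"
  shows "fst (fst X) \<in> H1 L" "fst (fst X) \<in> L2 L" "dx X \<in> L2 L" "vel X \<in> L2 L"
    "fst X \<in> H_space L" "snd X \<in> H_space L"
  using assms H1_L2 by (auto simp: state_space_def V_space_def H_space_def)

lemma subspace_V_space: "subspace (V_space L)"
  unfolding subspace_def
proof (intro conjI ballI allI)
  show "0 \<in> V_space L"
    using H1_zero point_value_scale[OF H1_zero, of 0 0] L_pos by (simp add: V_space_def zero_prod_def)
  fix x y and c :: real assume xy: "x \<in> V_space L"
  show "c *\<^sub>R x \<in> V_space L"
    using xy L_pos by (auto simp: V_space_def H1_scale point_value_scale)
  assume "y \<in> V_space L"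
  then show "x + y \<in> V_space L"
    using xy L_pos by (auto simp: V_space_def H1_add point_value_add)
qed

lemma subspace_H_space: "subspace (H_space L)"
  using L2_const[of 0] unfolding subspace_def H_space_def
  by (auto simp: zero_prod_def zero_fun_def plus_fun_def scaleR_fun_def L2_add L2_scale)

lemma subspace_state_space: "subspace (state_space L)"
  unfolding state_space_def by (intro subspace_Times subspace_V_space subspace_H_space)

lemma dx_linear:
  assumes "X \<in> state_space L" "Y \<in> state_space L"
  shows "AE x in M. dx (X + Y) x = dx X x + dx Y x" "AE x in M. dx (c *\<^sub>R X) x = c * dx X x"
  using weak_deriv_add[of "fst (fst X)" "fst (fst Y)"] weak_deriv_scale[of "fst (fst X)" c]
    state_space_D(1)[OF assms(1)] state_space_D(1)[OF assms(2)] by simp_all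

lemma wint_dx:
  assumes X: "X \<in> state_space L" and Y: "Y \<in> state_space L" and g: "g \<in> L2 L"
  shows "wint \<epsilon> (dx (X + Y)) g = wint \<epsilon> (dx X) g + wint \<epsilon> (dx Y) g"
    and "wint \<epsilon> (dx (c *\<^sub>R X)) g = c * wint \<epsilon> (dx X) g"
proof -
  have XY: "X + Y \<in> state_space L" "c *\<^sub>R X \<in> state_space L"
    using subspace_state_space X Y by (auto intro: subspace_add subspace_scale)
  show "wint \<epsilon> (dx (X + Y)) g = wint \<epsilon> (dx X) g + wint \<epsilon> (dx Y) g"
    by (intro wint_add state_space_D(3) X Y XY g dx_linear)
  show "wint \<epsilon> (dx (c *\<^sub>R X)) g = c * wint \<epsilon> (dx X) g"
    by (intro wint_scale state_space_D(3) X XY g dx_linear(2)[OF X X])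
qed

lemma wint_plus:
  assumes "f \<in> L2 L" "h \<in> L2 L" "g \<in> L2 L"
  shows "wint \<epsilon> (f + h) g = wint \<epsilon> f g + wint \<epsilon> h g" "wint \<epsilon> (c *\<^sub>R f) g = c * wint \<epsilon> f g"
proof -
  have "f + h \<in> L2 L" "c *\<^sub>R f \<in> L2 L"
    using assms by (auto simp: plus_fun_def scaleR_fun_def L2_add L2_scale)
  then show "wint \<epsilon> (f + h) g = wint \<epsilon> f g + wint \<epsilon> h g" "wint \<epsilon> (c *\<^sub>R f) g = c * wint \<epsilon> f g"
    using assms by (auto intro!: wint_add wint_scale simp: scaleR_fun_def)
qed

lemma psd_form_inner_H: "psd_form (H_space L) (inner_H L)"
proof
  have ih: "inner_H L v w = wint 0 (fst v) (fst w) + snd v * snd w" for v w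
    by (simp add: inner_H_def wint_0)
  show "subspace (H_space L)" by (rule subspace_H_space)
  fix x y z and c :: real
  assume x: "x \<in> H_space L"
  then have x': "fst x \<in> L2 L" by (auto simp: H_space_def)
  show "0 \<le> inner_H L x x" by (simp add: ih wint_0_nonneg)
  assume z: "z \<in> H_space L"
  then have z': "fst z \<in> L2 L" by (auto simp: H_space_def)
  show "inner_H L (c *\<^sub>R x) z = c * inner_H L x z"
    using wint_plus(2)[OF x' x' z'] by (simp add: ih algebra_simps)
  show "inner_H L x z = inner_H L z x" by (simp add: ih wint_sym[of _ "fst x"] mult.commute)
  assume "y \<in> H_space L"
  then have "fst y \<in> L2 L" by (auto simp: H_space_def)
  from wint_plus(1)[OF x' this z'] show "inner_H L (x + y) z = inner_H L x z + inner_H L y z"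
    by (simp add: ih algebra_simps)
qed

lemma inner_state_wint:
  "inner_state L X Y = wint 0 (fst (fst X)) (fst (fst Y)) + wint 0 (dx X) (dx Y) + snd (fst X) * snd (fst Y)
    + wint 0 (vel X) (vel Y) + trace X * trace Y"
  by (simp add: inner_state_def inner_V_def inner_H1_def inner_H_def wint_0)

lemma psd_form_inner_state: "psd_form (state_space L) (inner_state L)"
proof
  show "subspace (state_space L)" by (rule subspace_state_space)
  fix x y z :: state and c :: real
  assume x: "x \<in> state_space L"
  note x' = state_space_D[OF x]
  show "0 \<le> inner_state L x x" by (simp add: inner_state_wint wint_0_nonneg)
  assume z: "z \<in> state_space L"
  note z' = state_space_D[OF z]
  show "inner_state L (c *\<^sub>R x) z = c * inner_state L x z"
    using wint_plus(2)[OF x'(2) x'(2) z'(2)] wint_plus(2)[OF x'(4) x'(4) z'(4)] wint_dx(2)[OF x x z'(3)]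
    by (simp add: inner_state_wint algebra_simps)
  show "inner_state L x z = inner_state L z x"
    by (simp add: inner_state_wint wint_sym[of _ "fst (fst x)"] wint_sym[of _ "dx x"] wint_sym[of _ "vel x"] mult.commute)
  assume y: "y \<in> state_space L"
  note y' = state_space_D[OF y]
  show "inner_state L (x + y) z = inner_state L x z + inner_state L y z"
    using wint_plus(1)[OF x'(2) y'(2) z'(2)] wint_plus(1)[OF x'(4) y'(4) z'(4)] wint_dx(1)[OF x y z'(3)]
    by (simp add: inner_state_wint algebra_simps)
qed

text \<open>\<open>lyap \<beta> \<epsilon> X X\<close> is the energy perturbed by \<open>\<beta> \<integral> (1 + \<epsilon> x) u\<^sub>x u\<^sub>t\<close>; for \<open>\<beta> = 0\<close> it is the energy.\<close>

definition lyap :: "real \<Rightarrow> real \<Rightarrow> state \<Rightarrow> state \<Rightarrow> real"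
  where "lyap \<beta> \<epsilon> X Y = (wint 0 (dx X) (dx Y) + wint 0 (vel X) (vel Y) + trace X * trace Y) / 2
    + \<beta> / 2 * (wint \<epsilon> (vel X) (dx Y) + wint \<epsilon> (vel Y) (dx X))"

lemma energy_eq_lyap:
  assumes "X \<in> state_space L" shows "energy L X = lyap 0 \<epsilon> X X"
proof -
  have "(norm_H L (snd X))\<^sup>2 = inner_H L (snd X) (snd X)"
    using psd_form.nonneg[OF psd_form_inner_H state_space_D(6)[OF assms]] by (simp add: norm_H_def)
  then show ?thesis
    by (simp add: energy_def lyap_def wint_0 inner_H_def case_prod_unfold power2_eq_square)
qed

text \<open>The weight is at most \<open>1 + \<epsilon> * L\<close>, and Young's inequality bounds
  the cross term by the gradient and velocity parts of the energy; the trace part is slack.\<close>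

lemma lyap_energy_bounds:
  assumes X: "X \<in> state_space L" and "0 \<le> \<beta>" "0 \<le> \<epsilon>"
  shows "\<bar>lyap \<beta> \<epsilon> X X - energy L X\<bar> \<le> \<beta> * (1 + \<epsilon> * L) * energy L X"
proof -
  let ?D = "wint 0 (dx X) (dx X)" and ?V = "wint 0 (vel X) (vel X)"
  have e: "energy L X = (?D + ?V + trace X * trace X) / 2"
    unfolding energy_eq_lyap[OF X, of 0] by (simp add: lyap_def)
  have "lyap \<beta> \<epsilon> X X - energy L X = \<beta> * wint \<epsilon> (vel X) (dx X)"
    by (simp add: e lyap_def)
  then have "\<bar>lyap \<beta> \<epsilon> X X - energy L X\<bar> = \<beta> * \<bar>wint \<epsilon> (vel X) (dx X)\<bar>"
    using \<open>0 \<le> \<beta>\<close> by (simp add: abs_mult)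
  also have "\<dots> \<le> \<beta> * ((1 + \<epsilon> * L) * ((?V + ?D) / 2))"
    using assms state_space_D[OF X] by (intro mult_left_mono wint_bound)
  also have "\<dots> \<le> \<beta> * ((1 + \<epsilon> * L) * energy L X)"
    using assms L_pos by (intro mult_left_mono) (auto simp: e)
  finally show ?thesis by (simp add: mult.assoc)
qed

lemma energy_nonneg: "X \<in> state_space L \<Longrightarrow> 0 \<le> energy L X"
  by (simp add: energy_def case_prod_unfold)

text \<open>The purpose is to differentiate the Lyapunov function as a quadratic form in its own
  seminorm. Semidefiniteness is where the upper bound on \<beta> enters.\<close>

lemma psd_form_lyap:
  assumes le: "0 \<le> \<beta>" "0 \<le> \<epsilon>" "\<beta> * (1 + \<epsilon> * L) \<le> 1"
  shows "psd_form (state_space L) (lyap \<beta> \<epsilon>)"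
proof
  show "subspace (state_space L)" by (rule subspace_state_space)
  fix x y z :: state and c :: real
  assume x: "x \<in> state_space L"
  note x' = state_space_D[OF x]
  show "0 \<le> lyap \<beta> \<epsilon> x x"
    using lyap_energy_bounds[OF x le(1,2)] mult_right_mono[OF le(3) energy_nonneg[OF x]] by linarith
  assume z: "z \<in> state_space L"
  note z' = state_space_D[OF z]
  show "lyap \<beta> \<epsilon> (c *\<^sub>R x) z = c * lyap \<beta> \<epsilon> x z"
    using wint_plus(2)[OF x'(4) x'(4) z'(4)] wint_plus(2)[OF x'(4) x'(4) z'(3)]
      wint_dx(2)[OF x x z'(3)] wint_dx(2)[OF x x z'(4)]
    by (simp add: lyap_def wint_sym[of _ "vel z"] field_simps)
  show "lyap \<beta> \<epsilon> x z = lyap \<beta> \<epsilon> z x"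
    by (simp add: lyap_def wint_sym[of 0 "dx x"] wint_sym[of 0 "vel x"] mult.commute add.commute)
  assume y: "y \<in> state_space L"
  note y' = state_space_D[OF y]
  show "lyap \<beta> \<epsilon> (x + y) z = lyap \<beta> \<epsilon> x z + lyap \<beta> \<epsilon> y z"
    using wint_plus(1)[OF x'(4) y'(4) z'(4)] wint_plus(1)[OF x'(4) y'(4) z'(3)]
      wint_dx(1)[OF x y z'(3)] wint_dx(1)[OF x y z'(4)]
    by (simp add: lyap_def wint_sym[of _ "vel z"] field_simps)
qed

end

text \<open>A bounded linear map carries absolute continuity, derivatives and uniform limits along.
  The instances are the two projections of a state, measured in \<open>H\<close>, and the identity
  from the state norm to the Lyapunov seminorm.\<close>

locale seminorm_map =
  fixes S :: "'a::real_vector set" and N :: "'a \<Rightarrow> real"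
    and N' :: "'b::real_vector \<Rightarrow> real" and p :: "'a \<Rightarrow> 'b" and C :: real
  assumes S: "subspace S" and p: "linear p" and C: "0 \<le> C"
    and N'_nonneg: "x \<in> S \<Longrightarrow> 0 \<le> N' (p x)"
    and bound: "x \<in> S \<Longrightarrow> N' (p x) \<le> C * N x"
begin

lemma abs_cont:
  assumes ac: "locally_abs_cont_wrt N X" and X: "\<And>t. t \<ge> 0 \<Longrightarrow> X t \<in> S"
  shows "locally_abs_cont_wrt N' (\<lambda>t. p (X t))"
proof (rule locally_abs_cont_wrt_dominated[OF ac], intro exI[of _ C] conjI allI impI C)
  fix T s t :: real assume st: "0 \<le> s \<and> s \<le> t \<and> t \<le> T"
  then have "N' (p (X t - X s)) \<le> C * N (X t - X s)"
    by (intro bound subspace_diff[OF S] X) auto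
  moreover have "0 \<le> C * (t - s)" using st C by simp
  ultimately show "N' (p (X t) - p (X s)) \<le> C * (N (X t - X s) + (t - s))"
    by (simp add: linear_diff[OF p] distrib_left)
qed

lemma has_deriv:
  assumes der: "has_deriv_wrt N X Y t" and X: "\<And>t. t \<ge> 0 \<Longrightarrow> X t \<in> S" and Y: "Y \<in> S" and "t \<ge> 0"
  shows "has_deriv_wrt N' (\<lambda>t. p (X t)) (p Y) t"
  unfolding has_deriv_wrt_def
proof (rule tendsto_0_le[OF der[unfolded has_deriv_wrt_def], of _ C])
  have "norm (N' ((1 / (s - t)) *\<^sub>R (p (X s) - p (X t)) - p Y))
      \<le> norm (N ((1 / (s - t)) *\<^sub>R (X s - X t) - Y)) * C" if "s \<ge> 0" for s
  proof -
    let ?z = "(1 / (s - t)) *\<^sub>R (X s - X t) - Y"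
    have z: "?z \<in> S" using that \<open>t \<ge> 0\<close> X Y by (intro subspace_diff[OF S] subspace_scale[OF S]) auto
    have "N' (p ?z) \<le> C * N ?z" by (rule bound[OF z])
    also have "\<dots> \<le> C * norm (N ?z)" using C by (intro mult_left_mono) auto
    finally show ?thesis
      using N'_nonneg[OF z] by (simp add: linear_diff[OF p] linear_scale[OF p] mult.commute)
  qed
  then show "\<forall>\<^sub>F s in at t within {0..}. norm (N' ((1 / (s - t)) *\<^sub>R (p (X s) - p (X t)) - p Y))
      \<le> norm (N ((1 / (s - t)) *\<^sub>R (X s - X t) - Y)) * C"
    by (simp add: eventually_at_filter)
qed

lemma uniform_limit:
  assumes lim: "uniform_limit {0..T} (\<lambda>n t. N (Xs n t - X t)) (\<lambda>t. 0) sequentially"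
    and Xs: "\<And>n t. t \<ge> 0 \<Longrightarrow> Xs n t \<in> S" and X: "\<And>t. t \<ge> 0 \<Longrightarrow> X t \<in> S"
  shows "uniform_limit {0..T} (\<lambda>n t. N' (p (Xs n t) - p (X t))) (\<lambda>t. 0) sequentially"
proof (rule uniform_limitI)
  fix e :: real assume "e > 0"
  define d where "d = e / (C + 1)"
  have "d > 0" "C * d < e" using \<open>e > 0\<close> C by (auto simp: d_def field_simps)
  from uniform_limitD[OF lim \<open>d > 0\<close>]
  show "\<forall>\<^sub>F n in sequentially. \<forall>t\<in>{0..T}. dist (N' (p (Xs n t) - p (X t))) 0 < e"
  proof (eventually_elim, intro ballI)
    fix n t assume n: "\<forall>t\<in>{0..T}. dist (N (Xs n t - X t)) 0 < d" and t: "t \<in> {0..T}"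
    have z: "Xs n t - X t \<in> S" using t by (intro subspace_diff[OF S] Xs X) auto
    have "N' (p (Xs n t - X t)) \<le> C * N (Xs n t - X t)" by (rule bound[OF z])
    also have "\<dots> \<le> C * d" using bspec[OF n t] C by (intro mult_left_mono) auto
    finally show "dist (N' (p (Xs n t) - p (X t))) 0 < e"
      using N'_nonneg[OF z] \<open>C * d < e\<close> by (simp add: linear_diff[OF p])
  qed
qed

end

section \<open>Weak solutions and their velocity\<close>

context bounded_interval
begin

interpretation H: psd_form "H_space L" "inner_H L" by (rule psd_form_inner_H)
interpretation St: psd_form "state_space L" "inner_state L" by (rule psd_form_inner_state)

lemma nrm_eq: "H.nrm = norm_H L" "St.nrm = norm_state L"
  by (auto simp: H.nrm_def norm_H_def St.nrm_def norm_state_def)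

lemma seminorm_map_fst: "seminorm_map (state_space L) (norm_state L) (norm_H L) fst 1"
proof
  fix X assume X: "X \<in> state_space L"
  show "0 \<le> norm_H L (fst X)"
    using H.nrm_nonneg[OF state_space_D(5)[OF X]] by (simp add: nrm_eq)
  have "inner_H L (fst X) (fst X) \<le> inner_state L X X"
    by (simp add: inner_state_wint inner_H_def wint_0)
  then show "norm_H L (fst X) \<le> 1 * norm_state L X" by (simp add: norm_H_def norm_state_def)
qed (auto simp: subspace_state_space intro: linearI)

lemma seminorm_map_snd: "seminorm_map (state_space L) (norm_state L) (norm_H L) snd 1"
proof
  fix X assume X: "X \<in> state_space L"
  show "0 \<le> norm_H L (snd X)"
    using H.nrm_nonneg[OF state_space_D(6)[OF X]] by (simp add: nrm_eq)
  have "inner_H L (snd X) (snd X) \<le> inner_state L X X"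
    by (simp add: inner_state_wint inner_H_def wint_0)
  then show "norm_H L (snd X) \<le> 1 * norm_state L X" by (simp add: norm_H_def norm_state_def)
qed (auto simp: subspace_state_space intro: linearI)

lemma state_space_snd_V: "X \<in> dom_A L g \<Longrightarrow> snd X \<in> V_space L"
  by (auto simp: dom_A_def)

lemma field_fst: "fst (op_F F X - op_A L X) = snd X"
  by (simp add: op_F_def op_A_def case_prod_unfold zero_prod_def)

lemma field_snd:
  "snd (op_F F X - op_A L X) = (weak_deriv L (dx X), point_value L (dx X) 0 + F (trace X))"
  by (simp add: op_F_def op_A_def case_prod_unfold zero_fun_def)

text \<open>In a general state the trace is independent of the velocity function. In the domain of
  the operator it is a boundary value, and gradient and velocity are both in \<open>H1\<close>, so
  integration by parts is available.\<close>

lemma dom_A_D: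
  assumes "X \<in> dom_A L g"
  shows "X \<in> state_space L" "dx X \<in> H1 L" "vel X \<in> H1 L" "trace X = point_value L (vel X) 0"
    "point_value L (dx X) L = - g (point_value L (vel X) L)"
    "op_F F X - op_A L X \<in> state_space L"
proof -
  show "X \<in> state_space L" "dx X \<in> H1 L" "vel X \<in> H1 L" "trace X = point_value L (vel X) 0"
    "point_value L (dx X) L = - g (point_value L (vel X) L)"
    using assms H2_D H1_L2
    by (auto simp: dom_A_def W_space_def V_space_def state_space_def H_space_def)
  then have "weak_deriv L (dx X) \<in> L2 L" by (intro H1_L2)
  then show "op_F F X - op_A L X \<in> state_space L"
    using state_space_snd_V[OF assms]
    unfolding state_space_def mem_Times_iff field_fst field_snd by (simp add: H_space_def)
qed

text \<open>For strong solutions the first component of the equation says, in \<open>H\<close> and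
  almost everywhere, that the velocity is the derivative. Both components converge uniformly on
  bounded intervals, so the limit inherits this at every time.\<close>

lemma weak_state_solution_has_deriv:
  assumes sol: "weak_state_solution L g F X" and "t \<ge> 0"
  shows "has_deriv_wrt (norm_H L) (\<lambda>t. fst (X t)) (snd (X t)) t"
proof -
  interpret fst: seminorm_map "state_space L" "norm_state L" "norm_H L" fst 1 by (rule seminorm_map_fst)
  interpret snd: seminorm_map "state_space L" "norm_state L" "norm_H L" snd 1 by (rule seminorm_map_snd)
  obtain Xs where X: "\<And>t. t \<ge> 0 \<Longrightarrow> X t \<in> state_space L" and strong: "\<And>n. strong_solution L g F (Xs n)"
    and lim: "\<And>T. T > 0 \<Longrightarrow> uniform_limit {0..T} (\<lambda>n t. norm_state L (Xs n t - X t)) (\<lambda>t. 0) sequentially"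
    using sol unfolding weak_state_solution_def by blast
  have Xs: "\<And>n t. t \<ge> 0 \<Longrightarrow> Xs n t \<in> state_space L" and ac: "\<And>n. locally_abs_cont_wrt (norm_state L) (Xs n)"
    using strong unfolding strong_solution_def by blast+
  show ?thesis
  proof (rule H.uniform_limit_has_deriv_wrt[of "\<lambda>n t. fst (Xs n t)" "\<lambda>n t. snd (Xs n t)" _ "\<lambda>t. snd (X t)",
        unfolded nrm_eq])
    fix n
    show "locally_abs_cont_wrt (norm_H L) (\<lambda>t. fst (Xs n t))" by (rule fst.abs_cont[OF ac Xs])
    show "locally_abs_cont_wrt (norm_H L) (\<lambda>t. snd (Xs n t))" by (rule snd.abs_cont[OF ac Xs])
    have "AE t in lebesgue_on {0..}. Xs n t \<in> dom_A L g \<and>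
        has_deriv_wrt (norm_state L) (Xs n) (op_F F (Xs n t) - op_A L (Xs n t)) t"
      using strong unfolding strong_solution_def by blast
    moreover have "AE t in lebesgue_on {0..}. t \<ge> (0::real)" by (rule AE_I2) auto
    ultimately show "AE t in lebesgue_on {0..}. has_deriv_wrt (norm_H L) (\<lambda>t. fst (Xs n t)) (snd (Xs n t)) t"
    proof eventually_elim
      case (elim t)
      then have "has_deriv_wrt (norm_H L) (\<lambda>t. fst (Xs n t)) (fst (op_F F (Xs n t) - op_A L (Xs n t))) t"
        by (intro fst.has_deriv Xs dom_A_D(6)) auto
      then show ?case by (simp only: field_fst)
    qed
  next
    fix T :: real assume "T > 0"
    show "uniform_limit {0..T} (\<lambda>n t. norm_H L (fst (Xs n t) - fst (X t))) (\<lambda>t. 0) sequentially"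
      by (rule fst.uniform_limit[OF lim[OF \<open>T > 0\<close>] Xs X])
    show "uniform_limit {0..T} (\<lambda>n t. norm_H L (snd (Xs n t) - snd (X t))) (\<lambda>t. 0) sequentially"
      by (rule snd.uniform_limit[OF lim[OF \<open>T > 0\<close>] Xs X])
  qed (use X Xs \<open>t \<ge> 0\<close> state_space_D(5,6) in auto)
qed

text \<open>\<open>H_deriv\<close> may pick any derivative, but all of them have the same
  \<open>H\<close> norm, and the energy depends on the velocity only through that norm.\<close>

lemma solution_energy_eq:
  assumes sol: "weak_state_solution L g F (\<lambda>t. (u t, v t))" and "t \<ge> 0"
  shows "solution_energy L u t = energy L (u t, v t)"
proof -
  have X: "\<And>t. t \<ge> 0 \<Longrightarrow> (u t, v t) \<in> state_space L"
    using sol by (auto simp: weak_state_solution_def)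
  have mem: "u s \<in> H_space L" "v s \<in> H_space L" if "s \<ge> 0" for s
    using state_space_D(5,6)[OF X[OF that]] by auto
  have der: "has_deriv_wrt (norm_H L) u (v t) t"
    using weak_state_solution_has_deriv[OF sol \<open>t \<ge> 0\<close>] by simp
  let ?P = "\<lambda>w. w \<in> H_space L \<and> has_deriv_wrt (norm_H L) u w t"
  have "?P (v t)" using der mem \<open>t \<ge> 0\<close> by simp
  then have P: "?P (H_deriv L u t)" unfolding H_deriv_def by (rule someI[of ?P])
  have "norm_H L (H_deriv L u t) = norm_H L (v t)"
    using H.has_deriv_wrt_unique(2)[OF mem(1) \<open>t \<ge> 0\<close> conjunct1[OF P] mem(2)[OF \<open>t \<ge> 0\<close>],
        unfolded nrm_eq, OF _ conjunct2[OF P] der] by simp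
  then show ?thesis by (simp add: solution_energy_def energy_def)
qed

end

section \<open>Decay of the Lyapunov function\<close>

text \<open>The inequalities are what the Lyapunov argument consumes: \<open>2 * q < \<beta>\<close>
  at the end \<open>0\<close>, the last one at the end \<open>L\<close>, and
  \<open>\<beta> * (1 + \<epsilon> * L) < 1\<close> for coercivity. Bounds on \<open>F\<close> enter
  later, as they may hold only near \<open>0\<close>.\<close>

locale damped_wave = bounded_interval +
  fixes g F :: "real \<Rightarrow> real" and q \<alpha>\<^sub>1 \<alpha>\<^sub>2 \<beta> \<epsilon> :: real
  assumes g: "mono g" "g 0 = 0" "\<And>s. \<alpha>\<^sub>1 * \<bar>s\<bar> \<le> \<bar>g s\<bar>" "\<And>s. \<bar>g s\<bar> \<le> \<alpha>\<^sub>2 * \<bar>s\<bar>"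
    and q: "0 < q" "2 * q < \<beta>" and \<epsilon>: "0 < \<epsilon>"
    and \<beta>: "\<beta> * (1 + \<epsilon> * L) < 1" "\<beta> * (1 + \<epsilon> * L) * (1 + \<alpha>\<^sub>2\<^sup>2) \<le> 2 * \<alpha>\<^sub>1"
begin

abbreviation W :: "state \<Rightarrow> real" where "W X \<equiv> lyap \<beta> \<epsilon> X X"

definition \<kappa> :: real where "\<kappa> = 1 - \<beta> * (1 + \<epsilon> * L)"

text \<open>The minimum is the dissipation rate relative to the energy; the half comes from passing
  to \<open>W\<close>, which is at most twice the energy.\<close>

definition \<mu> :: real where "\<mu> = min (\<beta> - 2 * q) (\<beta> * \<epsilon>) / 2"

lemma pos: "\<beta> > 0" "\<kappa> > 0" "\<mu> > 0"
  using q \<epsilon> \<beta> by (auto simp: \<kappa>_def \<mu>_def)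

sublocale Ly: psd_form "state_space L" "lyap \<beta> \<epsilon>"
  using pos \<epsilon> \<beta> by (intro psd_form_lyap) auto

lemma W_bounds:
  assumes "X \<in> state_space L"
  shows "\<kappa> * energy L X \<le> W X" "W X \<le> 2 * energy L X"
proof -
  have *: "\<bar>W X - energy L X\<bar> \<le> \<beta> * (1 + \<epsilon> * L) * energy L X"
    using lyap_energy_bounds[OF assms, of \<beta> \<epsilon>] pos \<epsilon> by simp
  then show "\<kappa> * energy L X \<le> W X" by (simp add: \<kappa>_def left_diff_distrib abs_le_iff)
  have "\<beta> * (1 + \<epsilon> * L) * energy L X \<le> 1 * energy L X"
    using \<beta>(1) energy_nonneg[OF assms] by (intro mult_right_mono) auto
  with * show "W X \<le> 2 * energy L X" by simp
qed

lemma seminorm_map_lyap: "seminorm_map (state_space L) (norm_state L) Ly.nrm (\<lambda>X. X) 1"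
proof
  fix X assume X: "X \<in> state_space L"
  have "2 * energy L X \<le> inner_state L X X"
    unfolding energy_eq_lyap[OF X, of 0] by (simp add: lyap_def inner_state_wint wint_0_nonneg)
  then show "Ly.nrm X \<le> 1 * norm_state L X"
    using W_bounds(2)[OF X] by (simp add: Ly.nrm_def norm_state_def)
qed (auto simp: subspace_state_space intro: linearI)

lemma trace_bound:
  assumes "X \<in> state_space L" shows "(trace X)\<^sup>2 / 2 \<le> energy L X"
  unfolding energy_eq_lyap[OF assms, of 0] by (simp add: lyap_def power2_eq_square wint_0_nonneg)

text \<open>The damping at \<open>L\<close> absorbs the boundary terms produced by the multiplier \<open>1 + \<epsilon> x\<close>, whose value
  \<open>- \<beta> / 2 * \<theta>\<^sup>2\<close> at \<open>0\<close> in turn absorbs the anti-damping \<open>q \<theta>\<^sup>2\<close>.\<close>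

lemma dissipation:
  assumes X: "X \<in> dom_A L g" and small: "\<bar>F (trace X)\<bar> \<le> q * \<bar>trace X\<bar>"
  shows "2 * lyap \<beta> \<epsilon> X (op_F F X - op_A L X) \<le> - \<mu> * W X"
proof -
  note D = dom_A_D[OF X]
  define p v \<theta> where "p = dx X" and "v = vel X" and "\<theta> = trace X"
  have H1: "p \<in> H1 L" "v \<in> H1 L" using D by (auto simp: p_def v_def)
  define vL p0 P V where "vL = point_value L v L" and "p0 = point_value L p 0"
    and "P = wint 0 p p" and "V = wint 0 v v"
  have v0: "point_value L v 0 = \<theta>" and pL: "point_value L p L = - g vL"
    using D(4,5) by (simp_all add: p_def v_def vL_def \<theta>_def)
  have PV: "0 \<le> P" "0 \<le> V" by (simp_all add: P_def V_def wint_0_nonneg)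
  define B where "B = 1 + \<epsilon> * L"
  have "B > 0" using \<epsilon> L_pos by (simp add: B_def add_pos_pos)
  have "2 * lyap \<beta> \<epsilon> X (op_F F X - op_A L X)
      = (wint 0 p (weak_deriv L v) + wint 0 v (weak_deriv L p)) + \<theta> * (p0 + F \<theta>)
        + \<beta> / 2 * (2 * wint \<epsilon> v (weak_deriv L v) + 2 * wint \<epsilon> p (weak_deriv L p))"
    unfolding lyap_def field_fst field_snd
    by (simp add: p_def v_def \<theta>_def p0_def wint_sym[of \<epsilon> "weak_deriv L (dx X)"] field_simps)
  \<comment> \<open>The term \<open>\<theta> * p0\<close> from the dynamic boundary condition
    cancels the boundary term at \<open>0\<close> of the integration by parts.\<close>
  also have "\<dots> = - g vL * vL + \<theta> * F \<theta>
      + \<beta> / 2 * (B * (vL\<^sup>2 + (g vL)\<^sup>2) - \<theta>\<^sup>2 - p0\<^sup>2 - \<epsilon> * (P + V))"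
    unfolding wint_by_parts[OF H1] wint_weighted_by_parts[OF H1(1)] wint_weighted_by_parts[OF H1(2)]
    by (simp add: v0 pL vL_def[symmetric] p0_def[symmetric] P_def[symmetric] V_def[symmetric] B_def algebra_simps)
  \<comment> \<open>The term \<open>- p0\<^sup>2\<close> has a favourable sign and is
    dropped.\<close>
  also have "\<dots> \<le> - \<alpha>\<^sub>1 * vL\<^sup>2 + q * \<theta>\<^sup>2 + \<beta> / 2 * (B * ((1 + \<alpha>\<^sub>2\<^sup>2) * vL\<^sup>2) - \<theta>\<^sup>2 - 0 - \<epsilon> * (P + V))"
  proof (intro add_mono mult_left_mono diff_mono)
    \<comment> \<open>Monotonicity and \<open>g 0 = 0\<close> give \<open>g\<close> the sign of its
      argument, so the lower bound on \<open>\<bar>g s\<bar>\<close> becomes a bound for the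
      damping.\<close>
    have "0 \<le> g vL * vL"
    proof (cases "0 \<le> vL")
      case True
      then show ?thesis using monoD[OF g(1), of 0 vL] g(2) by simp
    next
      case False
      then show ?thesis using monoD[OF g(1), of vL 0] g(2) by (simp add: mult_nonpos_nonpos)
    qed
    then have "g vL * vL = \<bar>g vL\<bar> * \<bar>vL\<bar>" by (simp add: abs_mult[symmetric])
    also have "\<dots> \<ge> (\<alpha>\<^sub>1 * \<bar>vL\<bar>) * \<bar>vL\<bar>" by (intro mult_right_mono g) auto
    finally show "- g vL * vL \<le> - \<alpha>\<^sub>1 * vL\<^sup>2" by (simp add: power2_eq_square mult.assoc)
    have "\<theta> * F \<theta> \<le> \<bar>\<theta>\<bar> * \<bar>F \<theta>\<bar>" by (simp add: abs_mult[symmetric])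
    also have "\<dots> \<le> \<bar>\<theta>\<bar> * (q * \<bar>\<theta>\<bar>)" using small by (intro mult_left_mono) (auto simp: \<theta>_def)
    finally show "\<theta> * F \<theta> \<le> q * \<theta>\<^sup>2" by (simp add: power2_eq_square algebra_simps)
    have "(g vL)\<^sup>2 \<le> (\<alpha>\<^sub>2 * \<bar>vL\<bar>)\<^sup>2" using power_mono[OF g(4)[of vL], of 2] by simp
    then show "vL\<^sup>2 + (g vL)\<^sup>2 \<le> (1 + \<alpha>\<^sub>2\<^sup>2) * vL\<^sup>2" by (simp add: power_mult_distrib algebra_simps)
  qed (use pos \<epsilon> \<open>B > 0\<close> in auto)
  also have "\<dots> = (\<beta> * B * (1 + \<alpha>\<^sub>2\<^sup>2) / 2 - \<alpha>\<^sub>1) * vL\<^sup>2 - ((\<beta> - 2 * q) * (\<theta>\<^sup>2 / 2) + (\<beta> * \<epsilon>) * ((P + V) / 2))"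
    by (simp add: field_simps)
  also have "\<dots> \<le> 0 - ((2 * \<mu>) * (\<theta>\<^sup>2 / 2) + (2 * \<mu>) * ((P + V) / 2))"
  proof (intro diff_mono add_mono mult_right_mono)
    have "\<beta> * B * (1 + \<alpha>\<^sub>2\<^sup>2) / 2 - \<alpha>\<^sub>1 \<le> 0" using \<beta>(2) by (simp add: B_def)
    then show "(\<beta> * B * (1 + \<alpha>\<^sub>2\<^sup>2) / 2 - \<alpha>\<^sub>1) * vL\<^sup>2 \<le> 0" by (simp add: mult_nonpos_nonneg)
  qed (use PV in \<open>auto simp: \<mu>_def\<close>)
  also have "\<dots> = - \<mu> * (2 * energy L X)"
    unfolding energy_eq_lyap[OF D(1), of 0]
    by (simp add: lyap_def p_def v_def \<theta>_def P_def V_def power2_eq_square field_simps)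
  also have "\<dots> \<le> - \<mu> * W X"
    using W_bounds(2)[OF D(1)] pos by (simp add: mult_left_mono)
  finally show ?thesis .
qed

text \<open>\<open>\<kappa>\<close> and \<open>\<mu>\<close> do not involve \<delta>. The local
  version works with one \<delta>, the global one adapts \<delta> to the initial energy of the
  solution at hand, and the decay constants stay uniform.\<close>

context
  fixes \<delta> :: real
  assumes \<delta>: "\<delta> > 0" and F: "\<And>s. \<bar>s\<bar> < \<delta> \<Longrightarrow> \<bar>F s\<bar> \<le> q * \<bar>s\<bar>"
begin

text \<open>The threshold comes from \<open>\<kappa> * ((trace X)\<^sup>2 / 2) \<le> \<kappa> *
  energy L X \<le> W X\<close>: below it the trace is within the range where the bound on
  \<open>F\<close> holds.\<close>

lemma F_small:
  assumes X: "X \<in> state_space L" and "W X < \<kappa> * \<delta>\<^sup>2 / 2"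
  shows "\<bar>F (trace X)\<bar> \<le> q * \<bar>trace X\<bar>"
proof (rule F)
  have "\<kappa> * ((trace X)\<^sup>2 / 2) \<le> \<kappa> * energy L X"
    using trace_bound[OF X] pos by (intro mult_left_mono) auto
  also have "\<dots> < \<kappa> * (\<delta>\<^sup>2 / 2)" using W_bounds(1)[OF X] assms(2) by simp
  finally have "(trace X)\<^sup>2 < \<delta>\<^sup>2" using pos by simp
  then show "\<bar>trace X\<bar> < \<delta>" using \<delta> by (intro power2_less_imp_less[of "\<bar>trace X\<bar>"]) auto
qed

text \<open>Smallness is asked only strictly before \<open>b\<close>, so that the estimate still
  reaches a first exit time, where smallness fails.\<close>

lemma strong_solution_decay_while_small:
  assumes sol: "strong_solution L g F X" and "0 \<le> b"
    and small: "\<And>t. 0 \<le> t \<Longrightarrow> t < b \<Longrightarrow> W (X t) < \<kappa> * \<delta>\<^sup>2 / 2"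
  shows "W (X b) \<le> exp (- \<mu> * b) * W (X 0)"
proof -
  interpret id: seminorm_map "state_space L" "norm_state L" Ly.nrm "\<lambda>X. X" 1 by (rule seminorm_map_lyap)
  have X: "\<And>t. t \<ge> 0 \<Longrightarrow> X t \<in> state_space L" and ac: "locally_abs_cont_wrt (norm_state L) X"
    and ae: "AE t in lebesgue_on {0..}. X t \<in> dom_A L g \<and>
       has_deriv_wrt (norm_state L) X (op_F F (X t) - op_A L (X t)) t"
    using sol unfolding strong_solution_def by blast+
  show ?thesis
  proof (rule exponential_decay_of_derivative_le[OF Ly.abs_cont_quadratic[OF id.abs_cont[OF ac X] X] pos(3) \<open>0 \<le> b\<close>])
    \<comment> \<open>The endpoint, where smallness is not known, is a null set.\<close>
    have "AE t in lebesgue. t \<noteq> b" by (intro AE_completion AE_lborel_singleton)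
    then have "AE t in lebesgue_on {0..}. t \<noteq> b" by (subst AE_restrict_space_iff) (auto elim: eventually_mono)
    with ae show "AE t in lebesgue_on {0..}. t \<in> {0..b} \<longrightarrow>
      (\<exists>D. ((\<lambda>t. W (X t)) has_real_derivative D) (at t within {0..}) \<and> D \<le> - \<mu> * W (X t))"
    proof (eventually_elim, intro impI)
      fix t assume t: "X t \<in> dom_A L g \<and> has_deriv_wrt (norm_state L) X (op_F F (X t) - op_A L (X t)) t"
        "t \<noteq> b" "t \<in> {0..b}"
      then have "0 \<le> t" "t < b" by auto
      note Y = dom_A_D(6)[of "X t" g F]
      have "has_deriv_wrt Ly.nrm X (op_F F (X t) - op_A L (X t)) t"
        using t \<open>0 \<le> t\<close> by (intro id.has_deriv X Y) auto
      then have "((\<lambda>t. W (X t)) has_real_derivative 2 * lyap \<beta> \<epsilon> (X t) (op_F F (X t) - op_A L (X t))) (at t within {0..})"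
        using t by (intro Ly.has_deriv_wrt_quadratic X \<open>0 \<le> t\<close> Y) auto
      moreover have "2 * lyap \<beta> \<epsilon> (X t) (op_F F (X t) - op_A L (X t)) \<le> - \<mu> * W (X t)"
        using t F_small[OF X small] \<open>0 \<le> t\<close> \<open>t < b\<close> by (intro dissipation) auto
      ultimately show "\<exists>D. ((\<lambda>t. W (X t)) has_real_derivative D) (at t within {0..}) \<and> D \<le> - \<mu> * W (X t)"
        by blast
    qed
  qed
qed

text \<open>Barrier argument: at the first time \<open>Inf A\<close> at which the threshold is
  reached, the decay up to that time gives \<open>W (X (Inf A)) \<le> W (X 0)\<close>, which is
  below the threshold.\<close>

lemma strong_solution_decay:
  assumes sol: "strong_solution L g F X" and init: "W (X 0) < \<kappa> * \<delta>\<^sup>2 / 2" and "0 \<le> t"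
  shows "W (X t) \<le> exp (- \<mu> * t) * W (X 0)"
proof -
  interpret id: seminorm_map "state_space L" "norm_state L" Ly.nrm "\<lambda>X. X" 1 by (rule seminorm_map_lyap)
  have X: "\<And>t. t \<ge> 0 \<Longrightarrow> X t \<in> state_space L" and ac: "locally_abs_cont_wrt (norm_state L) X"
    using sol unfolding strong_solution_def by blast+
  have cont: "continuous_on {0..} (\<lambda>t. W (X t))"
    by (rule locally_abs_cont_wrt_continuous_on[OF Ly.abs_cont_quadratic[OF id.abs_cont[OF ac X] X]])
  have small: "W (X s) < \<kappa> * \<delta>\<^sup>2 / 2" if "0 \<le> s" for s
  proof (rule ccontr)
    assume big: "\<not> W (X s) < \<kappa> * \<delta>\<^sup>2 / 2"
    define A where "A = {t \<in> {0..}. \<kappa> * \<delta>\<^sup>2 / 2 \<le> W (X t)}"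
    have "closed A" unfolding A_def by (intro continuous_on_closed_Collect_le cont continuous_intros) auto
    moreover have "s \<in> A" "bdd_below A" using that big by (auto simp: A_def bdd_below_def)
    ultimately have "Inf A \<in> A" using closed_contains_Inf[of A] by auto
    have "W (X (Inf A)) \<le> exp (- \<mu> * Inf A) * W (X 0)"
    proof (rule strong_solution_decay_while_small[OF sol])
      fix t assume "0 \<le> t" "t < Inf A"
      then have "t \<notin> A" using cInf_lower[OF _ \<open>bdd_below A\<close>, of t] by auto
      then show "W (X t) < \<kappa> * \<delta>\<^sup>2 / 2" using \<open>0 \<le> t\<close> by (simp add: A_def)
    qed (use \<open>Inf A \<in> A\<close> in \<open>simp add: A_def\<close>)
    also have "\<dots> \<le> 1 * W (X 0)"
      using \<open>Inf A \<in> A\<close> pos Ly.nonneg[OF X, of 0] by (intro mult_right_mono) (auto simp: A_def)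
    finally show False using init \<open>Inf A \<in> A\<close> by (simp add: A_def)
  qed
  show ?thesis by (rule strong_solution_decay_while_small[OF sol \<open>0 \<le> t\<close> small])
qed

text \<open>The strict inequality for the initial value is an open condition, so it holds for all
  late approximants, and their estimates pass to the limit at each fixed time.\<close>

lemma weak_solution_decay:
  assumes sol: "weak_state_solution L g F X" and init: "W (X 0) < \<kappa> * \<delta>\<^sup>2 / 2" and "0 \<le> t"
  shows "W (X t) \<le> exp (- \<mu> * t) * W (X 0)"
proof -
  interpret id: seminorm_map "state_space L" "norm_state L" Ly.nrm "\<lambda>X. X" 1 by (rule seminorm_map_lyap)
  obtain Xs where X: "\<And>t. t \<ge> 0 \<Longrightarrow> X t \<in> state_space L" and strong: "\<And>n. strong_solution L g F (Xs n)"
    and lim: "\<And>T. T > 0 \<Longrightarrow> uniform_limit {0..T} (\<lambda>n t. norm_state L (Xs n t - X t)) (\<lambda>t. 0) sequentially"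
    using sol unfolding weak_state_solution_def by blast
  have Xs: "\<And>n t. t \<ge> 0 \<Longrightarrow> Xs n t \<in> state_space L"
    using strong unfolding strong_solution_def by blast
  have conv: "(\<lambda>n. W (Xs n s)) \<longlonglongrightarrow> W (X s)" if "0 \<le> s" for s
  proof (rule Ly.nrm_tendsto(2))
    have "s + 1 > 0" using that by simp
    from tendsto_uniform_limitI[OF id.uniform_limit[OF lim[OF this] Xs X], of s] that
    show "(\<lambda>n. Ly.nrm (Xs n s - X s)) \<longlonglongrightarrow> 0" by simp
  qed (use X Xs that in auto)
  have "\<forall>\<^sub>F n in sequentially. W (Xs n t) \<le> exp (- \<mu> * t) * W (Xs n 0)"
    using order_tendstoD(2)[OF conv[OF order_refl] init]
    by eventually_elim (use strong strong_solution_decay \<open>0 \<le> t\<close> in auto)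
  moreover have "(\<lambda>n. exp (- \<mu> * t) * W (Xs n 0)) \<longlonglongrightarrow> exp (- \<mu> * t) * W (X 0)"
    by (intro tendsto_intros conv) simp
  ultimately show ?thesis by (intro tendsto_le[OF sequentially_bot _ conv[OF \<open>0 \<le> t\<close>]])
qed

text \<open>The factor \<open>2 / \<kappa>\<close> is the quotient of the two equivalence constants
  between \<open>W\<close> and the energy.\<close>

lemma energy_decay:
  assumes sol: "weak_solution L g F u" and init: "2 * solution_energy L u 0 < \<kappa> * \<delta>\<^sup>2 / 2" and "0 \<le> t"
  shows "solution_energy L u t \<le> (2 / \<kappa>) * exp (- \<mu> * t) * solution_energy L u 0"
proof -
  obtain v where v: "weak_state_solution L g F (\<lambda>t. (u t, v t))"
    using sol by (auto simp: weak_solution_def)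
  note E = solution_energy_eq[OF v]
  have X: "\<And>t. t \<ge> 0 \<Longrightarrow> (u t, v t) \<in> state_space L"
    using v by (auto simp: weak_state_solution_def)
  have W0: "W (u 0, v 0) \<le> 2 * solution_energy L u 0" using W_bounds(2)[OF X[of 0]] E[of 0] by simp
  have "\<kappa> * solution_energy L u t \<le> W (u t, v t)"
    using W_bounds(1)[OF X] E \<open>0 \<le> t\<close> by simp
  also have "\<dots> \<le> exp (- \<mu> * t) * W (u 0, v 0)"
    using weak_solution_decay[OF v _ \<open>0 \<le> t\<close>] W0 init by simp
  also have "\<dots> \<le> exp (- \<mu> * t) * (2 * solution_energy L u 0)"
    using W0 by (intro mult_left_mono) auto
  finally show ?thesis using pos by (simp add: field_simps)
qed

end

end

section \<open>Choice of the constants and the two versions\<close>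

theorem theorem3:
  fixes L q \<alpha>\<^sub>1 \<alpha>\<^sub>2 :: real and g F :: "real \<Rightarrow> real"
  assumes "L > 0"
    and "continuous_on UNIV g" and "mono g" and "g 0 = 0"
    and "\<exists>C. C-lipschitz_on UNIV F" and "F 0 = 0"
    and "0 < q" and "q < 1 / 2"
    and "0 < \<alpha>\<^sub>1" and "\<alpha>\<^sub>1 \<le> \<alpha>\<^sub>2"
    and "\<forall>s. \<alpha>\<^sub>1 * \<bar>s\<bar> \<le> \<bar>g s\<bar> \<and> \<bar>g s\<bar> \<le> \<alpha>\<^sub>2 * \<bar>s\<bar>"
    and "\<alpha>\<^sub>1 / (1 + \<alpha>\<^sub>2\<^sup>2) > q"
  shows
    "(q-lipschitz_on UNIV F \<longrightarrow>
       (\<exists>M>0. \<exists>\<mu>>0. \<forall>u. weak_solution L g F u \<longrightarrow>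
          (\<forall>t\<ge>0. solution_energy L u t \<le> M * exp (- \<mu> * t) * solution_energy L u 0))) \<and>
     ((\<exists>N. 0 \<in> interior N \<and> q-lipschitz_on N F) \<longrightarrow>
       (\<exists>R>0. \<exists>M>0. \<exists>\<mu>>0. \<forall>u. weak_solution L g F u \<and> solution_energy L u 0 \<le> R \<longrightarrow>
          (\<forall>t\<ge>0. solution_energy L u t \<le> M * exp (- \<mu> * t) * solution_energy L u 0)))"
proof -
  define r where "r = \<alpha>\<^sub>1 / (1 + \<alpha>\<^sub>2\<^sup>2)"
  have den_pos: "1 + \<alpha>\<^sub>2\<^sup>2 > 0" by (simp add: add_pos_nonneg)
  have "r \<le> \<alpha>\<^sub>2 / (1 + \<alpha>\<^sub>2\<^sup>2)" unfolding r_def using assms(10) den_pos by (intro divide_right_mono) auto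
  \<comment> \<open>From \<open>2 * \<alpha>\<^sub>2 \<le> 1 + \<alpha>\<^sub>2\<^sup>2\<close>;
    this is what later gives \<open>\<beta> * (1 + \<epsilon> * L) < 1\<close>.\<close>
  also have "\<dots> \<le> 1 / 2" using sum_squares_bound[of 1 \<alpha>\<^sub>2] den_pos by (simp add: field_simps)
  finally have r: "q < r" "r \<le> 1 / 2" "r * (1 + \<alpha>\<^sub>2\<^sup>2) = \<alpha>\<^sub>1"
    using assms(12) den_pos by (auto simp: r_def)
  \<comment> \<open>The midpoint between \<open>2 * q\<close>, demanded by the anti-damping, and
    \<open>2 * r\<close>, allowed by the damping at \<open>L\<close>.\<close>
  define \<beta> where "\<beta> = q + r"
  have "\<beta> > 0" using r assms(7) by (simp add: \<beta>_def)
  \<comment> \<open>Half of the remaining gap \<open>2 * r - \<beta> = r - q\<close> is spent on the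
    weight: \<open>\<beta> * \<epsilon> * L = (r - q) / 2\<close>.\<close>
  define \<epsilon> where "\<epsilon> = (r - q) / (2 * \<beta> * L)"
  have "\<epsilon> > 0" using r \<open>\<beta> > 0\<close> \<open>L > 0\<close> by (simp add: \<epsilon>_def)
  have "\<beta> * (1 + \<epsilon> * L) = \<beta> + (r - q) / 2" using \<open>\<beta> > 0\<close> \<open>L > 0\<close> by (simp add: \<epsilon>_def field_simps)
  then have \<beta>: "\<beta> * (1 + \<epsilon> * L) < 2 * r" using r by (simp add: \<beta>_def field_simps)
  interpret damped_wave L g F q \<alpha>\<^sub>1 \<alpha>\<^sub>2 \<beta> \<epsilon>
  proof
    have "\<beta> * (1 + \<epsilon> * L) * (1 + \<alpha>\<^sub>2\<^sup>2) \<le> 2 * r * (1 + \<alpha>\<^sub>2\<^sup>2)" using \<beta> den_pos by (intro mult_right_mono) auto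
    then show "\<beta> * (1 + \<epsilon> * L) * (1 + \<alpha>\<^sub>2\<^sup>2) \<le> 2 * \<alpha>\<^sub>1" using r(3) by simp
  qed (use assms r \<beta> \<open>\<epsilon> > 0\<close> in \<open>auto simp: \<beta>_def\<close>)
  have \<kappa>: "2 / \<kappa> > 0" using pos by simp
  show ?thesis
  proof (intro conjI impI)
    assume lip: "q-lipschitz_on UNIV F"
    have F: "\<bar>F s\<bar> \<le> q * \<bar>s\<bar>" for s
      using lipschitz_onD[OF lip, of s 0] assms(6) by (simp add: dist_real_def)
    have "solution_energy L u t \<le> (2 / \<kappa>) * exp (- \<mu> * t) * solution_energy L u 0"
      if u: "weak_solution L g F u" and t: "0 \<le> t" for u t
    proof -
      define e where "e = \<bar>solution_energy L u 0\<bar>"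
      \<comment> \<open>As \<delta> is at least \<open>1\<close>,
        \<open>\<kappa> * \<delta>\<^sup>2\<close> is at least
        \<open>\<kappa> * \<delta> = \<kappa> + 4 * e\<close>, which exceeds four times the initial
        energy.\<close>
      define \<delta> where "\<delta> = 1 + 4 * (e / \<kappa>)"
      have "e / \<kappa> \<ge> 0" using pos by (simp add: e_def)
      then have "\<delta> \<ge> 1" by (simp add: \<delta>_def)
      then have "\<kappa> * \<delta> \<le> \<kappa> * \<delta>\<^sup>2" using pos by (intro mult_left_mono) (auto simp: power2_eq_square)
      moreover have "\<kappa> * \<delta> = \<kappa> + 4 * e" using pos by (simp add: \<delta>_def field_simps)
      ultimately have "2 * solution_energy L u 0 < \<kappa> * \<delta>\<^sup>2 / 2" using pos by (simp add: e_def)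
      then show ?thesis using \<open>\<delta> \<ge> 1\<close> by (intro energy_decay[of \<delta>] F u t) auto
    qed
    then show "\<exists>M>0. \<exists>\<mu>>0. \<forall>u. weak_solution L g F u \<longrightarrow>
          (\<forall>t\<ge>0. solution_energy L u t \<le> M * exp (- \<mu> * t) * solution_energy L u 0)"
      using \<kappa> pos(3) by blast
  next
    assume "\<exists>N. 0 \<in> interior N \<and> q-lipschitz_on N F"
    then obtain N where N: "0 \<in> interior N" "q-lipschitz_on N F" by blast
    then obtain \<delta> where "\<delta> > 0" and \<delta>: "ball 0 \<delta> \<subseteq> N" by (auto simp: mem_interior)
    have F: "\<bar>F s\<bar> \<le> q * \<bar>s\<bar>" if "\<bar>s\<bar> < \<delta>" for s
    proof -
      have "s \<in> N" "0 \<in> N" using \<delta> that \<open>\<delta> > 0\<close> by (auto simp: dist_real_def subset_iff)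
      then show ?thesis using lipschitz_onD[OF N(2), of s 0] assms(6) by (simp add: dist_real_def)
    qed
    \<comment> \<open>An eighth, not a quarter: \<open>2 * R\<close> has to lie strictly below the
      threshold \<open>\<kappa> * \<delta>\<^sup>2 / 2\<close>.\<close>
    define R where "R = \<kappa> * \<delta>\<^sup>2 / 8"
    have "R > 0" using pos \<open>\<delta> > 0\<close> by (simp add: R_def)
    have "solution_energy L u t \<le> (2 / \<kappa>) * exp (- \<mu> * t) * solution_energy L u 0"
      if "weak_solution L g F u" "solution_energy L u 0 \<le> R" "0 \<le> t" for u t
      using that \<open>R > 0\<close> by (intro energy_decay[OF \<open>\<delta> > 0\<close> F]) (auto simp: R_def)
    then show "\<exists>R>0. \<exists>M>0. \<exists>\<mu>>0. \<forall>u. weak_solution L g F u \<and> solution_energy L u 0 \<le> R \<longrightarrow>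
          (\<forall>t\<ge>0. solution_energy L u t \<le> M * exp (- \<mu> * t) * solution_energy L u 0)"
      using \<open>R > 0\<close> \<kappa> pos(3) by blast
  qed
qed

end
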